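(* Let $p,k\geq1$ be integers such that $p+k\leq n$, and let $\widehat R_{p,n}$ denote the leave-$p$-out risk estimator of the $k$NN classifier. Set $$C_1=\frac{128\kappa\gamma_d}{\sqrt{2\pi}},\qquad C_2=4\gamma_d\sqrt{2\kappa},\qquad \Gamma=2\sqrt{2e}\,\max\big(\sqrt{2C_1},\,2C_2\big).$$ Then for every $1\leq p\leq n-k$: (i) for $q=2$, $$\mathbb{E}\big[(\widehat R_{p,n}-\mathbb{E}[\widehat R_{p,n}])^2\big]\leq C_1\frac{k^{3/2}}{n-p+1};$$ (ii) for every $q>2$, $$\mathbb{E}\big[|\widehat R_{p,n}-\mathbb{E}[\widehat R_{p,n}]|^q\big]\leq(C_2k)^q\Big(\frac q{n-p+1}\Big)^{q/2}.$$ Furthermore, in the particular setting where $n/2+1<p\leq n-k$: (iii) for $q=2$, $$\mathbb{E}\big[(\widehat R_{p,n}-\mathbb{E}[\widehat R_{p,n}])^2\big]\leq C_1\frac{k^{3/2}}{(n-p+1)\left\lfloor\frac n{n-p+1}\right\rfloor};$$ (iv) for every $q>2$, $$\mathbb{E}\big[|\widehat R_{p,n}-\mathbb{E}[\widehat R_{p,n}]|^q\big]\leq\Big\lfloor\frac n{n-p+1}\Big\rfloor\,\Gamma^q\,\max\left(\frac{k^{3/2}}{(n-p+1)\left\lfloor\frac n{n-p+1}\right\rfloor}\,q,\ \frac{k^2}{(n-p+1)\left\lfloor\frac n{n-p+1}\right\rfloor^2}\,q^3\right)^{q/2}.$$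
   Context: Let $\mathcal{X}\subset\mathbb{R}^d$ and let $\mathcal{D}_n=\{Z_1,\ldots,Z_n\}$, $Z_i=(X_i,Y_i)\in\mathcal{X}\times\{0,1\}$, be i.i.d. copies of a pair $(X,Y)$ with arbitrary distribution. $k$NN rule: for a sample $\mathcal{D}$ of at least $k$ labelled points and $x\in\mathbb{R}^d$, let $Y_{(1)}(x),\ldots,Y_{(k)}(x)$ be the labels of the $k$ points of the sample closest to $x$ in Euclidean norm (distance ties are broken by smallest index). Then $\mathcal{A}_k^{\mathcal{D}}(x)=1$ if $\frac1k\sum_{i=1}^kY_{(i)}(x)>\frac12$, $\mathcal{A}_k^{\mathcal{D}}(x)=0$ if $\frac1k\sum_{i=1}^kY_{(i)}(x)<\frac12$, and $\mathcal{A}_k^{\mathcal{D}}(x)$ is a Bernoulli$(1/2)$ variable otherwise (independent of the data and of the other such variables). Leave-$p$-out estimator: with $\mathcal{E}_{n-p}$ the set of subsets of $\{1,\ldots,n\}$ of cardinality $n-p$, $\bar e=\{1,\ldots,n\}\setminus e$ and $\mathcal{D}^e=\{Z_i\mid i\in e\}$, $$\widehat R_{p,n}=\binom np^{-1}\sum_{e\in\mathcal{E}_{n-p}}\Big(\frac1p\sum_{i\in\bar e}\mathbf{1}_{\{\mathcal{A}_k^{\mathcal{D}^e}(X_i)\neq Y_i\}}\Big).$$ $\gamma_d$ is the constant of Stone's lemma, depending only on $d$ (and growing exponentially with $d$): given finitely many points in $\mathbb{R}^d$ and $k\ge1$, any of these points belongs to the $k$ nearest neighbors of at most $k\gamma_d$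 of the other points. It is a standing convention that this property holds almost surely, under the tie-breaking in use, for all finite families of points drawn from the $X_i$'s and independent copies of them. $\kappa\leq1.271$ is a universal constant such that for every $q\geq2$, all independent $U_1,\ldots,U_N$ with independent copies $U_1',\ldots,U_N'$, and every measurable real function $f$, setting $\zeta=f(U_1,\ldots,U_N)$ and $\zeta_i'=f(U_1,\ldots,U_i',\ldots,U_N)$, one has $\|\zeta-\mathbb{E}\zeta\|_q\leq\sqrt{2\kappa q}\,\sqrt{\|\sum_{i=1}^N(\zeta-\zeta_i')^2\|_{q/2}}$, where $\|U\|_q=(\mathbb{E}|U|^q)^{1/q}$. *)

theory Defs
  imports "HOL-Probability.Probability"
begin

text \<open>
  A sample is a pair of families \<open>x\<close> (points) and \<open>y\<close> (labels) indexed by natural numbers, and a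
  subsample is given by its index set \<open>e\<close>. Points are ranked by the lexicographic order on
  (distance to \<open>u\<close>, index), so distance ties are broken by smallest index.
\<close>

definition knn :: "nat \<Rightarrow> (nat \<Rightarrow> real ^ 'd) \<Rightarrow> nat set \<Rightarrow> real ^ 'd \<Rightarrow> nat set" where
  "knn k x e u =
     {i \<in> e. card {j \<in> e. norm (x j - u) < norm (x i - u)
                        \<or> (norm (x j - u) = norm (x i - u) \<and> j < i)} < k}"

text \<open>The argument \<open>b\<close> is the outcome of the fair coin that is used when the vote is tied.\<close>

definition knn_classifier ::
    "nat \<Rightarrow> (nat \<Rightarrow> real ^ 'd) \<Rightarrow> (nat \<Rightarrow> nat) \<Rightarrow> nat set \<Rightarrow> nat \<Rightarrow> real ^ 'd \<Rightarrow> nat" where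
  "knn_classifier k x y e b u =
     (let v = (1 / real k) * (\<Sum>i\<in>knn k x e u. real (y i))
      in if v > 1/2 then 1 else if v < 1/2 then 0 else b)"

definition training_sets :: "nat \<Rightarrow> nat \<Rightarrow> nat set set" where
  "training_sets n p = {e. e \<subseteq> {1..n} \<and> card e = n - p}"

text \<open>
  The prediction at \<open>x i\<close> by the classifier trained on \<open>e\<close> has its own coin \<open>b e i\<close>; the coins in
  use are those indexed by \<open>coin_index n p\<close>.
\<close>

definition coin_index :: "nat \<Rightarrow> nat \<Rightarrow> (nat set \<times> nat) set" where
  "coin_index n p = (SIGMA e:training_sets n p. {1..n} - e)"

definition lpo_risk ::
    "nat \<Rightarrow> nat \<Rightarrow> nat \<Rightarrow> (nat \<Rightarrow> real ^ 'd) \<Rightarrow> (nat \<Rightarrow> nat) \<Rightarrow> (nat set \<Rightarrow> nat \<Rightarrow> nat) \<Rightarrow> real" where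
  "lpo_risk k p n x y b =
     (1 / real (n choose p)) *
     (\<Sum>e\<in>training_sets n p.
        (1 / real p) *
        (\<Sum>i\<in>{1..n} - e. of_bool (knn_classifier k x y e (b e i) (x i) \<noteq> y i)))"

text \<open>
  Stone's property with constant \<open>\<gamma>\<close>, for independent points drawn from \<open>\<nu>\<close>: almost surely, each
  point is among the \<open>k\<close> nearest neighbours of at most \<open>k * \<gamma>\<close> of the other points, the neighbours
  of the point \<open>j\<close> being taken among the points other than \<open>j\<close>. The property cannot be
  required of all deterministic families, because it fails for coinciding points under
  tie-breaking by index.
\<close>

definition stone_constant :: "(real ^ 'd) measure \<Rightarrow> real \<Rightarrow> bool" where
  "stone_constant \<nu> \<gamma> \<longleftrightarrow>
     (\<forall>I :: nat set. finite I \<longrightarrow>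
        (AE x in Pi\<^sub>M I (\<lambda>_. \<nu>). \<forall>k\<ge>1. \<forall>i\<in>I.
           real (card {j \<in> I - {i}. i \<in> knn k x (I - {j}) (x j)}) \<le> real k * \<gamma>))"

definition Lq_norm :: "real \<Rightarrow> 'a measure \<Rightarrow> ('a \<Rightarrow> real) \<Rightarrow> real" where
  "Lq_norm q M f = (\<integral>w. \<bar>f w\<bar> powr q \<partial>M) powr (1 / q)"

text \<open>
  The generalised Efron-Stein inequality with constant \<open>\<kappa>\<close>. The independent variables are
  the coordinates \<open>u i\<close>, with arbitrary laws \<open>\<mu> i\<close> on the type \<open>'u\<close>, and their independent copies
  are the coordinates \<open>u' i\<close> of a second factor of the product. Membership of
  \<open>\<zeta> = f u\<close> in \<open>L\<^sup>q\<close> is required because the Bochner integral of a non-integrable function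
  is \<open>0\<close>, which would make the inequality false for every \<open>\<kappa>\<close>.
\<close>

definition efron_stein_constant :: "'u itself \<Rightarrow> real \<Rightarrow> bool" where
  "efron_stein_constant _ \<kappa> \<longleftrightarrow>
     (\<forall>(N :: nat) (\<mu> :: nat \<Rightarrow> 'u measure) (f :: (nat \<Rightarrow> 'u) \<Rightarrow> real) (q :: real).
        (\<forall>i\<in>{1..N}. prob_space (\<mu> i)) \<longrightarrow>
        f \<in> borel_measurable (Pi\<^sub>M {1..N} \<mu>) \<longrightarrow>
        2 \<le> q \<longrightarrow>
        integrable (Pi\<^sub>M {1..N} \<mu>) (\<lambda>u. \<bar>f u\<bar> powr q) \<longrightarrow>
        Lq_norm q (Pi\<^sub>M {1..N} \<mu>) (\<lambda>u. f u - (\<integral>v. f v \<partial>Pi\<^sub>M {1..N} \<mu>))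
          \<le> sqrt (2 * \<kappa> * q) *
             sqrt (Lq_norm (q / 2) (Pi\<^sub>M {1..N} \<mu> \<Otimes>\<^sub>M Pi\<^sub>M {1..N} \<mu>)
                     (\<lambda>(u, u'). \<Sum>i=1..N. (f u - f (u(i := u' i)))\<^sup>2)))"

end

theory Submission
  imports Defs
begin

text \<open>
  The coins are treated as further independent coordinates, and the generalised Efron--Stein inequality is applied
  to the leave-\<open>p\<close>-out risk itself. The sum of its squared increments is at most \<open>1/n\<close>
  times the average of \<open>W v\<close> over the blocks \<open>v \<subseteq> {1..n}\<close> of size \<open>m = n
  - p + 1\<close>, where \<open>W v\<close> is essentially the mean, over the points of \<open>v\<close>, of the
  square of the number of classifications inside \<open>v\<close> that changing this point can flip. By Stone's
  lemma every changed observation is among the neighbours of at most \<open>k \<gamma>\<close> others, so \<open>W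
  v\<close> is \<open>O(\<gamma>\<^sup>2 k\<^sup>2)\<close>. A vote can be flipped only if it is tied or almost
  tied; given the \<open>(k+1)\<close>-st neighbour (ties of distance being broken by auxiliary uniform marks) the
  \<open>k\<close> labels that vote are i.i.d., so the central binomial bound turns one factor \<open>k\<close> of
  the expectation into \<open>\<surd>k\<close>. For the last bound, the average over blocks is an average, over
  permutations, of averages over disjoint and hence independent blocks, which makes exponential moments available.
\<close>

section \<open>Product measures\<close>

text \<open>A training set together with a test point outside it is a block with a marked point, so
  the leave-\<open>p\<close>-out risk is an average over blocks of leave-one-out errors; hence the
  block size \<open>n - p + 1\<close>. When the observation \<open>j\<close> changes, the votes
  before and after are both compared with the vote from which \<open>j\<close> is deleted, which
  does not see the change. A flip thus makes \<open>j\<close> pivotal in one of two configurations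
  of equal law. Summed over the \<open>j\<close> of a block, the influences become the numbers of
  pivots of single votes, and it is this sum that is bounded in expectation. In the square, one
  factor is at most of order \<open>k * \<gamma>\<close> almost surely and the other has a mean of
  order \<open>sqrt k\<close>: this is the exponent \<open>3/2\<close>. The obstacle is the
  conditioning on the \<open>(k+1)\<close>-st neighbour. For an arbitrary law, distances may tie
  with positive probability, and under the index rule the law of a preceding point then depends on
  its index. Marks without atoms restore equal laws, and since the points are exchangeable,
  replacing the index by marks does not change the mean number of pivots.\<close>

lemma distr_PiM_update:
  assumes M: "\<And>i. prob_space (M i)" and I: "finite I" "i \<in> I"
  shows "distr (PiM I M \<Otimes>\<^sub>M PiM I M) (PiM I M) (\<lambda>(u, u'). u(i := u' i)) = PiM I M"
proof -
  interpret M: prob_space "M j" for j by (rule M)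
  interpret product_sigma_finite M ..
  interpret PI: prob_space "PiM I M" by (rule prob_space_PiM) (rule M)
  have em: "emeasure (distr (PiM I M \<Otimes>\<^sub>M PiM I M) (PiM I M) (\<lambda>(u, u'). u(i := u' i))) (Pi\<^sub>E I A)
      = (\<Prod>i\<in>I. emeasure (M i) (A i))" if A: "\<And>i. i \<in> I \<Longrightarrow> A i \<in> sets (M i)" for A
  proof -
    have m: "(\<lambda>(u, u'). u(i := u' i)) \<in> measurable (PiM I M \<Otimes>\<^sub>M PiM I M) (PiM I M)"
    proof -
      have "(\<lambda>x. (fst x)(i := snd x i)) \<in> measurable (PiM I M \<Otimes>\<^sub>M PiM I M) (PiM I M)"
      proof (rule measurable_PiM_single')
        fix j assume j: "j \<in> I"
        show "(\<lambda>x. ((fst x)(i := snd x i)) j) \<in> measurable (PiM I M \<Otimes>\<^sub>M PiM I M) (M j)"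
          using j I by (cases "j = i") simp_all
      next
        show "(\<lambda>x. (fst x)(i := snd x i)) \<in> space (PiM I M \<Otimes>\<^sub>M PiM I M) \<rightarrow> (\<Pi>\<^sub>E i\<in>I. space (M i))"
          using I by (auto simp: space_pair_measure space_PiM PiE_iff extensional_def)
      qed
      then show ?thesis by (simp add: case_prod_beta')
    qed
    \<comment> \<open>The update lies in the box exactly when \<open>u\<close> satisfies the
      constraints off \<open>i\<close> and \<open>u'\<close> the one at \<open>i\<close>. The
      preimage is therefore a rectangle, and the masses of its two sides complete each
      other.\<close>
    let ?B = "\<Pi>\<^sub>E j\<in>I. (if j = i then space (M i) else A j)"
    let ?C = "\<Pi>\<^sub>E j\<in>I. (if j = i then A i else space (M j))"
    have sA: "\<And>j x. j \<in> I \<Longrightarrow> x \<in> A j \<Longrightarrow> x \<in> space (M j)"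
      using A sets.sets_into_space by blast
    have eq: "u \<in> space (PiM I M) \<and> u' \<in> space (PiM I M) \<and> u(i := u' i) \<in> Pi\<^sub>E I A \<longleftrightarrow> u \<in> ?B \<and> u' \<in> ?C"
      (is "?l = ?r") for u u'
    proof
      assume l: ?l
      then have 1: "(u(i := u' i)) j \<in> A j" if "j \<in> I" for j using that by (auto simp del: fun_upd_apply)
      have "u' i \<in> A i" using 1[of i] I by simp
      moreover have "u j \<in> A j" if "j \<in> I" "j \<noteq> i" for j using 1[of j] that by simp
      ultimately show ?r using l by (simp add: space_PiM PiE_iff)
    next
      assume r: ?r
      then have 1: "u j \<in> (if j = i then space (M i) else A j)"
        and 2: "u' j \<in> (if j = i then A i else space (M j))" if "j \<in> I" for j
        using that by (auto simp: PiE_iff)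
      have "u j \<in> space (M j)" and "u' j \<in> space (M j)" if "j \<in> I" for j
        using 1[OF that] 2[OF that] sA[of j] that by (cases "j = i"; simp)+
      moreover have "(u(i := u' i)) j \<in> A j" if "j \<in> I" for j
        using 1[OF that] 2[OF that] by (cases "j = i") simp_all
      moreover have "u(i := u' i) \<in> extensional I" using r I by (auto simp: PiE_iff extensional_def)
      ultimately show ?l using r by (simp add: space_PiM PiE_iff)
    qed
    have pre: "(\<lambda>(u, u'). u(i := u' i)) -` Pi\<^sub>E I A \<inter> space (PiM I M \<Otimes>\<^sub>M PiM I M) = ?B \<times> ?C"
    proof (rule set_eqI)
      fix z :: "('a \<Rightarrow> 'b) \<times> ('a \<Rightarrow> 'b)"
      show "z \<in> (\<lambda>(u, u'). u(i := u' i)) -` Pi\<^sub>E I A \<inter> space (PiM I M \<Otimes>\<^sub>M PiM I M) \<longleftrightarrow> z \<in> ?B \<times> ?C"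
        unfolding space_pair_measure mem_Times_iff case_prod_beta' vimage_eq Int_iff eq[of "fst z" "snd z", symmetric]
        by (rule iffI; elim conjE; intro conjI)
    qed
    have Bs: "(if j = i then space (M i) else A j) \<in> sets (M j)" if "j \<in> I" for j
      using A[OF that] by simp
    have Cs: "(if j = i then A i else space (M j)) \<in> sets (M j)" if "j \<in> I" for j
      using A[OF I(2)] by simp
    have B: "emeasure (PiM I M) ?B = (\<Prod>j\<in>I. if j = i then 1 else emeasure (M j) (A j))"
    proof -
      have "emeasure (PiM I M) ?B = (\<Prod>j\<in>I. emeasure (M j) (if j = i then space (M i) else A j))"
        by (intro emeasure_PiM I Bs)
      then show ?thesis by (auto intro!: prod.cong simp: M.emeasure_space_1)
    qed
    have C: "emeasure (PiM I M) ?C = (\<Prod>j\<in>I. if j = i then emeasure (M i) (A i) else 1)"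
    proof -
      have "emeasure (PiM I M) ?C = (\<Prod>j\<in>I. emeasure (M j) (if j = i then A i else space (M j)))"
        by (intro emeasure_PiM I Cs)
      then show ?thesis by (auto intro!: prod.cong simp: M.emeasure_space_1)
    qed
    have "emeasure (distr (PiM I M \<Otimes>\<^sub>M PiM I M) (PiM I M) (\<lambda>(u, u'). u(i := u' i))) (Pi\<^sub>E I A)
        = emeasure (PiM I M \<Otimes>\<^sub>M PiM I M) (?B \<times> ?C)"
      by (subst emeasure_distr[OF m]) (simp_all only: pre sets_PiM_I_finite[OF I(1) A])
    also have "\<dots> = emeasure (PiM I M) ?B * emeasure (PiM I M) ?C"
      by (intro PI.emeasure_pair_measure_Times sets_PiM_I_finite I Bs Cs)
    also have "\<dots> = (\<Prod>i\<in>I. emeasure (M i) (A i))"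
      unfolding B C prod.distrib[symmetric] by (intro prod.cong refl) simp
    finally show ?thesis .
  qed
  show ?thesis
    by (rule PiM_eqI[OF I(1) _ em]) simp_all
qed

text \<open>Used to attach a mark to every sample point: drawing all marks and then all points
  amounts to drawing marked points independently.\<close>

lemma distr_PiM_pair:
  assumes M: "\<And>i. prob_space (M i)" and N: "\<And>i. prob_space (N i)" and I: "finite I"
  shows "distr (PiM I M \<Otimes>\<^sub>M PiM I N) (\<Pi>\<^sub>M i\<in>I. M i \<Otimes>\<^sub>M N i) (\<lambda>(u, v). \<lambda>i\<in>I. (u i, v i))
    = (\<Pi>\<^sub>M i\<in>I. M i \<Otimes>\<^sub>M N i)"
proof -
  interpret M: prob_space "M j" for j by (rule M)
  interpret N: prob_space "N j" for j by (rule N)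
  interpret MN: prob_space "M j \<Otimes>\<^sub>M N j" for j
    by (intro prob_space_pair M N)
  interpret PM: product_sigma_finite M ..
  interpret PN': product_sigma_finite N ..
  interpret PMN: product_sigma_finite "\<lambda>i. M i \<Otimes>\<^sub>M N i" ..
  interpret PN: prob_space "PiM I N" by (rule prob_space_PiM) (rule N)
  let ?f = "\<lambda>(u, v). \<lambda>i\<in>I. (u i, v i)"
  show ?thesis
  proof (rule PMN.PiM_eqI)
    show "finite I" by fact
    show "sets (distr (PiM I M \<Otimes>\<^sub>M PiM I N) (\<Pi>\<^sub>M i\<in>I. M i \<Otimes>\<^sub>M N i) ?f) = sets (\<Pi>\<^sub>M i\<in>I. M i \<Otimes>\<^sub>M N i)"
      by simp
    fix A assume A: "\<And>i. i \<in> I \<Longrightarrow> A i \<in> sets (M i \<Otimes>\<^sub>M N i)"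
    have f: "?f \<in> measurable (PiM I M \<Otimes>\<^sub>M PiM I N) (\<Pi>\<^sub>M i\<in>I. M i \<Otimes>\<^sub>M N i)"
      unfolding case_prod_beta' by (intro measurable_restrict) simp
    have ind: "indicator (?f -` Pi\<^sub>E I A \<inter> space (PiM I M \<Otimes>\<^sub>M PiM I N)) (u, v)
        = (\<Prod>i\<in>I. indicator (A i) (u i, v i) :: ennreal)"
      if "u \<in> space (PiM I M)" "v \<in> space (PiM I N)" for u v
      using that I by (auto simp: indicator_def PiE_iff space_pair_measure)
    have mA: "(\<lambda>y. indicator (A i) (x, y) :: ennreal) \<in> borel_measurable (N i)"
      if "i \<in> I" "x \<in> space (M i)" for i x
      using that A by measurable
    have "emeasure (distr (PiM I M \<Otimes>\<^sub>M PiM I N) (\<Pi>\<^sub>M i\<in>I. M i \<Otimes>\<^sub>M N i) ?f) (Pi\<^sub>E I A)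
        = emeasure (PiM I M \<Otimes>\<^sub>M PiM I N) (?f -` Pi\<^sub>E I A \<inter> space (PiM I M \<Otimes>\<^sub>M PiM I N))"
      using A I by (intro emeasure_distr f sets_PiM_I_finite)
    also have "\<dots> = (\<integral>\<^sup>+u. \<integral>\<^sup>+v. indicator (?f -` Pi\<^sub>E I A \<inter> space (PiM I M \<Otimes>\<^sub>M PiM I N)) (u, v) \<partial>PiM I N \<partial>PiM I M)"
      using A I by (intro PN.emeasure_pair_measure measurable_sets[OF f] sets_PiM_I_finite)
    also have "\<dots> = (\<integral>\<^sup>+u. \<integral>\<^sup>+v. (\<Prod>i\<in>I. indicator (A i) (u i, v i)) \<partial>PiM I N \<partial>PiM I M)"
      by (intro nn_integral_cong) (simp add: ind)
    also have "\<dots> = (\<integral>\<^sup>+u. (\<Prod>i\<in>I. \<integral>\<^sup>+y. indicator (A i) (u i, y) \<partial>N i) \<partial>PiM I M)"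
      using I by (intro nn_integral_cong PN'.product_nn_integral_prod mA) (auto simp: space_PiM)
    also have "\<dots> = (\<Prod>i\<in>I. \<integral>\<^sup>+x. \<integral>\<^sup>+y. indicator (A i) (x, y) \<partial>N i \<partial>M i)"
      using I A by (intro PM.product_nn_integral_prod N.borel_measurable_nn_integral) (auto simp: case_prod_beta')
    also have "\<dots> = (\<Prod>i\<in>I. emeasure (M i \<Otimes>\<^sub>M N i) (A i))"
      using A by (intro prod.cong refl N.emeasure_pair_measure[symmetric])
    finally show "emeasure (distr (PiM I M \<Otimes>\<^sub>M PiM I N) (\<Pi>\<^sub>M i\<in>I. M i \<Otimes>\<^sub>M N i) ?f) (Pi\<^sub>E I A)
        = (\<Prod>i\<in>I. emeasure (M i \<Otimes>\<^sub>M N i) (A i))" .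
  qed
qed

text \<open>Split \<open>I\<close> into the coordinates in \<open>A\<close> and the others. By
  Fubini, \<open>f\<close> is constant in the second variable and \<open>g\<close> in the first, so
  the double integral factors.\<close>

lemma nn_integral_PiM_mult_disjoint:
  fixes f g :: "('i \<Rightarrow> 'a) \<Rightarrow> ennreal"
  assumes M: "\<And>i. prob_space (M i)" and I: "finite I"
    and f[measurable]: "f \<in> borel_measurable (PiM I M)" and g[measurable]: "g \<in> borel_measurable (PiM I M)"
    and AB: "A \<inter> B = {}"
    and fA: "\<And>u v. \<lbrakk>u \<in> space (PiM I M); v \<in> space (PiM I M); \<And>i. i \<in> A \<Longrightarrow> u i = v i\<rbrakk> \<Longrightarrow> f u = f v"
    and gB: "\<And>u v. \<lbrakk>u \<in> space (PiM I M); v \<in> space (PiM I M); \<And>i. i \<in> B \<Longrightarrow> u i = v i\<rbrakk> \<Longrightarrow> g u = g v"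
  shows "(\<integral>\<^sup>+u. f u * g u \<partial>PiM I M) = (\<integral>\<^sup>+u. f u \<partial>PiM I M) * (\<integral>\<^sup>+u. g u \<partial>PiM I M)"
proof -
  interpret M: prob_space "M j" for j by (rule M)
  interpret product_sigma_finite M ..
  define J where "J = I \<inter> A"
  define L where "L = I - A"
  have IJL: "I = J \<union> L" "J \<inter> L = {}" "finite J" "finite L" using I by (auto simp: J_def L_def)
  interpret PJ: prob_space "PiM J M" by (rule prob_space_PiM) (rule M)
  interpret PL: prob_space "PiM L M" by (rule prob_space_PiM) (rule M)
  \<comment> \<open>\<open>x0\<close> and \<open>y0\<close> merely fill the coordinates that the
    function in question does not see.\<close>
  obtain x0 where x0: "x0 \<in> space (PiM J M)" using PJ.not_empty by blast
  obtain y0 where y0: "y0 \<in> space (PiM L M)" using PL.not_empty by blast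
  have mg: "merge J L (x, y) \<in> space (PiM I M)" if "x \<in> space (PiM J M)" "y \<in> space (PiM L M)" for x y
    using that measurable_space[OF measurable_merge, of "(x,y)" J M L] IJL(1) by (simp add: space_pair_measure)
  have f': "f (merge J L (x, y)) = f (merge J L (x, y0))"
    if "x \<in> space (PiM J M)" "y \<in> space (PiM L M)" for x y
    using that y0 by (intro fA mg) (auto simp: merge_def L_def)
  have g': "g (merge J L (x, y)) = g (merge J L (x0, y))"
    if "x \<in> space (PiM J M)" "y \<in> space (PiM L M)" for x y
    using that x0 AB by (intro gB mg) (auto simp: merge_def J_def)
  have mf: "f \<in> borel_measurable (PiM (J \<union> L) M)" and mg': "g \<in> borel_measurable (PiM (J \<union> L) M)"
    using f g IJL(1) by simp_all
  have mf0: "(\<lambda>x. f (merge J L (x, y0))) \<in> borel_measurable (PiM J M)"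
    by (rule measurable_compose[OF _ mf]) (rule measurable_compose[OF _ measurable_merge], use y0 in simp)
  have mg0: "(\<lambda>y. g (merge J L (x0, y))) \<in> borel_measurable (PiM L M)"
    by (rule measurable_compose[OF _ mg']) (rule measurable_compose[OF _ measurable_merge], use x0 in simp)
  have "(\<integral>\<^sup>+u. f u * g u \<partial>PiM I M) = (\<integral>\<^sup>+x. \<integral>\<^sup>+y. f (merge J L (x, y)) * g (merge J L (x, y)) \<partial>PiM L M \<partial>PiM J M)"
    unfolding IJL(1) using mf mg' IJL by (intro product_nn_integral_fold) auto
  also have "\<dots> = (\<integral>\<^sup>+x. \<integral>\<^sup>+y. f (merge J L (x, y0)) * g (merge J L (x0, y)) \<partial>PiM L M \<partial>PiM J M)"
    by (intro nn_integral_cong arg_cong2[where f = "(*)"] f' g')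
  also have "\<dots> = (\<integral>\<^sup>+x. f (merge J L (x, y0)) \<partial>PiM J M) * (\<integral>\<^sup>+y. g (merge J L (x0, y)) \<partial>PiM L M)"
    by (simp add: nn_integral_cmult nn_integral_multc mf0 mg0)
  also have "(\<integral>\<^sup>+x. f (merge J L (x, y0)) \<partial>PiM J M) = (\<integral>\<^sup>+u. f u \<partial>PiM I M)"
  proof -
    have "(\<integral>\<^sup>+u. f u \<partial>PiM I M) = (\<integral>\<^sup>+x. \<integral>\<^sup>+y. f (merge J L (x, y)) \<partial>PiM L M \<partial>PiM J M)"
      unfolding IJL(1) using mf IJL by (intro product_nn_integral_fold) auto
    also have "\<dots> = (\<integral>\<^sup>+x. \<integral>\<^sup>+y. f (merge J L (x, y0)) \<partial>PiM L M \<partial>PiM J M)"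
      by (intro nn_integral_cong f')
    finally show ?thesis by (simp add: PL.emeasure_space_1)
  qed
  also have "(\<integral>\<^sup>+y. g (merge J L (x0, y)) \<partial>PiM L M) = (\<integral>\<^sup>+u. g u \<partial>PiM I M)"
  proof -
    have "(\<integral>\<^sup>+u. g u \<partial>PiM I M) = (\<integral>\<^sup>+x. \<integral>\<^sup>+y. g (merge J L (x, y)) \<partial>PiM L M \<partial>PiM J M)"
      unfolding IJL(1) using mg' IJL by (intro product_nn_integral_fold) auto
    also have "\<dots> = (\<integral>\<^sup>+x. \<integral>\<^sup>+y. g (merge J L (x0, y)) \<partial>PiM L M \<partial>PiM J M)"
      by (intro nn_integral_cong g')
    finally show ?thesis by (simp add: PJ.emeasure_space_1)
  qed
  finally show ?thesis .
qed

lemma nn_integral_PiM_prod_disjoint: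
  fixes f :: "'l \<Rightarrow> ('i \<Rightarrow> 'a) \<Rightarrow> ennreal"
  assumes M: "\<And>i. prob_space (M i)" and I: "finite I" and L: "finite L"
    and f: "\<And>l. l \<in> L \<Longrightarrow> f l \<in> borel_measurable (PiM I M)"
    and K: "disjoint_family_on K L"
    and fK: "\<And>l u v. \<lbrakk>l \<in> L; u \<in> space (PiM I M); v \<in> space (PiM I M); \<And>i. i \<in> K l \<Longrightarrow> u i = v i\<rbrakk>
      \<Longrightarrow> f l u = f l v"
  shows "(\<integral>\<^sup>+u. (\<Prod>l\<in>L. f l u) \<partial>PiM I M) = (\<Prod>l\<in>L. \<integral>\<^sup>+u. f l u \<partial>PiM I M)"
  using L f K fK
proof (induction L)
  case empty
  interpret M: prob_space "M j" for j by (rule M)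
  interpret product_sigma_finite M ..
  interpret PI: prob_space "PiM I M" by (rule prob_space_PiM) (rule M)
  show ?case by (simp add: PI.emeasure_space_1)
next
  case (insert l L)
  have K': "K l \<inter> (\<Union>i\<in>L. K i) = {}"
    using insert.prems(2) insert.hyps by (auto simp: disjoint_family_on_def)
  have "(\<integral>\<^sup>+u. (\<Prod>l\<in>insert l L. f l u) \<partial>PiM I M) = (\<integral>\<^sup>+u. f l u * (\<Prod>l\<in>L. f l u) \<partial>PiM I M)"
    using insert.hyps by simp
  also have "\<dots> = (\<integral>\<^sup>+u. f l u \<partial>PiM I M) * (\<integral>\<^sup>+u. (\<Prod>l\<in>L. f l u) \<partial>PiM I M)"
  proof (rule nn_integral_PiM_mult_disjoint[OF M I _ _ K'])
    show "f l \<in> borel_measurable (PiM I M)" using insert.prems by simp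
    show "(\<lambda>u. \<Prod>l\<in>L. f l u) \<in> borel_measurable (PiM I M)" using insert.prems by simp
    show "f l u = f l v" if "u \<in> space (PiM I M)" "v \<in> space (PiM I M)" "\<And>i. i \<in> K l \<Longrightarrow> u i = v i" for u v
      by (rule insert.prems(3)) (simp_all add: that)
    show "(\<Prod>l\<in>L. f l u) = (\<Prod>l\<in>L. f l v)"
      if "u \<in> space (PiM I M)" "v \<in> space (PiM I M)" "\<And>i. i \<in> (\<Union>i\<in>L. K i) \<Longrightarrow> u i = v i" for u v
    proof (rule prod.cong[OF refl])
      fix x assume "x \<in> L"
      then show "f x u = f x v"
        by (intro insert.prems(3)[of x]) (use that in \<open>blast+\<close>)
    qed
  qed
  also have "(\<integral>\<^sup>+u. (\<Prod>l\<in>L. f l u) \<partial>PiM I M) = (\<Prod>l\<in>L. \<integral>\<^sup>+u. f l u \<partial>PiM I M)"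
  proof (rule insert.IH)
    show "disjoint_family_on K L"
      using insert.prems(2) by (rule disjoint_family_on_mono[rotated]) blast
    show "f l u = f l v" if "l \<in> L" "u \<in> space (PiM I M)" "v \<in> space (PiM I M)" "\<And>i. i \<in> K l \<Longrightarrow> u i = v i" for l u v
      by (rule insert.prems(3)) (simp_all add: that)
  qed (simp add: insert.prems(1))
  finally show ?case using insert.hyps by simp
qed

text \<open>The functions \<open>W v\<close> below take a configuration and an independent copy of
  it. Both are read on the same index set \<open>K l\<close>, so the product rule applies to the
  inner integral and then to the outer one.\<close>

lemma nn_integral_PiM_pair_prod_disjoint:
  fixes f :: "'l \<Rightarrow> ('i \<Rightarrow> 'a) \<Rightarrow> ('i \<Rightarrow> 'a) \<Rightarrow> ennreal"
  assumes M: "\<And>i. prob_space (M i)" and I: "finite I" and L: "finite L"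
    and f: "\<And>l. l \<in> L \<Longrightarrow> (\<lambda>(u, v). f l u v) \<in> borel_measurable (PiM I M \<Otimes>\<^sub>M PiM I M)"
    and K: "disjoint_family_on K L"
    and fK: "\<And>l u v u' v'. \<lbrakk>l \<in> L; u \<in> space (PiM I M); v \<in> space (PiM I M); u' \<in> space (PiM I M);
        v' \<in> space (PiM I M); \<And>i. i \<in> K l \<Longrightarrow> u i = v i; \<And>i. i \<in> K l \<Longrightarrow> u' i = v' i\<rbrakk>
      \<Longrightarrow> f l u u' = f l v v'"
  shows "(\<integral>\<^sup>+(u, u'). (\<Prod>l\<in>L. f l u u') \<partial>(PiM I M \<Otimes>\<^sub>M PiM I M))
    = (\<Prod>l\<in>L. \<integral>\<^sup>+(u, u'). f l u u' \<partial>(PiM I M \<Otimes>\<^sub>M PiM I M))"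
proof -
  interpret M: prob_space "M j" for j by (rule M)
  interpret product_sigma_finite M ..
  interpret PI: prob_space "PiM I M" by (rule prob_space_PiM) (rule M)
  have f1: "f l u \<in> borel_measurable (PiM I M)" if "l \<in> L" "u \<in> space (PiM I M)" for l u
    using measurable_compose[OF measurable_Pair1'[OF that(2)] f[OF that(1)]] by simp
  have f2: "(\<lambda>u. \<integral>\<^sup>+u'. f l u u' \<partial>PiM I M) \<in> borel_measurable (PiM I M)" if "l \<in> L" for l
    using PI.borel_measurable_nn_integral_fst[OF f[OF that]] by simp
  have mp: "(\<lambda>(u, u'). \<Prod>l\<in>L. f l u u') \<in> borel_measurable (PiM I M \<Otimes>\<^sub>M PiM I M)"
    using f by (simp add: case_prod_beta')
  have "(\<integral>\<^sup>+(u, u'). (\<Prod>l\<in>L. f l u u') \<partial>(PiM I M \<Otimes>\<^sub>M PiM I M))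
      = (\<integral>\<^sup>+u. \<integral>\<^sup>+u'. (\<Prod>l\<in>L. f l u u') \<partial>PiM I M \<partial>PiM I M)"
    using PI.nn_integral_fst[OF mp] by simp
  also have "\<dots> = (\<integral>\<^sup>+u. (\<Prod>l\<in>L. \<integral>\<^sup>+u'. f l u u' \<partial>PiM I M) \<partial>PiM I M)"
  proof (rule nn_integral_cong)
    fix u assume u: "u \<in> space (PiM I M)"
    show "(\<integral>\<^sup>+u'. (\<Prod>l\<in>L. f l u u') \<partial>PiM I M) = (\<Prod>l\<in>L. \<integral>\<^sup>+u'. f l u u' \<partial>PiM I M)"
      by (rule nn_integral_PiM_prod_disjoint[OF M I L f1[OF _ u] K]) (assumption | rule fK u refl)+
  qed
  also have "\<dots> = (\<Prod>l\<in>L. \<integral>\<^sup>+u. \<integral>\<^sup>+u'. f l u u' \<partial>PiM I M \<partial>PiM I M)"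
  proof (rule nn_integral_PiM_prod_disjoint[OF M I L f2 K])
    fix l u v assume "l \<in> L" "u \<in> space (PiM I M)" "v \<in> space (PiM I M)" "\<And>i. i \<in> K l \<Longrightarrow> u i = v i"
    then show "(\<integral>\<^sup>+u'. f l u u' \<partial>PiM I M) = (\<integral>\<^sup>+u'. f l v u' \<partial>PiM I M)"
      by (intro nn_integral_cong) (rule fK, (assumption | rule refl)+)
  qed
  also have "\<dots> = (\<Prod>l\<in>L. \<integral>\<^sup>+(u, u'). f l u u' \<partial>(PiM I M \<Otimes>\<^sub>M PiM I M))"
    by (intro prod.cong refl) (simp add: PI.nn_integral_fst[OF f, simplified])
  finally show ?thesis .
qed

section \<open>Votes in a finite ordered sample\<close>

text \<open>Neighbourhoods and votes for an arbitrary order \<open>lt\<close>, so that ties can be broken by other keys than the index.\<close>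

definition nearest :: "nat \<Rightarrow> (nat \<Rightarrow> nat \<Rightarrow> bool) \<Rightarrow> nat set \<Rightarrow> nat set" where
  "nearest k lt e = {i \<in> e. card {j \<in> e. lt j i} < k}"

text \<open>The coin counts as half a vote: for \<open>b \<le> 1\<close> it decides the outcome
  exactly when twice the sum of the labels is \<open>k\<close>.\<close>

definition majority :: "nat \<Rightarrow> (nat \<Rightarrow> nat \<Rightarrow> bool) \<Rightarrow> (nat \<Rightarrow> nat) \<Rightarrow> nat set \<Rightarrow> nat \<Rightarrow> bool" where
  "majority k lt y e b \<longleftrightarrow> k < 2 * (\<Sum>i\<in>nearest k lt e. y i) + b"

text \<open>The number \<open>k\<close> of voters is kept when \<open>j\<close> is removed, so a
  removed neighbour is replaced by the next point of the order, if there is one.\<close>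

definition pivots :: "nat \<Rightarrow> (nat \<Rightarrow> nat \<Rightarrow> bool) \<Rightarrow> (nat \<Rightarrow> nat) \<Rightarrow> nat set \<Rightarrow> nat \<Rightarrow> nat" where
  "pivots k lt y e b = card {j \<in> e. majority k lt y e b \<noteq> majority k lt y (e - {j}) b}"

text \<open>The axioms are restricted to \<open>e\<close> because the lexicographic orders used
  below are total only where their keys are injective.\<close>

locale finite_order =
  fixes lt :: "nat \<Rightarrow> nat \<Rightarrow> bool" and e :: "nat set"
  assumes finite: "finite e"
    and irrefl: "\<And>a. a \<in> e \<Longrightarrow> \<not> lt a a"
    and trans: "\<And>a b c. \<lbrakk>a \<in> e; b \<in> e; c \<in> e; lt a b; lt b c\<rbrakk> \<Longrightarrow> lt a c"
    and total: "\<And>a b. \<lbrakk>a \<in> e; b \<in> e; a \<noteq> b\<rbrakk> \<Longrightarrow> lt a b \<or> lt b a"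
begin

definition below :: "nat \<Rightarrow> nat set" where
  "below c = {j \<in> e. lt j c}"

lemma below_subset: "below c \<subseteq> e" by (auto simp: below_def)

lemma finite_below [simp]: "finite (below c)"
  using finite below_subset finite_subset by blast

lemma card_below_mono: "a \<in> e \<Longrightarrow> b \<in> e \<Longrightarrow> lt a b \<Longrightarrow> card (below a) < card (below b)"
  by (intro psubset_card_mono finite_below) (auto simp: below_def dest: trans irrefl)

lemma lt_iff: "a \<in> e \<Longrightarrow> b \<in> e \<Longrightarrow> lt a b \<longleftrightarrow> card (below a) < card (below b)"
  using card_below_mono[of a b] card_below_mono[of b a] total[of a b] by fastforce

lemma inj_card_below: "inj_on (\<lambda>c. card (below c)) e"
proof (rule inj_onI, rule ccontr)
  fix a b assume "a \<in> e" "b \<in> e" "card (below a) = card (below b)" "a \<noteq> b"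
  then show False using card_below_mono[of a b] card_below_mono[of b a] total[of a b] by auto
qed

lemma card_below_less: "c \<in> e \<Longrightarrow> card (below c) < card e"
  using irrefl by (intro psubset_card_mono finite) (auto simp: below_def)

lemma ex_card_below:
  assumes "k < card e" shows "\<exists>c\<in>e. card (below c) = k"
proof -
  have "(\<lambda>c. card (below c)) ` e = {..<card e}"
    using card_below_less inj_card_below by (intro card_subset_eq) (auto simp: card_image)
  then have "k \<in> (\<lambda>c. card (below c)) ` e" using assms by simp
  then show ?thesis by blast
qed

text \<open>\<open>card (below c)\<close> is the rank counted from \<open>0\<close>; the point of
  rank \<open>k\<close> is thus the first one that does not vote.\<close>

lemma nearest_eq_below:
  assumes c: "c \<in> e" "card (below c) = k"
  shows "nearest k lt e = below c"
proof -
  have "nearest k lt e = {i \<in> e. card (below i) < k}" by (simp add: nearest_def below_def)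
  also have "\<dots> = below c" using c(2) lt_iff[OF _ c(1)] by (auto simp: below_def[of c])
  finally show ?thesis .
qed

text \<open>The removal of \<open>j\<close> lowers by one the ranks above \<open>j\<close> and no
  others. If \<open>j\<close> voted, the point of rank \<open>k\<close> is the only one to enter;
  otherwise nothing below rank \<open>k\<close> moves.\<close>

lemma nearest_remove:
  assumes c: "c \<in> e" "card (below c) = k" and j: "j \<in> e"
  shows "nearest k lt (e - {j}) = (if j \<in> below c then insert c (below c - {j}) else below c)"
proof -
  have eq: "{a \<in> e - {j}. lt a i} = below i - {j}" for i by (auto simp: below_def)
  have "nearest k lt (e - {j}) = {i \<in> e - {j}. card (below i - {j}) < k}"
    by (simp only: nearest_def eq)
  also have "\<dots> = (if j \<in> below c then insert c (below c - {j}) else below c)"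
  proof (cases "j \<in> below c")
    case True
    have "card (below i - {j}) < k \<longleftrightarrow> i \<in> insert c (below c)" if i: "i \<in> e" "i \<noteq> j" for i
    proof
      assume l: "card (below i - {j}) < k"
      show "i \<in> insert c (below c)"
      proof (rule ccontr)
        assume n: "i \<notin> insert c (below c)"
        then have "lt c i" using total[OF c(1) i(1)] i by (auto simp: below_def)
        then have "insert c (below c) \<subseteq> below i" unfolding below_def using c(1) i(1) by (blast intro: trans)
        moreover have "c \<notin> below c" using irrefl c by (auto simp: below_def)
        ultimately have "Suc k \<le> card (below i)"
          using c card_mono[of "below i" "insert c (below c)"] by simp
        then show False using l by (auto simp: card_Diff_singleton_if split: if_splits)
      qed
    next
      assume "i \<in> insert c (below c)"
      then consider "i = c" | "i \<in> below c" by auto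
      then show "card (below i - {j}) < k"
      proof cases
        case 1
        then show ?thesis using card_Diff1_less[OF finite_below True] c by simp
      next
        case 2
        then have "card (below i) < k" using c lt_iff[OF i(1) c(1)] by (simp add: below_def[of c])
        then show ?thesis using card_Diff1_le[of "below i" j] by linarith
      qed
    qed
    then have "{i \<in> e - {j}. card (below i - {j}) < k} = {i \<in> e - {j}. i \<in> insert c (below c)}"
      by blast
    moreover have "c \<noteq> j" using True irrefl[OF c(1)] by (auto simp: below_def)
    then have "{i \<in> e - {j}. i \<in> insert c (below c)} = insert c (below c - {j})"
      using c(1) below_subset[of c] by blast
    ultimately show ?thesis using True by simp
  next
    case False
    have "card (below i - {j}) < k \<longleftrightarrow> i \<in> below c" if i: "i \<in> e" "i \<noteq> j" for i
    proof
      assume l: "card (below i - {j}) < k"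
      show "i \<in> below c"
      proof (rule ccontr)
        assume n: "i \<notin> below c"
        then have "i = c \<or> lt c i" using total[OF c(1) i(1)] i by (auto simp: below_def)
        then have "below c \<subseteq> below i" unfolding below_def using c(1) i(1) by (blast intro: trans)
        then have "below c \<subseteq> below i - {j}" using False by blast
        then have "k \<le> card (below i - {j})" using c card_mono[of "below i - {j}" "below c"] by simp
        then show False using l by simp
      qed
    next
      assume "i \<in> below c"
      then have "card (below i) < k" using c lt_iff[OF i(1) c(1)] by (simp add: below_def[of c])
      then show "card (below i - {j}) < k" using card_Diff1_le[of "below i" j] by linarith
    qed
    then have "{i \<in> e - {j}. card (below i - {j}) < k} = {i \<in> e - {j}. i \<in> below c}"
      by blast
    also have "\<dots> = below c" using False below_subset[of c] by blast
    finally show ?thesis using False by simp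
  qed
  finally show ?thesis .
qed

text \<open>\<open>\<theta>\<close> is the least number of labels \<open>1\<close> for which the
  vote is \<open>1\<close>. Removing a neighbour replaces its label by \<open>y c\<close>, where
  \<open>c\<close> has rank \<open>k\<close>, and this matters only at the threshold. If
  \<open>y c = 0\<close>, the count must be \<open>\<theta>\<close> and the pivots are neighbours
  with label \<open>1\<close>; otherwise the count must be \<open>\<theta> - 1\<close> and the
  pivots are among the \<open>k + 1 - \<theta>\<close> neighbours with label \<open>0\<close>. At
  most one summand is nonzero; the sum makes it possible to fix \<open>c\<close> before
  integrating.\<close>

lemma pivots_le:
  assumes y: "\<And>a. a \<in> e \<Longrightarrow> y a \<le> 1" and b: "b \<le> 1" and k: "1 \<le> k" "k < card e"
  defines "\<theta> \<equiv> (k + 2 - b) div 2"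
  shows "pivots k lt y e b \<le> (\<Sum>c\<in>e. of_bool (card (below c) = k) *
      (if y c = 0 then \<theta> * of_bool (card {a \<in> below c. y a = 1} = \<theta>)
       else (k + 1 - \<theta>) * of_bool (card {a \<in> below c. y a = 1} = \<theta> - 1)))"
proof -
  obtain c where c: "c \<in> e" "card (below c) = k" using ex_card_below k by blast
  let ?A = "below c"
  let ?s = "\<Sum>a\<in>?A. y a"
  have yA: "y a = 0 \<or> y a = 1" if "a \<in> e" for a using y[OF that] by linarith
  have s: "?s = card {a \<in> ?A. y a = 1}"
  proof -
    have "?s = (\<Sum>a\<in>?A. of_bool (y a = 1))"
    proof (rule sum.cong[OF refl])
      fix a assume "a \<in> ?A"
      then show "y a = of_bool (y a = 1)" using yA[of a] below_subset by auto
    qed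
    also have "\<dots> = card {a \<in> ?A. y a = 1}" by (simp add: Int_def)
    finally show ?thesis .
  qed
  have sk: "?s + card {a \<in> ?A. y a = 0} = k"
  proof -
    have "?A = {a \<in> ?A. y a = 1} \<union> {a \<in> ?A. y a = 0}" using yA below_subset by blast
    then have "card ?A = card {a \<in> ?A. y a = 1} + card {a \<in> ?A. y a = 0}"
      using card_Un_disjoint[of "{a \<in> ?A. y a = 1}" "{a \<in> ?A. y a = 0}"] by fastforce
    then show ?thesis using s c by simp
  qed
  have maj: "majority k lt y e b \<longleftrightarrow> \<theta> \<le> ?s"
    using b k unfolding majority_def nearest_eq_below[OF c] \<theta>_def by linarith
  have maj': "majority k lt y (e - {j}) b \<longleftrightarrow> (if j \<in> ?A then \<theta> + y j \<le> ?s + y c else \<theta> \<le> ?s)"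
    if j: "j \<in> e" for j
  proof (cases "j \<in> ?A")
    case True
    have "c \<notin> ?A" using irrefl c by (auto simp: below_def)
    then have "(\<Sum>i\<in>nearest k lt (e - {j}). y i) + y j = ?s + y c"
      using True sum.remove[of ?A j y] by (simp add: nearest_remove[OF c j])
    then show ?thesis using True b k unfolding majority_def \<theta>_def by (auto; linarith)
  next
    case False
    then show ?thesis using b k unfolding majority_def nearest_remove[OF c j] \<theta>_def
      by simp linarith
  qed
  have "pivots k lt y e b \<le> (if y c = 0 then \<theta> * of_bool (card {a \<in> ?A. y a = 1} = \<theta>)
       else (k + 1 - \<theta>) * of_bool (card {a \<in> ?A. y a = 1} = \<theta> - 1))"
  proof (cases "y c = 0")
    case True
    have "{j \<in> e. majority k lt y e b \<noteq> majority k lt y (e - {j}) b}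
        \<subseteq> (if ?s = \<theta> then {a \<in> ?A. y a = 1} else {})"
    proof
      fix j assume "j \<in> {j \<in> e. majority k lt y e b \<noteq> majority k lt y (e - {j}) b}"
      then have j: "j \<in> e" and ne: "(\<theta> \<le> ?s) \<noteq> (if j \<in> ?A then \<theta> + y j \<le> ?s + y c else \<theta> \<le> ?s)"
        by (auto simp only: maj maj' mem_Collect_eq)
      have "j \<in> ?A" using ne by (rule contrapos_np) simp
      moreover have "y j = 1 \<and> ?s = \<theta>" using ne \<open>j \<in> ?A\<close> True yA[OF j] by auto
      ultimately show "j \<in> (if ?s = \<theta> then {a \<in> ?A. y a = 1} else {})" by simp
    qed
    then have "pivots k lt y e b \<le> card (if ?s = \<theta> then {a \<in> ?A. y a = 1} else {})"
      unfolding pivots_def by (intro card_mono) auto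
    then show ?thesis using True s by (auto split: if_splits)
  next
    case False
    have "{j \<in> e. majority k lt y e b \<noteq> majority k lt y (e - {j}) b}
        \<subseteq> (if Suc ?s = \<theta> then {a \<in> ?A. y a = 0} else {})"
    proof
      fix j assume "j \<in> {j \<in> e. majority k lt y e b \<noteq> majority k lt y (e - {j}) b}"
      then have j: "j \<in> e" and ne: "(\<theta> \<le> ?s) \<noteq> (if j \<in> ?A then \<theta> + y j \<le> ?s + y c else \<theta> \<le> ?s)"
        by (auto simp only: maj maj' mem_Collect_eq)
      have "j \<in> ?A" using ne by (rule contrapos_np) simp
      moreover have "y j = 0 \<and> Suc ?s = \<theta>"
        using ne \<open>j \<in> ?A\<close> False yA[OF j] yA[OF c(1)] by auto
      ultimately show "j \<in> (if Suc ?s = \<theta> then {a \<in> ?A. y a = 0} else {})" by simp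
    qed
    then have "pivots k lt y e b \<le> card (if Suc ?s = \<theta> then {a \<in> ?A. y a = 0} else {})"
      unfolding pivots_def by (intro card_mono) auto
    then show ?thesis using False s sk by (auto split: if_splits)
  qed
  also have "\<dots> = of_bool (card ?A = k) * (if y c = 0 then \<theta> * of_bool (card {a \<in> ?A. y a = 1} = \<theta>)
       else (k + 1 - \<theta>) * of_bool (card {a \<in> ?A. y a = 1} = \<theta> - 1))" using c by simp
  also have "\<dots> \<le> (\<Sum>c\<in>e. of_bool (card (below c) = k) *
      (if y c = 0 then \<theta> * of_bool (card {a \<in> below c. y a = 1} = \<theta>)
       else (k + 1 - \<theta>) * of_bool (card {a \<in> below c. y a = 1} = \<theta> - 1)))"
    by (rule member_le_sum[OF c(1)]) (simp_all add: finite)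
  finally show ?thesis .
qed

text \<open>Here every point votes and nobody replaces a removed one, while the threshold stays at
  \<open>\<theta>\<close>: only the loss of a label \<open>1\<close> can change the outcome. Within
  blocks this case occurs for \<open>p + k = n\<close>.\<close>

lemma pivots_le_full:
  assumes y: "\<And>a. a \<in> e \<Longrightarrow> y a \<le> 1" and b: "b \<le> 1" and k: "1 \<le> k" "k = card e"
  defines "\<theta> \<equiv> (k + 2 - b) div 2"
  shows "pivots k lt y e b \<le> \<theta> * of_bool (card {a \<in> e. y a = 1} = \<theta>)"
proof -
  have yA: "y a = 0 \<or> y a = 1" if "a \<in> e" for a using y[OF that] by linarith
  let ?s = "\<Sum>a\<in>e. y a"
  have s: "?s = card {a \<in> e. y a = 1}"
  proof -
    have "?s = (\<Sum>a\<in>e. of_bool (y a = 1))"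
    proof (rule sum.cong[OF refl])
      fix a assume "a \<in> e"
      then show "y a = of_bool (y a = 1)" using yA[of a] by auto
    qed
    also have "\<dots> = card {a \<in> e. y a = 1}" using finite by (simp add: Int_def)
    finally show ?thesis .
  qed
  have "nearest k lt e = e"
    using card_below_less by (auto simp: nearest_def below_def k)
  then have "majority k lt y e b \<longleftrightarrow> k < 2 * ?s + b" by (simp add: majority_def)
  then have maj: "majority k lt y e b \<longleftrightarrow> \<theta> \<le> ?s"
    using b k(1) unfolding \<theta>_def by linarith
  have maj': "majority k lt y (e - {j}) b \<longleftrightarrow> \<theta> + y j \<le> ?s" if j: "j \<in> e" for j
  proof -
    have "card {a \<in> e - {j}. lt a i} < k" if "i \<in> e" for i
    proof -
      have "card {a \<in> e - {j}. lt a i} \<le> card (below i)"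
        by (intro card_mono) (auto simp: below_def finite)
      then show ?thesis using card_below_less[OF that] k by simp
    qed
    then have "nearest k lt (e - {j}) = e - {j}" by (auto simp: nearest_def)
    moreover have "?s = y j + (\<Sum>a\<in>e - {j}. y a)" using finite j by (rule sum.remove)
    ultimately have "majority k lt y (e - {j}) b \<longleftrightarrow> k + 2 * y j < 2 * ?s + b"
      by (simp add: majority_def)
    then show ?thesis using b k(1) unfolding \<theta>_def by linarith
  qed
  have "{j \<in> e. majority k lt y e b \<noteq> majority k lt y (e - {j}) b}
      \<subseteq> (if ?s = \<theta> then {a \<in> e. y a = 1} else {})"
  proof
    fix j assume "j \<in> {j \<in> e. majority k lt y e b \<noteq> majority k lt y (e - {j}) b}"
    then have j: "j \<in> e" and ne: "(\<theta> \<le> ?s) \<noteq> (\<theta> + y j \<le> ?s)"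
      by (auto simp only: maj maj' mem_Collect_eq)
    then have "y j = 1 \<and> ?s = \<theta>" using yA[OF j] by auto
    then show "j \<in> (if ?s = \<theta> then {a \<in> e. y a = 1} else {})" using j by simp
  qed
  then have "pivots k lt y e b \<le> card (if ?s = \<theta> then {a \<in> e. y a = 1} else {})"
    unfolding pivots_def using finite by (intro card_mono) auto
  then show ?thesis using s by (auto split: if_splits)
qed

end

section \<open>Binomial probabilities\<close>

text \<open>Squaring removes the root from \<open>central_binomial_le_sqrt\<close>. By the recursion
  of the central binomial coefficients, the induction step then reduces to
  \<open>(2s+1)(2s+3) \<le> (2s+2)^2\<close>.\<close>

lemma central_binomial_le: "(2 * real s + 1) * (real (2 * s choose s))\<^sup>2 \<le> 16 ^ s"
proof (induction s)
  case 0
  then show ?case by simp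
next
  case (Suc s)
  let ?c = "real (2 * s choose s)" and ?d = "real (2 * Suc s choose Suc s)"
  have e1: "(2 * Suc s choose Suc s) = 2 * (Suc (2 * s) choose Suc s)"
  proof -
    have "(2 * Suc s choose Suc s) = (Suc (2 * s) choose s) + (Suc (2 * s) choose Suc s)" by simp
    also have "(Suc (2 * s) choose s) = (Suc (2 * s) choose Suc s)"
      by (subst binomial_symmetric) auto
    finally show ?thesis by simp
  qed
  have e2: "Suc (2 * s) * (2 * s choose s) = (Suc (2 * s) choose Suc s) * Suc s"
    by (rule Suc_times_binomial_eq)
  have "real (Suc s * (2 * Suc s choose Suc s)) = real (2 * (Suc (2 * s) * (2 * s choose s)))"
    unfolding e1 e2 by (simp only: ac_simps)
  then have "real (Suc s) * ?d = 2 * (real (Suc (2 * s)) * ?c)"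
    by (simp only: of_nat_mult of_nat_numeral)
  moreover have "real (Suc s) = real s + 1" "real (Suc (2 * s)) = 2 * real s + 1" by simp_all
  ultimately have d: "(real s + 1) * ?d = 2 * (2 * real s + 1) * ?c"
    by (simp only: mult.assoc)
  have "(real s + 1)\<^sup>2 * ((2 * real s + 3) * ?d\<^sup>2) = (2 * real s + 3) * ((real s + 1) * ?d)\<^sup>2"
    by (simp add: power_mult_distrib)
  also have "\<dots> = 4 * ((2 * real s + 3) * (2 * real s + 1)) * ((2 * real s + 1) * ?c\<^sup>2)"
    unfolding d power_mult_distrib by (simp add: power2_eq_square field_simps)
  also have "\<dots> \<le> 4 * ((2 * real s + 3) * (2 * real s + 1)) * 16 ^ s"
    using Suc by (intro mult_left_mono) auto
  also have "\<dots> \<le> 4 * (4 * (real s + 1)\<^sup>2) * 16 ^ s"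
  proof (intro mult_right_mono mult_left_mono)
    show "(2 * real s + 3) * (2 * real s + 1) \<le> 4 * (real s + 1)\<^sup>2"
      by (simp add: power2_eq_square algebra_simps)
  qed simp_all
  finally have "(real s + 1)\<^sup>2 * ((2 * real s + 3) * ?d\<^sup>2) \<le> (real s + 1)\<^sup>2 * (16 * 16 ^ s)"
    by simp
  then have "(2 * real s + 3) * ?d\<^sup>2 \<le> 16 * 16 ^ s"
    by (rule mult_left_le_imp_le) simp
  then show ?case by (simp add: algebra_simps)
qed

lemma central_binomial_le_sqrt: "real (2 * s choose s) \<le> 4 ^ s / sqrt (2 * real s + 1)"
proof -
  have "(sqrt (2 * real s + 1) * real (2 * s choose s))\<^sup>2 \<le> (4 ^ s)\<^sup>2"
    using central_binomial_le[of s] by (simp add: power_mult_distrib power_mult[symmetric] mult.commute[of s 2])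
      (simp add: power_mult)
  then have "sqrt (2 * real s + 1) * real (2 * s choose s) \<le> 4 ^ s"
    by (rule power2_le_imp_le) simp
  then show ?thesis by (simp add: field_simps)
qed

text \<open>For even \<open>k\<close> this is the value that \<open>binomial_term_le\<close> yields
  at a threshold above \<open>k / 2\<close>; the formula also dominates \<open>sqrt k\<close>, which
  suffices for odd \<open>k\<close>. At \<open>k = 1\<close> the formula would give
  \<open>sqrt 2\<close>, and with that value \<open>Wmean_le\<close> would fail for
  \<open>\<gamma> = 1\<close>.\<close>

definition pivot_bound :: "nat \<Rightarrow> real" where
  "pivot_bound k = (if k = 1 then 1 else 2 * real k / sqrt (real k + 1))"

lemma pivot_bound_nonneg: "0 \<le> pivot_bound k"
  by (simp add: pivot_bound_def)

lemma pivot_bound_even: "1 \<le> s \<Longrightarrow> pivot_bound (2 * s) = 4 * real s / sqrt (2 * real s + 1)"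
  by (simp add: pivot_bound_def)

lemma pivot_bound_odd: "sqrt (2 * real s + 1) \<le> pivot_bound (2 * s + 1)"
proof (cases "s = 0")
  case False
  let ?k = "2 * real s + 1"
  have "sqrt ?k * sqrt (?k + 1) \<le> sqrt (2 * ?k) * sqrt (2 * ?k)"
    by (intro mult_mono) auto
  also have "\<dots> = 2 * ?k" by simp
  finally show ?thesis using False by (simp add: pivot_bound_def field_simps)
qed (simp add: pivot_bound_def)

text \<open>For \<open>\<alpha> + \<beta> = 1\<close> the left side is \<open>\<theta>\<close> times
  the probability of exactly \<open>\<theta>\<close> labels \<open>1\<close> among \<open>k\<close>
  independent ones; the homogeneous form admits classes that do not exhaust the space, even null
  ones. Since \<open>\<theta>\<close> differs from \<open>k / 2\<close> by at most one, almost all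
  factors pair up to powers of \<open>\<alpha> * \<beta>\<close>, which the inequality between
  arithmetic and geometric mean controls, and the coefficient reduces to the central one.\<close>

lemma binomial_term_le:
  fixes \<alpha> \<beta> :: real
  assumes k: "1 \<le> k" "b \<le> 1" and ab: "0 \<le> \<alpha>" "0 \<le> \<beta>"
  defines "\<theta> \<equiv> (k + 2 - b) div 2"
  shows "real \<theta> * (real (k choose \<theta>) * (\<alpha> ^ \<theta> * \<beta> ^ (k - \<theta>))) \<le> pivot_bound k * (\<alpha> + \<beta>) ^ k"
proof -
  have amgm: "(\<alpha> * \<beta>) ^ r \<le> (\<alpha> + \<beta>) ^ (2 * r) / 4 ^ r" for r
  proof -
    have "\<alpha> * \<beta> \<le> (\<alpha> + \<beta>)\<^sup>2 / 4"
      using zero_le_power2[of "\<alpha> - \<beta>"] by (simp add: power2_eq_square algebra_simps)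
    then have "(\<alpha> * \<beta>) ^ r \<le> ((\<alpha> + \<beta>)\<^sup>2 / 4) ^ r" using ab by (intro power_mono) auto
    then show ?thesis by (simp add: power_divide power_mult)
  qed
  consider (odd) s where "k = 2 * s + 1" "\<theta> = s + 1"
    | (low) s where "k = 2 * s" "\<theta> = s" "1 \<le> s"
    | (high) s where "k = 2 * s" "\<theta> = s + 1" "1 \<le> s"
  proof (cases "even k")
    case True
    then obtain s where s: "k = 2 * s" by blast
    then have "1 \<le> s" "\<theta> = s \<or> \<theta> = s + 1" using k by (auto simp: \<theta>_def)
    then show ?thesis using low high s by blast
  next
    case False
    then obtain s where s: "k = 2 * s + 1" by (rule oddE)
    then have "\<theta> = s + 1" using k(2) by (auto simp: \<theta>_def)
    then show ?thesis using odd s by blast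
  qed
  then show ?thesis
  proof cases
    case odd
    have "real \<theta> * real (k choose \<theta>) = (2 * real s + 1) * real (2 * s choose s)"
      using arg_cong[OF Suc_times_binomial_eq[of "2 * s" s], of real] odd by (simp add: algebra_simps)
    also have "\<dots> \<le> (2 * real s + 1) * (4 ^ s / sqrt (2 * real s + 1))"
      by (intro mult_left_mono central_binomial_le_sqrt) simp
    also have "\<dots> = sqrt (2 * real s + 1) * 4 ^ s"
    proof -
      have "(2 * real s + 1) * (4 ^ s / sqrt (2 * real s + 1)) = (2 * real s + 1) / sqrt (2 * real s + 1) * 4 ^ s"
        by simp
      then show ?thesis by (simp only: real_div_sqrt)
    qed
    finally have 1: "real \<theta> * real (k choose \<theta>) \<le> sqrt (2 * real s + 1) * 4 ^ s" .
    have "\<alpha> ^ \<theta> * \<beta> ^ (k - \<theta>) = \<alpha> * (\<alpha> * \<beta>) ^ s" using odd by (simp add: power_mult_distrib)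
    also have "\<dots> \<le> (\<alpha> + \<beta>) * ((\<alpha> + \<beta>) ^ (2 * s) / 4 ^ s)"
      using ab by (intro mult_mono amgm) auto
    finally have 2: "\<alpha> ^ \<theta> * \<beta> ^ (k - \<theta>) \<le> (\<alpha> + \<beta>) ^ k / 4 ^ s" using odd by simp
    have "real \<theta> * real (k choose \<theta>) * (\<alpha> ^ \<theta> * \<beta> ^ (k - \<theta>))
        \<le> (sqrt (2 * real s + 1) * 4 ^ s) * ((\<alpha> + \<beta>) ^ k / 4 ^ s)"
      by (rule mult_mono[OF 1 2]) (use ab in auto)
    also have "\<dots> = sqrt (2 * real s + 1) * (\<alpha> + \<beta>) ^ k" by simp
    also have "\<dots> \<le> pivot_bound k * (\<alpha> + \<beta>) ^ k"
      using ab odd pivot_bound_odd[of s] by (intro mult_right_mono) auto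
    finally show ?thesis by (simp add: mult.assoc)
  next
    case low
    have 1: "real \<theta> * real (k choose \<theta>) \<le> real s * (4 ^ s / sqrt (2 * real s + 1))"
      using mult_left_mono[OF central_binomial_le_sqrt[of s], of "real s"] low by simp
    have 2: "\<alpha> ^ \<theta> * \<beta> ^ (k - \<theta>) \<le> (\<alpha> + \<beta>) ^ k / 4 ^ s"
      using low amgm[of s] by (simp add: power_mult_distrib mult_2)
    have "real \<theta> * real (k choose \<theta>) * (\<alpha> ^ \<theta> * \<beta> ^ (k - \<theta>))
        \<le> (real s * (4 ^ s / sqrt (2 * real s + 1))) * ((\<alpha> + \<beta>) ^ k / 4 ^ s)"
      by (rule mult_mono[OF 1 2]) (use ab in auto)
    also have "\<dots> = real s / sqrt (2 * real s + 1) * (\<alpha> + \<beta>) ^ k" by simp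
    also have "\<dots> \<le> pivot_bound k * (\<alpha> + \<beta>) ^ k"
      using ab low by (intro mult_right_mono) (auto simp: pivot_bound_even divide_right_mono)
    finally show ?thesis by (simp add: mult.assoc)
  next
    case high
    have "Suc s * (2 * s choose Suc s) = s * (2 * s choose s)"
      using binomial_absorb_comp[of "2 * s" s] Suc_times_binomial[of s "2 * s - 1"] high(3)
      by (simp add: Suc_diff_Suc numeral_2_eq_2)
    then have "real \<theta> * real (k choose \<theta>) = real s * real (2 * s choose s)"
      using high by (metis Suc_eq_plus1 of_nat_mult)
    also have "\<dots> \<le> real s * (4 ^ s / sqrt (2 * real s + 1))"
      by (intro mult_left_mono central_binomial_le_sqrt) simp
    finally have 1: "real \<theta> * real (k choose \<theta>) \<le> real s * (4 ^ s / sqrt (2 * real s + 1))" .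
    \<comment> \<open>Two factors \<open>\<alpha>\<close> stay unpaired here. Bounding their product
      by \<open>(\<alpha> + \<beta>)\<^sup>2\<close> costs the factor \<open>4\<close> seen in
      \<open>pivot_bound_even\<close>.\<close>
    obtain r where r: "s = Suc r" using high(3) by (cases s) auto
    have "\<alpha> ^ \<theta> * \<beta> ^ (k - \<theta>) = \<alpha>\<^sup>2 * (\<alpha> * \<beta>) ^ r"
      using high r by (simp add: power_mult_distrib power2_eq_square)
    also have "\<dots> \<le> (\<alpha> + \<beta>)\<^sup>2 * ((\<alpha> + \<beta>) ^ (2 * r) / 4 ^ r)"
      using ab by (intro mult_mono amgm power_mono) auto
    also have "\<dots> = 4 * (\<alpha> + \<beta>) ^ k / 4 ^ s"
      using high r by (simp add: power2_eq_square)
    finally have 2: "\<alpha> ^ \<theta> * \<beta> ^ (k - \<theta>) \<le> 4 * (\<alpha> + \<beta>) ^ k / 4 ^ s" .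
    have "real \<theta> * real (k choose \<theta>) * (\<alpha> ^ \<theta> * \<beta> ^ (k - \<theta>))
        \<le> (real s * (4 ^ s / sqrt (2 * real s + 1))) * (4 * (\<alpha> + \<beta>) ^ k / 4 ^ s)"
      by (rule mult_mono[OF 1 2]) (use ab in auto)
    also have "\<dots> = pivot_bound k * (\<alpha> + \<beta>) ^ k"
      using high by (simp add: pivot_bound_even)
    finally show ?thesis by (simp add: mult.assoc)
  qed
qed

text \<open>The previous bound with the labels \<open>0\<close> and \<open>1\<close> exchanged and
  the coin turned over: the threshold that belongs to \<open>1 - b\<close> is
  \<open>k + 1 - \<theta>\<close>.\<close>

lemma binomial_term_le':
  fixes \<alpha> \<beta> :: real
  assumes k: "1 \<le> k" "b \<le> 1" and ab: "0 \<le> \<alpha>" "0 \<le> \<beta>"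
  defines "\<theta> \<equiv> (k + 2 - b) div 2"
  shows "real (k + 1 - \<theta>) * (real (k choose (\<theta> - 1)) * (\<alpha> ^ (\<theta> - 1) * \<beta> ^ (k - (\<theta> - 1)))) \<le> pivot_bound k * (\<alpha> + \<beta>) ^ k"
proof -
  have *: "(k + 2 - (1 - b)) div 2 = k + 1 - \<theta>" "k - (k + 1 - \<theta>) = \<theta> - 1" "k - (\<theta> - 1) = k + 1 - \<theta>"
    "\<theta> - 1 \<le> k"
    using k by (auto simp: \<theta>_def)
  have "(k choose (\<theta> - 1)) = (k choose (k + 1 - \<theta>))"
    using binomial_symmetric[OF *(4)] *(3) by simp
  then show ?thesis
    using binomial_term_le[OF k(1) _ ab(2,1), of "1 - b"] unfolding * by (simp add: ac_simps)
qed

text \<open>Fix the set \<open>D\<close> of the \<open>k\<close> points that fall into the two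
  classes. On the left, \<open>k choose s\<close> boxes tell which points of \<open>D\<close> lie in
  \<open>A1\<close>; on the right there is one box, which contributes
  \<open>(\<alpha> + \<beta>) ^ k\<close> on \<open>D\<close>. All share the same factor off
  \<open>D\<close>, so the hypothesis on \<open>\<alpha>\<close> and \<open>\<beta>\<close> compares
  them for each \<open>D\<close>. This takes the place of conditioning on the event that exactly
  \<open>k\<close> points precede a given one.\<close>

lemma (in prob_space) measure_PiM_two_classes_le:
  assumes J: "finite J" and A: "A1 \<in> events" "A0 \<in> events" "A1 \<inter> A0 = {}" and c: "0 \<le> c" and s: "s \<le> k"
    and B: "\<And>\<alpha> \<beta>. 0 \<le> \<alpha> \<Longrightarrow> 0 \<le> \<beta> \<Longrightarrow> c * (real (k choose s) * (\<alpha> ^ s * \<beta> ^ (k - s))) \<le> B * (\<alpha> + \<beta>) ^ k"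
  shows "c * measure (\<Pi>\<^sub>M j\<in>J. M) {z \<in> space (\<Pi>\<^sub>M j\<in>J. M). card {a \<in> J. z a \<in> A1} = s \<and> card {a \<in> J. z a \<in> A0} = k - s}
    \<le> B * measure (\<Pi>\<^sub>M j\<in>J. M) {z \<in> space (\<Pi>\<^sub>M j\<in>J. M). card {a \<in> J. z a \<in> A1 \<union> A0} = k}"
proof -
  interpret PM: product_sigma_finite "\<lambda>_. M" ..
  interpret PJ: finite_product_prob_space "\<lambda>_. M" J
    by unfold_locales (use J in auto)
  define T where "T = space M - A1 - A0"
  have T: "T \<in> events" using A by (auto simp: T_def)
  define box where "box D E = (\<Pi>\<^sub>E a\<in>J. if a \<in> E then A1 else if a \<in> D then A0 else T)" for D E
  define box2 where "box2 D = (\<Pi>\<^sub>E a\<in>J. if a \<in> D then A1 \<union> A0 else T)" for D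
  let ?PJ = "\<Pi>\<^sub>M j\<in>J. M"
  let ?Ds = "{D. D \<subseteq> J \<and> card D = k}"
  let ?Es = "\<lambda>D. {E. E \<subseteq> D \<and> card E = s}"
  define \<alpha> \<beta> \<tau> where "\<alpha> = prob A1" and "\<beta> = prob A0" and "\<tau> = prob T"
  have fin: "finite ?Ds" using J by simp
  have finE: "finite (?Es D)" if "D \<in> ?Ds" for D
    using that J finite_subset[of D J] by simp
  have box_sets: "box D E \<in> sets ?PJ" for D E
    unfolding box_def by (rule sets_PiM_I_finite[OF J]) (use A T in auto)
  have box2_sets: "box2 D \<in> sets ?PJ" for D
    unfolding box2_def by (rule sets_PiM_I_finite[OF J]) (use A T in auto)
  have card_split: "J = E \<union> (D - E) \<union> (J - D)" if "D \<subseteq> J" "E \<subseteq> D" for D E using that by auto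
  have box_measure: "measure ?PJ (box D E) = \<alpha> ^ s * \<beta> ^ (k - s) * \<tau> ^ (card J - k)"
    if D: "D \<in> ?Ds" and E: "E \<in> ?Es D" for D E
  proof -
    have finD: "finite D" using D J finite_subset by auto
    have finE: "finite E" using E finD finite_subset by auto
    have "measure ?PJ (box D E) = (\<Prod>a\<in>J. prob (if a \<in> E then A1 else if a \<in> D then A0 else T))"
      unfolding box_def by (rule PJ.prob_times) (use A T in auto)
    also have "\<dots> = (\<Prod>a\<in>J. if a \<in> E then \<alpha> else if a \<in> D then \<beta> else \<tau>)"
      by (intro prod.cong refl) (simp add: \<alpha>_def \<beta>_def \<tau>_def)
    also have "\<dots> = (\<Prod>a\<in>J - D. if a \<in> E then \<alpha> else if a \<in> D then \<beta> else \<tau>)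
        * (\<Prod>a\<in>D. if a \<in> E then \<alpha> else if a \<in> D then \<beta> else \<tau>)"
      using D J by (intro prod.subset_diff) auto
    also have "(\<Prod>a\<in>J - D. if a \<in> E then \<alpha> else if a \<in> D then \<beta> else \<tau>) = (\<Prod>a\<in>J - D. \<tau>)"
      using E by (intro prod.cong refl) auto
    also have "(\<Prod>a\<in>D. if a \<in> E then \<alpha> else if a \<in> D then \<beta> else \<tau>)
        = (\<Prod>a\<in>D - E. if a \<in> E then \<alpha> else if a \<in> D then \<beta> else \<tau>) * (\<Prod>a\<in>E. if a \<in> E then \<alpha> else if a \<in> D then \<beta> else \<tau>)"
      using E finD by (intro prod.subset_diff) auto
    also have "(\<Prod>a\<in>D - E. if a \<in> E then \<alpha> else if a \<in> D then \<beta> else \<tau>) = (\<Prod>a\<in>D - E. \<beta>)"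
      by (intro prod.cong refl) auto
    also have "(\<Prod>a\<in>E. if a \<in> E then \<alpha> else if a \<in> D then \<beta> else \<tau>) = (\<Prod>a\<in>E. \<alpha>)"
      by (intro prod.cong refl) auto
    finally show ?thesis
      using D E finD finE J by (simp add: card_Diff_subset mult_ac)
  qed
  have box2_measure: "measure ?PJ (box2 D) = (\<alpha> + \<beta>) ^ k * \<tau> ^ (card J - k)" if D: "D \<in> ?Ds" for D
  proof -
    have finD: "finite D" using D J finite_subset by auto
    have un: "prob (A1 \<union> A0) = \<alpha> + \<beta>" unfolding \<alpha>_def \<beta>_def by (rule finite_measure_Union[OF A])
    have "measure ?PJ (box2 D) = (\<Prod>a\<in>J. prob (if a \<in> D then A1 \<union> A0 else T))"
      unfolding box2_def by (rule PJ.prob_times) (use A T in auto)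
    also have "\<dots> = (\<Prod>a\<in>J. if a \<in> D then \<alpha> + \<beta> else \<tau>)"
      by (intro prod.cong refl) (simp add: un \<tau>_def)
    also have "\<dots> = (\<Prod>a\<in>J - D. if a \<in> D then \<alpha> + \<beta> else \<tau>) * (\<Prod>a\<in>D. if a \<in> D then \<alpha> + \<beta> else \<tau>)"
      using D J by (intro prod.subset_diff) auto
    also have "(\<Prod>a\<in>J - D. if a \<in> D then \<alpha> + \<beta> else \<tau>) = (\<Prod>a\<in>J - D. \<tau>)" by (intro prod.cong refl) auto
    also have "(\<Prod>a\<in>D. if a \<in> D then \<alpha> + \<beta> else \<tau>) = (\<Prod>a\<in>D. \<alpha> + \<beta>)" by (intro prod.cong refl) auto
    finally show ?thesis using D finD J by (simp add: card_Diff_subset mult_ac)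
  qed
  have sub: "{z \<in> space ?PJ. card {a \<in> J. z a \<in> A1} = s \<and> card {a \<in> J. z a \<in> A0} = k - s}
      \<subseteq> (\<Union>D\<in>?Ds. \<Union>E\<in>?Es D. box D E)"
  proof
    fix z assume z: "z \<in> {z \<in> space ?PJ. card {a \<in> J. z a \<in> A1} = s \<and> card {a \<in> J. z a \<in> A0} = k - s}"
    let ?E = "{a \<in> J. z a \<in> A1}" and ?F = "{a \<in> J. z a \<in> A0}"
    have "card (?E \<union> ?F) = card ?E + card ?F" using J A(3) by (intro card_Un_disjoint) auto
    then have "?E \<union> ?F \<in> ?Ds" using z s by auto
    moreover have "?E \<in> ?Es (?E \<union> ?F)" using z by auto
    moreover have "z \<in> box (?E \<union> ?F) ?E"
      using z by (auto simp: box_def PiE_iff space_PiM T_def)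
    ultimately show "z \<in> (\<Union>D\<in>?Ds. \<Union>E\<in>?Es D. box D E)" by blast
  qed
  \<comment> \<open>A covering by boxes and subadditivity are enough on this side.\<close>
  have "measure ?PJ {z \<in> space ?PJ. card {a \<in> J. z a \<in> A1} = s \<and> card {a \<in> J. z a \<in> A0} = k - s}
      \<le> measure ?PJ (\<Union>D\<in>?Ds. \<Union>E\<in>?Es D. box D E)"
    using fin finE box_sets by (intro PJ.finite_measure_mono[OF sub] sets.finite_UN) auto
  also have "\<dots> \<le> (\<Sum>D\<in>?Ds. measure ?PJ (\<Union>E\<in>?Es D. box D E))"
    using fin finE box_sets by (intro PJ.finite_measure_subadditive_finite) (auto intro!: sets.finite_UN)
  also have "\<dots> \<le> (\<Sum>D\<in>?Ds. \<Sum>E\<in>?Es D. measure ?PJ (box D E))"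
    using finE box_sets by (intro sum_mono PJ.finite_measure_subadditive_finite) auto
  also have "\<dots> = (\<Sum>D\<in>?Ds. real (k choose s) * (\<alpha> ^ s * \<beta> ^ (k - s)) * \<tau> ^ (card J - k))"
  proof (rule sum.cong[OF refl])
    fix D assume D: "D \<in> ?Ds"
    then have "card (?Es D) = (k choose s)" using n_subsets[of D s] J finite_subset[of D J] by simp
    then show "(\<Sum>E\<in>?Es D. measure ?PJ (box D E)) = real (k choose s) * (\<alpha> ^ s * \<beta> ^ (k - s)) * \<tau> ^ (card J - k)"
      using box_measure[OF D] by simp
  qed
  finally have "c * measure ?PJ {z \<in> space ?PJ. card {a \<in> J. z a \<in> A1} = s \<and> card {a \<in> J. z a \<in> A0} = k - s}
      \<le> c * (\<Sum>D\<in>?Ds. real (k choose s) * (\<alpha> ^ s * \<beta> ^ (k - s)) * \<tau> ^ (card J - k))"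
    using c by (rule mult_left_mono)
  also have "\<dots> = (\<Sum>D\<in>?Ds. (c * (real (k choose s) * (\<alpha> ^ s * \<beta> ^ (k - s)))) * \<tau> ^ (card J - k))"
    by (simp add: sum_distrib_left mult.assoc)
  also have "\<dots> \<le> (\<Sum>D\<in>?Ds. (B * (\<alpha> + \<beta>) ^ k) * \<tau> ^ (card J - k))"
    by (intro sum_mono mult_right_mono B) (simp_all add: \<alpha>_def \<beta>_def \<tau>_def)
  also have "\<dots> = B * (\<Sum>D\<in>?Ds. measure ?PJ (box2 D))"
    by (simp add: box2_measure sum_distrib_left mult.assoc)
  \<comment> \<open>On this side disjointness is needed; it holds because \<open>D\<close> can be
    recovered from any \<open>z\<close> in its box.\<close>
  also have "(\<Sum>D\<in>?Ds. measure ?PJ (box2 D)) = measure ?PJ (\<Union>D\<in>?Ds. box2 D)"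
  proof (rule PJ.finite_measure_finite_Union[symmetric])
    show "disjoint_family_on box2 ?Ds"
      unfolding disjoint_family_on_def
    proof (intro ballI impI)
      fix D D' assume D: "D \<in> ?Ds" "D' \<in> ?Ds" and neq: "D \<noteq> D'"
      show "box2 D \<inter> box2 D' = {}"
      proof (rule ccontr)
        assume "box2 D \<inter> box2 D' \<noteq> {}"
        then obtain z where z: "z \<in> box2 D" "z \<in> box2 D'" by blast
        have "a \<in> D \<longleftrightarrow> z a \<in> A1 \<union> A0" "a \<in> D' \<longleftrightarrow> z a \<in> A1 \<union> A0" if "a \<in> J" for a
          using z that by (auto simp: box2_def T_def PiE_iff split: if_splits)
        then have "D = D'" using D by blast
        then show False using neq by simp
      qed
    qed
  qed (use fin box2_sets in auto)
  also have "(\<Union>D\<in>?Ds. box2 D) = {z \<in> space ?PJ. card {a \<in> J. z a \<in> A1 \<union> A0} = k}"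
  proof (intro subset_antisym subsetI)
    fix z assume "z \<in> (\<Union>D\<in>?Ds. box2 D)"
    then obtain D where D: "D \<subseteq> J" "card D = k" and z: "z \<in> box2 D" by auto
    have "a \<in> D \<longleftrightarrow> z a \<in> A1 \<union> A0" if "a \<in> J" for a
      using z that by (auto simp: box2_def T_def PiE_iff split: if_splits)
    then have "{a \<in> J. z a \<in> A1 \<union> A0} = D" using D by blast
    moreover have "z \<in> space ?PJ" using z box2_sets sets.sets_into_space by blast
    ultimately show "z \<in> {z \<in> space ?PJ. card {a \<in> J. z a \<in> A1 \<union> A0} = k}" using D by simp
  next
    fix z assume z: "z \<in> {z \<in> space ?PJ. card {a \<in> J. z a \<in> A1 \<union> A0} = k}"
    have "z \<in> box2 {a \<in> J. z a \<in> A1 \<union> A0}" using z by (simp add: box2_def PiE_iff space_PiM T_def)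
    moreover have "{a \<in> J. z a \<in> A1 \<union> A0} \<in> ?Ds" using z by simp
    ultimately show "z \<in> (\<Union>D\<in>?Ds. box2 D)" by (rule UN_I[rotated])
  qed
  finally show ?thesis .
qed

section \<open>The expected number of pivots\<close>

lemma (in finite_order) bij_card_below: "bij_betw (\<lambda>c. card (below c)) e {..<card e}"
proof -
  have "(\<lambda>c. card (below c)) ` e = {..<card e}"
    using card_below_less inj_card_below by (intro card_subset_eq) (auto simp: card_image)
  then show ?thesis using inj_card_below by (simp add: bij_betw_def)
qed

text \<open>With the index as key this is the tie-breaking of \<open>knn\<close>; a general key
  makes room for random marks.\<close>

definition lex_less :: "(nat \<Rightarrow> real) \<Rightarrow> (nat \<Rightarrow> real) \<Rightarrow> nat \<Rightarrow> nat \<Rightarrow> bool" where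
  "lex_less r \<kappa> a b \<longleftrightarrow> r a < r b \<or> (r a = r b \<and> \<kappa> a < \<kappa> b)"

lemma finite_order_lex_less:
  assumes "finite J" "inj_on \<kappa> J"
  shows "finite_order (lex_less r \<kappa>) J"
proof
  fix a b assume "a \<in> J" "b \<in> J" "a \<noteq> b"
  then have "\<kappa> a \<noteq> \<kappa> b" using assms(2) by (auto dest: inj_onD)
  then show "lex_less r \<kappa> a b \<or> lex_less r \<kappa> b a" by (auto simp: lex_less_def)
qed (use assms in \<open>auto simp: lex_less_def\<close>)

text \<open>\<open>\<pi>\<close> sends an index to the one that has the same rank with respect to
  the keys.\<close>

lemma ex_order_bijection:
  fixes \<kappa> :: "nat \<Rightarrow> real"
  assumes J: "finite J" "inj_on \<kappa> J"
  shows "\<exists>\<pi>. bij_betw \<pi> J J \<and> (\<forall>a\<in>J. \<forall>b\<in>J. a < b \<longleftrightarrow> \<kappa> (\<pi> a) < \<kappa> (\<pi> b))"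
proof -
  interpret o1: finite_order "(<)" J by standard (use J in auto)
  interpret o2: finite_order "\<lambda>a b. \<kappa> a < \<kappa> b" J
  proof
    fix a b assume "a \<in> J" "b \<in> J" "a \<noteq> b"
    then have "\<kappa> a \<noteq> \<kappa> b" using J(2) by (auto dest: inj_onD)
    then show "\<kappa> a < \<kappa> b \<or> \<kappa> b < \<kappa> a" by auto
  qed (use J in auto)
  let ?f = "\<lambda>c. card (o1.below c)" and ?g = "\<lambda>c. card (o2.below c)"
  define \<pi> where "\<pi> = the_inv_into J ?g \<circ> ?f"
  have bij: "bij_betw \<pi> J J"
    unfolding \<pi>_def using o1.bij_card_below o2.bij_card_below by (blast intro: bij_betw_trans bij_betw_the_inv_into)
  have g: "?g (\<pi> a) = ?f a" if "a \<in> J" for a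
    unfolding \<pi>_def comp_def
    using f_the_inv_into_f_bij_betw[OF o2.bij_card_below, of "?f a"] o1.card_below_less[OF that] by simp
  have "a < b \<longleftrightarrow> \<kappa> (\<pi> a) < \<kappa> (\<pi> b)" if ab: "a \<in> J" "b \<in> J" for a b
  proof -
    have "\<pi> a \<in> J" "\<pi> b \<in> J" using bij ab bij_betwE by blast+
    then show ?thesis using o1.lt_iff[OF ab] o2.lt_iff[of "\<pi> a" "\<pi> b"] g[OF ab(1)] g[OF ab(2)] by simp
  qed
  then show ?thesis using bij by blast
qed

text \<open>A relabelling that respects order and labels transports neighbourhoods, votes and
  removals.\<close>

lemma pivots_reindex:
  assumes \<pi>: "bij_betw \<pi> J J"
    and lt: "\<And>a b. a \<in> J \<Longrightarrow> b \<in> J \<Longrightarrow> lt' a b \<longleftrightarrow> lt (\<pi> a) (\<pi> b)"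
    and y: "\<And>a. a \<in> J \<Longrightarrow> y' a = y (\<pi> a)"
  shows "pivots k lt' y' J b = pivots k lt y J b"
proof -
  have inj: "inj_on \<pi> J" and img: "\<pi> ` J = J" using \<pi> by (auto simp: bij_betw_def)
  have near: "nearest k lt (\<pi> ` e) = \<pi> ` nearest k lt' e" if e: "e \<subseteq> J" for e
  proof -
    have c: "card {j \<in> \<pi> ` e. lt j (\<pi> i)} = card {j \<in> e. lt' j i}" if "i \<in> e" for i
    proof -
      have "{j \<in> \<pi> ` e. lt j (\<pi> i)} = \<pi> ` {j \<in> e. lt' j i}" using lt e that by auto
      moreover have "inj_on \<pi> {j \<in> e. lt' j i}" using inj e by (auto intro: inj_on_subset)
      ultimately show ?thesis by (simp add: card_image)
    qed
    show ?thesis unfolding nearest_def using c by auto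
  qed
  have maj: "majority k lt y (\<pi> ` e) b \<longleftrightarrow> majority k lt' y' e b" if e: "e \<subseteq> J" for e
  proof -
    have "nearest k lt' e \<subseteq> J" using e by (auto simp: nearest_def)
    then have "(\<Sum>i\<in>\<pi> ` nearest k lt' e. y i) = (\<Sum>i\<in>nearest k lt' e. y' i)"
      using inj y by (subst sum.reindex) (auto intro!: sum.cong simp: inj_on_subset subset_iff)
    then show ?thesis by (simp add: majority_def near[OF e])
  qed
  have "{j \<in> J. majority k lt y J b \<noteq> majority k lt y (J - {j}) b}
      = \<pi> ` {j \<in> J. majority k lt' y' J b \<noteq> majority k lt' y' (J - {j}) b}"
  proof -
    have "majority k lt y J b \<longleftrightarrow> majority k lt' y' J b" using maj[of J] img by simp
    moreover have "majority k lt y (J - {\<pi> j}) b \<longleftrightarrow> majority k lt' y' (J - {j}) b" if "j \<in> J" for j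
    proof -
      have "\<pi> ` (J - {j}) = J - {\<pi> j}" using inj_on_image_set_diff[OF inj, of J "{j}"] img that by simp
      then show ?thesis using maj[of "J - {j}"] by simp
    qed
    ultimately have "(majority k lt y J b \<noteq> majority k lt y (J - {\<pi> j}) b)
        \<longleftrightarrow> (majority k lt' y' J b \<noteq> majority k lt' y' (J - {j}) b)" if "j \<in> J" for j
      using that by simp
    then have "\<pi> ` {j \<in> J. majority k lt' y' J b \<noteq> majority k lt' y' (J - {j}) b}
        = {j \<in> \<pi> ` J. majority k lt y J b \<noteq> majority k lt y (J - {j}) b}" by auto
    then show ?thesis using img by simp
  qed
  then show ?thesis unfolding pivots_def using inj by (simp add: card_image inj_on_subset)
qed

lemma pivots_cong:
  assumes "\<And>a b. a \<in> J \<Longrightarrow> b \<in> J \<Longrightarrow> lt' a b \<longleftrightarrow> lt a b" and "\<And>a. a \<in> J \<Longrightarrow> y' a = y a"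
  shows "pivots k lt' y' J b = pivots k lt y J b"
  using assms by (intro pivots_reindex[of id]) auto

section \<open>Measurability of votes and pivot counts\<close>

lemma measurable_card_filter:
  fixes e :: "nat set"
  assumes "finite e" "\<And>j. j \<in> e \<Longrightarrow> Measurable.pred M (P j)"
  shows "(\<lambda>\<omega>. card {j \<in> e. P j \<omega>}) \<in> measurable M (count_space UNIV)"
proof (rule measurable_card)
  fix j show "{\<omega> \<in> space M. j \<in> {j \<in> e. P j \<omega>}} \<in> sets M"
    using assms(2)[of j] by (cases "j \<in> e") (auto simp: pred_def)
qed

lemma majority_measurable:
  assumes e: "finite e" and lt: "\<And>i j. i \<in> e \<Longrightarrow> j \<in> e \<Longrightarrow> Measurable.pred M (\<lambda>\<omega>. lt \<omega> i j)"
    and y[measurable]: "\<And>i. i \<in> e \<Longrightarrow> (\<lambda>\<omega>. y \<omega> i) \<in> measurable M (count_space UNIV)"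
    and b[measurable]: "b \<in> measurable M (count_space UNIV)"
  shows "Measurable.pred M (\<lambda>\<omega>. majority k (lt \<omega>) (y \<omega>) e (b \<omega>))"
proof -
  have c[measurable]: "Measurable.pred M (\<lambda>\<omega>. card {j \<in> e. lt \<omega> j i} < k)" if "i \<in> e" for i
    by (rule measurable_compose[OF measurable_card_filter[OF e lt[OF _ that]]]) simp_all
  \<comment> \<open>The sum over the random set of neighbours becomes a sum over the fixed set
    \<open>e\<close> with indicators.\<close>
  have "majority k (lt \<omega>) (y \<omega>) e (b \<omega>)
      \<longleftrightarrow> real k < 2 * (\<Sum>i\<in>e. if card {j \<in> e. lt \<omega> j i} < k then real (y \<omega> i) else 0) + real (b \<omega>)" for \<omega>
  proof -
    have "(\<Sum>i\<in>e. if card {j \<in> e. lt \<omega> j i} < k then real (y \<omega> i) else 0) = real (\<Sum>i\<in>nearest k (lt \<omega>) e. y \<omega> i)"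
      unfolding nearest_def of_nat_sum using e by (simp add: sum.inter_filter)
    then show ?thesis unfolding majority_def
      by (metis of_nat_add of_nat_less_iff of_nat_mult of_nat_numeral)
  qed
  moreover have "Measurable.pred M (\<lambda>\<omega>. real k < 2 * (\<Sum>i\<in>e. if card {j \<in> e. lt \<omega> j i} < k then real (y \<omega> i) else 0) + real (b \<omega>))"
    by measurable
  ultimately show ?thesis by simp
qed

lemma pivots_measurable:
  assumes e: "finite e" and lt: "\<And>i j. i \<in> e \<Longrightarrow> j \<in> e \<Longrightarrow> Measurable.pred M (\<lambda>\<omega>. lt \<omega> i j)"
    and y: "\<And>i. i \<in> e \<Longrightarrow> (\<lambda>\<omega>. y \<omega> i) \<in> measurable M (count_space UNIV)"
    and b: "b \<in> measurable M (count_space UNIV)"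
  shows "(\<lambda>\<omega>. pivots k (lt \<omega>) (y \<omega>) e (b \<omega>)) \<in> measurable M (count_space UNIV)"
  unfolding pivots_def
proof (rule measurable_card_filter[OF e])
  fix j assume "j \<in> e"
  have [measurable]: "Measurable.pred M (\<lambda>\<omega>. majority k (lt \<omega>) (y \<omega>) e (b \<omega>))"
    by (rule majority_measurable[OF e lt y b])
  have [measurable]: "Measurable.pred M (\<lambda>\<omega>. majority k (lt \<omega>) (y \<omega>) (e - {j}) (b \<omega>))"
    by (rule majority_measurable) (use e lt y b in auto)
  show "Measurable.pred M (\<lambda>\<omega>. majority k (lt \<omega>) (y \<omega>) e (b \<omega>) \<noteq> majority k (lt \<omega>) (y \<omega>) (e - {j}) (b \<omega>))"
    by measurable
qed

lemma measurable_PiM_component_compose: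
  "j \<in> J \<Longrightarrow> f \<in> measurable P N \<Longrightarrow> (\<lambda>t. f (t j)) \<in> measurable (\<Pi>\<^sub>M j\<in>J. P) N"
  by (rule measurable_compose[where N = P]) (auto intro: measurable_component_singleton)

lemma lex_less_measurable:
  assumes [measurable]: "(\<lambda>\<omega>. r \<omega> i) \<in> borel_measurable M" "(\<lambda>\<omega>. r \<omega> j) \<in> borel_measurable M"
    "(\<lambda>\<omega>. \<kappa> \<omega> i) \<in> borel_measurable M" "(\<lambda>\<omega>. \<kappa> \<omega> j) \<in> borel_measurable M"
  shows "Measurable.pred M (\<lambda>\<omega>. lex_less (r \<omega>) (\<kappa> \<omega>) i j)"
  unfolding lex_less_def by measurable

text \<open>The points are exchangeable. Permuting them by the bijection that sorts the keys turns
  the order by keys into the order by indices without changing the law of the sample.\<close>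

lemma pivots_key_invariant:
  fixes \<rho> :: "'a \<Rightarrow> real" and y :: "'a \<Rightarrow> nat"
  assumes P: "prob_space P" and \<rho>[measurable]: "\<rho> \<in> borel_measurable P"
    and y[measurable]: "y \<in> measurable P (count_space UNIV)"
    and J: "finite J" "inj_on \<kappa> J"
  shows "(\<integral>\<^sup>+t. ennreal (real (pivots k (lex_less (\<lambda>a. \<rho> (t a)) \<kappa>) (\<lambda>a. y (t a)) J b)) \<partial>(\<Pi>\<^sub>M j\<in>J. P))
    = (\<integral>\<^sup>+t. ennreal (real (pivots k (lex_less (\<lambda>a. \<rho> (t a)) real) (\<lambda>a. y (t a)) J b)) \<partial>(\<Pi>\<^sub>M j\<in>J. P))"
proof -
  obtain \<pi> where \<pi>: "bij_betw \<pi> J J" and \<pi>_lt: "\<And>a b. a \<in> J \<Longrightarrow> b \<in> J \<Longrightarrow> a < b \<longleftrightarrow> \<kappa> (\<pi> a) < \<kappa> (\<pi> b)"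
    using ex_order_bijection[OF J] by blast
  let ?G = "\<lambda>t. ennreal (real (pivots k (lex_less (\<lambda>a. \<rho> (t a)) real) (\<lambda>a. y (t a)) J b))"
  have [measurable]: "(\<lambda>t. pivots k (lex_less (\<lambda>a. \<rho> (t a)) real) (\<lambda>a. y (t a)) J b)
      \<in> measurable (\<Pi>\<^sub>M j\<in>J. P) (count_space UNIV)"
  proof (rule pivots_measurable[OF J(1)])
    fix i j assume ij[measurable]: "i \<in> J" "j \<in> J"
    have "(\<lambda>t. \<rho> (t i)) \<in> borel_measurable (\<Pi>\<^sub>M j\<in>J. P)" "(\<lambda>t. \<rho> (t j)) \<in> borel_measurable (\<Pi>\<^sub>M j\<in>J. P)"
      using ij by (auto intro!: measurable_PiM_component_compose \<rho>)
    then show "Measurable.pred (\<Pi>\<^sub>M j\<in>J. P) (\<lambda>t. lex_less (\<lambda>a. \<rho> (t a)) real i j)"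
      by (rule lex_less_measurable) simp_all
    show "(\<lambda>t. y (t i)) \<in> measurable (\<Pi>\<^sub>M j\<in>J. P) (count_space UNIV)" by measurable
  qed simp
  have G: "?G \<in> borel_measurable (\<Pi>\<^sub>M j\<in>J. P)" by measurable
  have \<pi>J: "\<pi> \<in> J \<rightarrow> J" "inj_on \<pi> J" using \<pi> by (auto simp: bij_betw_def)
  have re: "distr (\<Pi>\<^sub>M j\<in>J. P) (\<Pi>\<^sub>M j\<in>J. P) (\<lambda>t. \<lambda>a\<in>J. t (\<pi> a)) = (\<Pi>\<^sub>M j\<in>J. P)"
    using distr_PiM_reindex[of J "\<lambda>_. P" \<pi> J] P \<pi>J by simp
  have "(\<integral>\<^sup>+t. ?G t \<partial>(\<Pi>\<^sub>M j\<in>J. P)) = (\<integral>\<^sup>+t. ?G (\<lambda>a\<in>J. t (\<pi> a)) \<partial>(\<Pi>\<^sub>M j\<in>J. P))"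
    using \<pi>J by (subst re[symmetric], subst nn_integral_distr)
      (auto intro!: measurable_restrict measurable_component_singleton simp: G)
  also have "\<dots> = (\<integral>\<^sup>+t. ennreal (real (pivots k (lex_less (\<lambda>a. \<rho> (t a)) \<kappa>) (\<lambda>a. y (t a)) J b)) \<partial>(\<Pi>\<^sub>M j\<in>J. P))"
  proof (intro nn_integral_cong arg_cong[where f = ennreal] arg_cong[where f = real])
    fix t
    show "pivots k (lex_less (\<lambda>a. \<rho> ((\<lambda>a\<in>J. t (\<pi> a)) a)) real) (\<lambda>a. y ((\<lambda>a\<in>J. t (\<pi> a)) a)) J b
        = pivots k (lex_less (\<lambda>a. \<rho> (t a)) \<kappa>) (\<lambda>a. y (t a)) J b"
      by (rule pivots_reindex[OF \<pi>]) (use \<pi>_lt in \<open>auto simp: lex_less_def\<close>)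
  qed
  finally show ?thesis ..
qed

text \<open>For two indices \<open>a\<close> and \<open>c\<close>, fix all coordinates but
  \<open>a\<close>: a coincidence then confines the coordinate \<open>a\<close> to one point, and
  \<open>U\<close> has no atoms.\<close>

lemma AE_PiM_inj_on:
  assumes U: "prob_space U" "sets U = sets (borel :: real measure)" "\<And>x. emeasure U {x} = 0" and J: "finite J"
  shows "AE w in (\<Pi>\<^sub>M j\<in>J. U). inj_on w J"
proof -
  interpret U: prob_space U by fact
  interpret product_sigma_finite "\<lambda>_. U" ..
  have neq: "AE w in (\<Pi>\<^sub>M j\<in>J. U). w a \<noteq> w c" if ac: "a \<in> J" "c \<in> J" "a \<noteq> c" for a c
  proof -
    let ?S = "{w \<in> space (\<Pi>\<^sub>M j\<in>J. U). w a = w c}"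
    have bm: "(\<lambda>w. w i) \<in> borel_measurable (\<Pi>\<^sub>M j\<in>J. U)" if "i \<in> J" for i
      using measurable_component_singleton[OF that, of "\<lambda>_. U"] measurable_cong_sets[OF refl U(2)] by blast
    have S[measurable]: "?S \<in> sets (\<Pi>\<^sub>M j\<in>J. U)"
      using bm[OF ac(1)] bm[OF ac(2)] by measurable
    have ins: "insert a (J - {a}) = J" using ac by auto
    have m: "(indicator ?S :: _ \<Rightarrow> ennreal) \<in> borel_measurable (Pi\<^sub>M (insert a (J - {a})) (\<lambda>_. U))"
      unfolding ins by measurable
    have "emeasure (\<Pi>\<^sub>M j\<in>J. U) ?S = (\<integral>\<^sup>+w. indicator ?S w \<partial>Pi\<^sub>M (insert a (J - {a})) (\<lambda>_. U))"
      unfolding ins using S by simp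
    also have "\<dots> = (\<integral>\<^sup>+w. \<integral>\<^sup>+x. indicator ?S (w(a := x)) \<partial>U \<partial>Pi\<^sub>M (J - {a}) (\<lambda>_. U))"
      using J by (intro product_nn_integral_insert m) auto
    also have "\<dots> \<le> (\<integral>\<^sup>+w. \<integral>\<^sup>+x. indicator {w c} x \<partial>U \<partial>Pi\<^sub>M (J - {a}) (\<lambda>_. U))"
      using ac by (intro nn_integral_mono) (auto simp: indicator_def)
    also have "\<dots> = 0" using U by simp
    finally have "?S \<in> null_sets (\<Pi>\<^sub>M j\<in>J. U)" using S by (simp add: null_sets_def)
    then show ?thesis by (rule AE_I') auto
  qed
  have "AE w in (\<Pi>\<^sub>M j\<in>J. U). \<forall>a\<in>J. \<forall>c\<in>J. a \<noteq> c \<longrightarrow> w a \<noteq> w c"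
    using J neq by (intro AE_finite_allI) auto
  then show ?thesis by eventually_elim (auto simp: inj_on_def)
qed

lemma nn_integral_two_classes_le:
  fixes J :: "nat set"
  assumes Q: "prob_space Q" and J: "finite J" and A: "A1 \<in> sets Q" "A0 \<in> sets Q" "A1 \<inter> A0 = {}" and c: "0 \<le> c"
    and s: "s \<le> k" and B0: "0 \<le> B"
    and B: "\<And>\<alpha> \<beta>. 0 \<le> \<alpha> \<Longrightarrow> 0 \<le> \<beta> \<Longrightarrow> c * (real (k choose s) * (\<alpha> ^ s * \<beta> ^ (k - s))) \<le> B * (\<alpha> + \<beta>) ^ k"
  shows "(\<integral>\<^sup>+z. ennreal (c * of_bool (card {a \<in> J. z a \<in> A1} = s \<and> card {a \<in> J. z a \<in> A0} = k - s)) \<partial>(\<Pi>\<^sub>M j\<in>J. Q))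
    \<le> (\<integral>\<^sup>+z. ennreal (B * of_bool (card {a \<in> J. z a \<in> A1 \<union> A0} = k)) \<partial>(\<Pi>\<^sub>M j\<in>J. Q))"
proof -
  interpret Q: prob_space Q by fact
  interpret PJ: prob_space "\<Pi>\<^sub>M j\<in>J. Q" by (rule prob_space_PiM) (rule Q)
  let ?PJ = "\<Pi>\<^sub>M j\<in>J. Q"
  let ?S1 = "{z \<in> space ?PJ. card {a \<in> J. z a \<in> A1} = s \<and> card {a \<in> J. z a \<in> A0} = k - s}"
  let ?S2 = "{z \<in> space ?PJ. card {a \<in> J. z a \<in> A1 \<union> A0} = k}"
  have cm: "(\<lambda>z. card {a \<in> J. z a \<in> A}) \<in> measurable ?PJ (count_space UNIV)" if "A \<in> sets Q" for A
  proof (rule measurable_card_filter[OF J])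
    fix j assume j: "j \<in> J"
    show "Measurable.pred ?PJ (\<lambda>z. z j \<in> A)"
      by (rule measurable_PiM_component_compose[OF j, of "\<lambda>x. x \<in> A"]) (use that in simp)
  qed
  note [measurable] = cm[OF A(1)] cm[OF A(2)] cm[OF sets.Un[OF A(1,2)]]
  have S1: "?S1 \<in> sets ?PJ" and S2: "?S2 \<in> sets ?PJ" by measurable
  have "(\<integral>\<^sup>+z. ennreal (c * of_bool (card {a \<in> J. z a \<in> A1} = s \<and> card {a \<in> J. z a \<in> A0} = k - s)) \<partial>?PJ)
      = (\<integral>\<^sup>+z. ennreal c * indicator ?S1 z \<partial>?PJ)"
    by (intro nn_integral_cong) (auto simp: indicator_def)
  also have "\<dots> = ennreal (c * measure ?PJ ?S1)"
    using S1 c by (simp add: nn_integral_cmult PJ.emeasure_eq_measure ennreal_mult)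
  also have "\<dots> \<le> ennreal (B * measure ?PJ ?S2)"
    by (intro ennreal_leI Q.measure_PiM_two_classes_le J A c s B)
  also have "\<dots> = (\<integral>\<^sup>+z. ennreal B * indicator ?S2 z \<partial>?PJ)"
    using S2 B0 by (simp add: nn_integral_cmult PJ.emeasure_eq_measure ennreal_mult)
  also have "\<dots> = (\<integral>\<^sup>+z. ennreal (B * of_bool (card {a \<in> J. z a \<in> A1 \<union> A0} = k)) \<partial>?PJ)"
    by (intro nn_integral_cong) (auto simp: indicator_def)
  finally show ?thesis .
qed

text \<open>All points of \<open>J\<close> vote, so the labels are independent without any
  conditioning, and the order \<open>lt t\<close> may depend on the sample in an arbitrary
  way.\<close>

lemma expected_pivots_le_full:
  fixes y :: "'a \<Rightarrow> nat"
  assumes P: "prob_space P" and y[measurable]: "y \<in> measurable P (count_space UNIV)"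
    and y1: "\<And>x. x \<in> space P \<Longrightarrow> y x \<le> 1"
    and J: "finite J" and k: "1 \<le> k" "k = card J" and b: "b \<le> 1"
    and lt: "\<And>t. finite_order (lt t) J"
  shows "(\<integral>\<^sup>+t. ennreal (real (pivots k (lt t) (\<lambda>a. y (t a)) J b)) \<partial>(\<Pi>\<^sub>M j\<in>J. P)) \<le> ennreal (pivot_bound k)"
proof -
  interpret P: prob_space P by fact
  interpret PJ: prob_space "\<Pi>\<^sub>M j\<in>J. P" by (rule prob_space_PiM) (rule P)
  define \<theta> where "\<theta> = (k + 2 - b) div 2"
  have \<theta>: "1 \<le> \<theta>" "\<theta> \<le> k" using k b by (auto simp: \<theta>_def)
  let ?A1 = "{x \<in> space P. y x = 1}" and ?A0 = "{x \<in> space P. y x = 0}"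
  have A: "?A1 \<in> sets P" "?A0 \<in> sets P" by measurable
  have "(\<integral>\<^sup>+t. ennreal (real (pivots k (lt t) (\<lambda>a. y (t a)) J b)) \<partial>(\<Pi>\<^sub>M j\<in>J. P))
      \<le> (\<integral>\<^sup>+t. ennreal (real \<theta> * of_bool (card {a \<in> J. t a \<in> ?A1} = \<theta> \<and> card {a \<in> J. t a \<in> ?A0} = k - \<theta>)) \<partial>(\<Pi>\<^sub>M j\<in>J. P))"
  proof (intro nn_integral_mono ennreal_leI)
    fix t assume t: "t \<in> space (\<Pi>\<^sub>M j\<in>J. P)"
    interpret fo: finite_order "lt t" J by (rule lt)
    have tP: "t a \<in> space P" if "a \<in> J" for a using t that by (auto simp: space_PiM)
    have e1: "{a \<in> J. t a \<in> ?A1} = {a \<in> J. y (t a) = 1}" using tP by auto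
    have "y (t a) = 1 \<or> y (t a) = 0" if "a \<in> J" for a using y1[OF tP[OF that]] by linarith
    then have "J = {a \<in> J. t a \<in> ?A1} \<union> {a \<in> J. t a \<in> ?A0}" using tP by blast
    moreover have "card ({a \<in> J. t a \<in> ?A1} \<union> {a \<in> J. t a \<in> ?A0}) = card {a \<in> J. t a \<in> ?A1} + card {a \<in> J. t a \<in> ?A0}"
      using J by (intro card_Un_disjoint) auto
    ultimately have c: "card {a \<in> J. t a \<in> ?A1} + card {a \<in> J. t a \<in> ?A0} = k" using k by simp
    have "pivots k (lt t) (\<lambda>a. y (t a)) J b \<le> \<theta> * of_bool (card {a \<in> J. y (t a) = 1} = \<theta>)"
      unfolding \<theta>_def by (rule fo.pivots_le_full) (use tP y1 k b in auto)
    also have "\<dots> = \<theta> * of_bool (card {a \<in> J. t a \<in> ?A1} = \<theta> \<and> card {a \<in> J. t a \<in> ?A0} = k - \<theta>)"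
    proof -
      have "card {a \<in> J. y (t a) = 1} = \<theta> \<longleftrightarrow> card {a \<in> J. t a \<in> ?A1} = \<theta> \<and> card {a \<in> J. t a \<in> ?A0} = k - \<theta>"
        unfolding e1[symmetric] using c by linarith
      then show ?thesis by (simp only:)
    qed
    finally show "real (pivots k (lt t) (\<lambda>a. y (t a)) J b)
        \<le> real \<theta> * of_bool (card {a \<in> J. t a \<in> ?A1} = \<theta> \<and> card {a \<in> J. t a \<in> ?A0} = k - \<theta>)"
      by (simp only: of_nat_le_iff[symmetric, where 'a = real] of_nat_mult of_nat_of_bool)
  qed
  also have "\<dots> \<le> (\<integral>\<^sup>+t. ennreal (pivot_bound k * of_bool (card {a \<in> J. t a \<in> ?A1 \<union> ?A0} = k)) \<partial>(\<Pi>\<^sub>M j\<in>J. P))"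
    by (rule nn_integral_two_classes_le[OF P J A _ _ \<theta>(2) pivot_bound_nonneg binomial_term_le[OF k(1) b, folded \<theta>_def]])
      auto
  also have "\<dots> \<le> (\<integral>\<^sup>+t. ennreal (pivot_bound k) \<partial>(\<Pi>\<^sub>M j\<in>J. P))"
    using pivot_bound_nonneg by (intro nn_integral_mono ennreal_leI) auto
  also have "\<dots> = ennreal (pivot_bound k)" by (simp add: PJ.emeasure_space_1)
  finally show ?thesis .
qed

text \<open>Ties are broken by marks \<open>fst (t a)\<close>: given the point and the mark of \<open>c\<close>, the points preceding \<open>c\<close>
  have labels that are independent with a common law, which fails when ties are broken by the index.\<close>

lemma nn_integral_term_le:
  fixes \<rho> :: "'a \<Rightarrow> real" and y :: "'a \<Rightarrow> nat"
  assumes Q: "prob_space Q" and f[measurable]: "f \<in> borel_measurable Q" and g[measurable]: "g \<in> borel_measurable Q"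
    and y[measurable]: "y \<in> measurable Q (count_space UNIV)"
    and y1: "\<And>x. x \<in> space Q \<Longrightarrow> y x \<le> 1"
    and J: "finite J" "c \<in> J" and k: "1 \<le> k" and b: "b \<le> 1"
  defines "\<theta> \<equiv> (k + 2 - b) div 2"
    and "D \<equiv> \<lambda>t. {j \<in> J. lex_less (\<lambda>a. f (t a)) (\<lambda>a. g (t a)) j c}"
  shows "(\<integral>\<^sup>+t. ennreal (real (of_bool (card (D t) = k) *
      (if y (t c) = 0 then \<theta> * of_bool (card {a \<in> D t. y (t a) = 1} = \<theta>)
       else (k + 1 - \<theta>) * of_bool (card {a \<in> D t. y (t a) = 1} = \<theta> - 1)))) \<partial>(\<Pi>\<^sub>M j\<in>J. Q))
    \<le> (\<integral>\<^sup>+t. ennreal (pivot_bound k * of_bool (card (D t) = k)) \<partial>(\<Pi>\<^sub>M j\<in>J. Q))"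
    (is "(\<integral>\<^sup>+t. ?F t \<partial>_) \<le> (\<integral>\<^sup>+t. ?G t \<partial>_)")
proof -
  interpret Q: prob_space Q by fact
  interpret product_sigma_finite "\<lambda>_. Q" ..
  let ?J' = "J - {c}"
  have ins: "insert c ?J' = J" using J by auto
  have \<theta>: "1 \<le> \<theta>" "\<theta> \<le> k" using k b by (auto simp: \<theta>_def)
  note bt = binomial_term_le[OF k b, folded \<theta>_def] and bt' = binomial_term_le'[OF k b, folded \<theta>_def]
  let ?PJ = "\<Pi>\<^sub>M j\<in>J. Q"
  have comp[measurable]: "(\<lambda>t. f (t j)) \<in> borel_measurable ?PJ" "(\<lambda>t. g (t j)) \<in> borel_measurable ?PJ"
    "(\<lambda>t. y (t j)) \<in> measurable ?PJ (count_space UNIV)" if "j \<in> J" for j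
    by (rule measurable_PiM_component_compose[OF that], fact)+
  have ltm[measurable]: "Measurable.pred ?PJ (\<lambda>t. lex_less (\<lambda>a. f (t a)) (\<lambda>a. g (t a)) j c)" if "j \<in> J" for j
    by (rule lex_less_measurable) (use comp[OF that] comp[OF J(2)] in auto)
  have c1[measurable]: "(\<lambda>t. card (D t)) \<in> measurable ?PJ (count_space UNIV)"
    unfolding D_def by (rule measurable_card_filter[OF J(1) ltm])
  have c2[measurable]: "(\<lambda>t. card {a \<in> D t. y (t a) = 1}) \<in> measurable ?PJ (count_space UNIV)"
  proof -
    have "(\<lambda>t. card {a \<in> J. lex_less (\<lambda>a. f (t a)) (\<lambda>a. g (t a)) a c \<and> y (t a) = 1}) \<in> measurable ?PJ (count_space UNIV)"
      by (rule measurable_card_filter[OF J(1)]) measurable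
    then show ?thesis by (simp add: D_def conj_assoc)
  qed
  have yc[measurable]: "(\<lambda>t. y (t c)) \<in> measurable ?PJ (count_space UNIV)" by (rule comp(3)[OF J(2)])
  have F: "?F \<in> borel_measurable (Pi\<^sub>M (insert c ?J') (\<lambda>_. Q))" unfolding ins by measurable
  have G: "?G \<in> borel_measurable (Pi\<^sub>M (insert c ?J') (\<lambda>_. Q))" unfolding ins by measurable
  \<comment> \<open>The value \<open>v\<close> of the coordinate \<open>c\<close> is fixed first;
    the other points remain independent with law \<open>Q\<close>.\<close>
  have "(\<integral>\<^sup>+t. ?F t \<partial>?PJ) = (\<integral>\<^sup>+v. \<integral>\<^sup>+t. ?F (t(c := v)) \<partial>(Pi\<^sub>M ?J' (\<lambda>_. Q)) \<partial>Q)"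
    using product_nn_integral_insert_rev[of ?J' c ?F, OF _ _ F] J unfolding ins by simp
  also have "\<dots> \<le> (\<integral>\<^sup>+v. \<integral>\<^sup>+t. ?G (t(c := v)) \<partial>(Pi\<^sub>M ?J' (\<lambda>_. Q)) \<partial>Q)"
  proof (rule nn_integral_mono)
    fix v assume v: "v \<in> space Q"
    \<comment> \<open>\<open>E\<close> is the set of values that precede \<open>v\<close>. Whether a
      point lies in \<open>E\<close>, and with which label, is decided by the value of that point
      alone, because the mark is part of the value.\<close>
    define E where "E = {x \<in> space Q. f x < f v \<or> (f x = f v \<and> g x < g v)}"
    let ?A1 = "{x \<in> E. y x = 1}" and ?A0 = "{x \<in> E. y x = 0}"
    have Eq: "?A1 = {x \<in> space Q. (f x < f v \<or> (f x = f v \<and> g x < g v)) \<and> y x = 1}"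
      "?A0 = {x \<in> space Q. (f x < f v \<or> (f x = f v \<and> g x < g v)) \<and> y x = 0}" by (auto simp: E_def)
    have A: "?A1 \<in> sets Q" "?A0 \<in> sets Q" "?A1 \<inter> ?A0 = {}" unfolding Eq by (measurable, auto)
    have un: "?A1 \<union> ?A0 = E" using y1 by (force simp: E_def le_Suc_eq)
    have D: "D (t(c := v)) = {a \<in> ?J'. t a \<in> E}" if "t \<in> space (Pi\<^sub>M ?J' (\<lambda>_. Q))" for t
    proof -
      have tQ: "t a \<in> space Q" if "a \<in> ?J'" for a
        using PiE_mem[of t ?J' "\<lambda>_. space Q" a] that \<open>t \<in> space _\<close> by (simp add: space_PiM)
      show ?thesis
      proof (rule set_eqI)
        fix a
        show "a \<in> D (t(c := v)) \<longleftrightarrow> a \<in> {a \<in> ?J'. t a \<in> E}"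
        proof (cases "a = c")
          case True
          then show ?thesis by (simp add: D_def lex_less_def)
        next
          case False
          show ?thesis
          proof (cases "a \<in> J")
            case True
            then have "t a \<in> space Q" using False by (intro tQ) simp
            then show ?thesis using False True by (simp add: D_def lex_less_def E_def)
          qed (simp add: D_def)
        qed
      qed
    qed
    have D1: "{a \<in> D (t(c := v)). y ((t(c := v)) a) = 1} = {a \<in> ?J'. t a \<in> ?A1}"
      if "t \<in> space (Pi\<^sub>M ?J' (\<lambda>_. Q))" for t
      unfolding D[OF that] by auto
    have fin: "finite ?J'" using J by simp
    have cd: "card {a \<in> ?J'. t a \<in> E} = card {a \<in> ?J'. t a \<in> ?A1} + card {a \<in> ?J'. t a \<in> ?A0}" for t
    proof -
      have "x \<in> E \<longleftrightarrow> x \<in> ?A1 \<or> x \<in> ?A0" for x using un by blast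
      then have eq: "{a \<in> ?J'. t a \<in> E} = {a \<in> ?J'. t a \<in> ?A1} \<union> {a \<in> ?J'. t a \<in> ?A0}"
        by blast
      show ?thesis
        unfolding eq by (rule card_Un_disjoint) (use fin in auto)
    qed
    have main: "(\<integral>\<^sup>+t. ennreal (cst * of_bool (card {a \<in> ?J'. t a \<in> ?A1} = s \<and> card {a \<in> ?J'. t a \<in> ?A0} = k - s)) \<partial>(Pi\<^sub>M ?J' (\<lambda>_. Q)))
        \<le> (\<integral>\<^sup>+t. ?G (t(c := v)) \<partial>(Pi\<^sub>M ?J' (\<lambda>_. Q)))"
      if "0 \<le> cst" "s \<le> k"
        "\<And>\<alpha> \<beta>. 0 \<le> \<alpha> \<Longrightarrow> 0 \<le> \<beta> \<Longrightarrow> cst * (real (k choose s) * (\<alpha> ^ s * \<beta> ^ (k - s))) \<le> pivot_bound k * (\<alpha> + \<beta>) ^ k"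
      for cst s
    proof -
      have "(\<integral>\<^sup>+t. ennreal (cst * of_bool (card {a \<in> ?J'. t a \<in> ?A1} = s \<and> card {a \<in> ?J'. t a \<in> ?A0} = k - s)) \<partial>(Pi\<^sub>M ?J' (\<lambda>_. Q)))
        \<le> (\<integral>\<^sup>+t. ennreal (pivot_bound k * of_bool (card {a \<in> ?J'. t a \<in> ?A1 \<union> ?A0} = k)) \<partial>(Pi\<^sub>M ?J' (\<lambda>_. Q)))"
        by (rule nn_integral_two_classes_le[OF Q fin A that(1,2) pivot_bound_nonneg that(3)])
      also have "\<dots> = (\<integral>\<^sup>+t. ?G (t(c := v)) \<partial>(Pi\<^sub>M ?J' (\<lambda>_. Q)))"
        unfolding un by (intro nn_integral_cong) (simp add: D)
      finally show ?thesis .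
    qed
    have e1: "card (D (t(c := v))) = card {a \<in> ?J'. t a \<in> ?A1} + card {a \<in> ?J'. t a \<in> ?A0}"
      if "t \<in> space (Pi\<^sub>M ?J' (\<lambda>_. Q))" for t
      by (rule trans[OF arg_cong[where f = card, OF D[OF that]] cd])
    have e2: "card {a \<in> D (t(c := v)). y ((t(c := v)) a) = 1} = card {a \<in> ?J'. t a \<in> ?A1}"
      if "t \<in> space (Pi\<^sub>M ?J' (\<lambda>_. Q))" for t
      by (rule arg_cong[where f = card, OF D1[OF that]])
    have e3: "y ((t(c := v)) c) = y v" for t by simp
    have h: "real (of_bool (n1 + n0 = k) * (w * of_bool (n1 = s))) = real w * of_bool (n1 = s \<and> n0 = k - s)"
      if "s \<le> k" for n1 n0 w s
      using that by auto
    show "(\<integral>\<^sup>+t. ?F (t(c := v)) \<partial>(Pi\<^sub>M ?J' (\<lambda>_. Q))) \<le> (\<integral>\<^sup>+t. ?G (t(c := v)) \<partial>(Pi\<^sub>M ?J' (\<lambda>_. Q)))"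
    proof (cases "y v = 0")
      case True
      have "(\<integral>\<^sup>+t. ?F (t(c := v)) \<partial>(Pi\<^sub>M ?J' (\<lambda>_. Q)))
          = (\<integral>\<^sup>+t. ennreal (real \<theta> * of_bool (card {a \<in> ?J'. t a \<in> ?A1} = \<theta> \<and> card {a \<in> ?J'. t a \<in> ?A0} = k - \<theta>)) \<partial>(Pi\<^sub>M ?J' (\<lambda>_. Q)))"
      proof (rule nn_integral_cong)
        fix t assume t: "t \<in> space (Pi\<^sub>M ?J' (\<lambda>_. Q))"
        show "?F (t(c := v)) = ennreal (real \<theta> * of_bool (card {a \<in> ?J'. t a \<in> ?A1} = \<theta> \<and> card {a \<in> ?J'. t a \<in> ?A0} = k - \<theta>))"
          unfolding e1[OF t] e2[OF t] e3 if_P[OF True] h[OF \<theta>(2)] ..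
      qed
      also have "\<dots> \<le> (\<integral>\<^sup>+t. ?G (t(c := v)) \<partial>(Pi\<^sub>M ?J' (\<lambda>_. Q)))"
        by (rule main[OF _ \<theta>(2)]) (simp_all only: of_nat_0_le_iff bt)
      finally show ?thesis .
    next
      case False
      have "(\<integral>\<^sup>+t. ?F (t(c := v)) \<partial>(Pi\<^sub>M ?J' (\<lambda>_. Q)))
          = (\<integral>\<^sup>+t. ennreal (real (k + 1 - \<theta>) * of_bool (card {a \<in> ?J'. t a \<in> ?A1} = \<theta> - 1 \<and> card {a \<in> ?J'. t a \<in> ?A0} = k - (\<theta> - 1))) \<partial>(Pi\<^sub>M ?J' (\<lambda>_. Q)))"
      proof (rule nn_integral_cong)
        fix t assume t: "t \<in> space (Pi\<^sub>M ?J' (\<lambda>_. Q))"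
        show "?F (t(c := v)) = ennreal (real (k + 1 - \<theta>) * of_bool (card {a \<in> ?J'. t a \<in> ?A1} = \<theta> - 1 \<and> card {a \<in> ?J'. t a \<in> ?A0} = k - (\<theta> - 1)))"
          unfolding e1[OF t] e2[OF t] e3 if_not_P[OF False] h[OF le_trans[OF diff_le_self \<theta>(2)]] ..
      qed
      also have "\<dots> \<le> (\<integral>\<^sup>+t. ?G (t(c := v)) \<partial>(Pi\<^sub>M ?J' (\<lambda>_. Q)))"
        by (rule main[OF _ le_trans[OF diff_le_self \<theta>(2)]]) (simp_all only: of_nat_0_le_iff bt')
      finally show ?thesis .
    qed
  qed
  also have "\<dots> = (\<integral>\<^sup>+t. ?G t \<partial>?PJ)"
    using product_nn_integral_insert_rev[of ?J' c ?G, OF _ _ G] J unfolding ins by simp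
  finally show ?thesis .
qed

text \<open>For \<open>k < card J\<close>, the index is first replaced by uniform marks. The pivots
  are then bounded by the sum in \<open>pivots_le\<close>, whose term at \<open>c\<close> has a mean
  of at most \<open>pivot_bound k\<close> times the probability that \<open>c\<close> has rank
  \<open>k\<close>. Up to a null set these events are disjoint, so their probabilities add up to at
  most \<open>1\<close>.\<close>

theorem expected_pivots_le:
  fixes \<rho> :: "'a \<Rightarrow> real" and y :: "'a \<Rightarrow> nat"
  assumes P: "prob_space P" and \<rho>[measurable]: "\<rho> \<in> borel_measurable P"
    and y[measurable]: "y \<in> measurable P (count_space UNIV)"
    and y1: "\<And>x. x \<in> space P \<Longrightarrow> y x \<le> 1"
    and J: "finite J" and k: "1 \<le> k" "k \<le> card J" and b: "b \<le> 1"
  shows "(\<integral>\<^sup>+t. ennreal (real (pivots k (lex_less (\<lambda>a. \<rho> (t a)) real) (\<lambda>a. y (t a)) J b)) \<partial>(\<Pi>\<^sub>M j\<in>J. P))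
    \<le> ennreal (pivot_bound k)"
proof (cases "k = card J")
  case True
  have "finite_order (lex_less (\<lambda>a. \<rho> (t a)) real) J" for t
    using J by (intro finite_order_lex_less) (auto simp: inj_on_def)
  then show ?thesis by (intro expected_pivots_le_full P y y1 J k True b)
next
  case False
  then have kJ: "k < card J" using k by simp
  define U :: "real measure" where "U = uniform_measure lborel {0..1}"
  have U: "prob_space U" unfolding U_def by (rule prob_space_uniform_measure) auto
  have setsU[measurable_cong, simp]: "sets U = sets borel" by (simp add: U_def)
  have U0: "emeasure U {x} = 0" for x
  proof -
    have "emeasure lborel ({0..1} \<inter> {x}) \<le> emeasure lborel {x}" by (intro emeasure_mono) auto
    then have "emeasure lborel ({0..1} \<inter> {x}) = 0" by simp
    then show ?thesis unfolding U_def by (subst emeasure_uniform_measure) simp_all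
  qed
  interpret P: prob_space P by fact
  interpret U: prob_space U by fact
  interpret PJ: prob_space "\<Pi>\<^sub>M j\<in>J. P" by (rule prob_space_PiM) (rule P)
  interpret UJ: prob_space "\<Pi>\<^sub>M j\<in>J. U" by (rule prob_space_PiM) (rule U)
  define Q where "Q = U \<Otimes>\<^sub>M P"
  have Q: "prob_space Q" unfolding Q_def by (rule prob_space_pair[OF U P])
  interpret QJ: prob_space "\<Pi>\<^sub>M j\<in>J. Q" by (rule prob_space_PiM) (rule Q)
  define f where "f x = \<rho> (snd x)" for x :: "real \<times> 'a"
  define g where "g x = fst x" for x :: "real \<times> 'a"
  define z where "z x = y (snd x)" for x :: "real \<times> 'a"
  have f: "f \<in> borel_measurable Q" and g: "g \<in> borel_measurable Q" and z: "z \<in> measurable Q (count_space UNIV)"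
    unfolding f_def g_def z_def Q_def by measurable
  have z1: "z x \<le> 1" if "x \<in> space Q" for x
    using that y1 by (auto simp: z_def Q_def space_pair_measure)
  let ?PJ = "\<Pi>\<^sub>M j\<in>J. P" and ?UJ = "\<Pi>\<^sub>M j\<in>J. U" and ?QJ = "\<Pi>\<^sub>M j\<in>J. Q"
  define G where "G w t = ennreal (real (pivots k (lex_less (\<lambda>a. \<rho> (t a)) w) (\<lambda>a. y (t a)) J b))" for w t
  define H where "H s = ennreal (real (pivots k (lex_less (\<lambda>a. f (s a)) (\<lambda>a. g (s a))) (\<lambda>a. z (s a)) J b))" for s
  define D where "D s c = {j \<in> J. lex_less (\<lambda>a. f (s a)) (\<lambda>a. g (s a)) j c}" for s c
  define \<theta> where "\<theta> = (k + 2 - b) div 2"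
  define T where "T s c = of_bool (card (D s c) = k) *
      (if z (s c) = 0 then \<theta> * of_bool (card {a \<in> D s c. z (s a) = 1} = \<theta>)
       else (k + 1 - \<theta>) * of_bool (card {a \<in> D s c. z (s a) = 1} = \<theta> - 1))" for s c
  have comp: "(\<lambda>t. f (t j)) \<in> borel_measurable ?QJ" "(\<lambda>t. g (t j)) \<in> borel_measurable ?QJ"
    "(\<lambda>t. z (t j)) \<in> measurable ?QJ (count_space UNIV)" if "j \<in> J" for j
    by (rule measurable_PiM_component_compose[OF that], fact)+
  have ltm: "Measurable.pred ?QJ (\<lambda>s. lex_less (\<lambda>a. f (s a)) (\<lambda>a. g (s a)) i j)" if "i \<in> J" "j \<in> J" for i j
    by (rule lex_less_measurable) (use comp that in auto)
  have Hm: "H \<in> borel_measurable ?QJ"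
  proof -
    have [measurable]: "(\<lambda>s. pivots k (lex_less (\<lambda>a. f (s a)) (\<lambda>a. g (s a))) (\<lambda>a. z (s a)) J b) \<in> measurable ?QJ (count_space UNIV)"
      by (rule pivots_measurable[OF J ltm comp(3)]) auto
    show ?thesis unfolding H_def by measurable
  qed
  have Dm: "(\<lambda>s. card (D s c)) \<in> measurable ?QJ (count_space UNIV)" if "c \<in> J" for c
    unfolding D_def by (rule measurable_card_filter[OF J ltm[OF _ that]])
  have Tm: "(\<lambda>s. T s c) \<in> measurable ?QJ (count_space UNIV)" if "c \<in> J" for c
  proof -
    have "(\<lambda>s. card {a \<in> J. lex_less (\<lambda>a. f (s a)) (\<lambda>a. g (s a)) a c \<and> z (s a) = 1}) \<in> measurable ?QJ (count_space UNIV)"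
    proof (rule measurable_card_filter[OF J])
      fix j assume j: "j \<in> J"
      note [measurable] = ltm[OF j that] comp(3)[OF j]
      show "Measurable.pred ?QJ (\<lambda>s. lex_less (\<lambda>a. f (s a)) (\<lambda>a. g (s a)) j c \<and> z (s j) = 1)" by measurable
    qed
    then have [measurable]: "(\<lambda>s. card {a \<in> D s c. z (s a) = 1}) \<in> measurable ?QJ (count_space UNIV)"
      by (simp add: D_def conj_assoc)
    note [measurable] = Dm[OF that] comp(3)[OF that]
    show ?thesis unfolding T_def by measurable
  qed
  have injQ: "AE s in ?QJ. inj_on (\<lambda>a. g (s a)) J"
  proof -
    have "distr ?QJ ?UJ (compose J fst) = (\<Pi>\<^sub>M j\<in>J. distr Q U fst)"
      by (rule distr_PiM_finite_prob_space'[OF J Q U]) (simp add: Q_def)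
    also have "distr Q U fst = U" unfolding Q_def by (rule P.distr_pair_fst)
    finally have d: "distr ?QJ ?UJ (compose J fst) = ?UJ" .
    have cm: "compose J fst \<in> measurable ?QJ ?UJ"
      unfolding compose_def
      by (intro measurable_restrict measurable_PiM_component_compose) (auto simp: Q_def)
    have "AE w in distr ?QJ ?UJ (compose J fst). inj_on w J"
      unfolding d by (rule AE_PiM_inj_on[OF U setsU U0 J])
    from AE_distrD[OF cm this] show ?thesis
      by eventually_elim (auto simp: inj_on_def compose_def g_def)
  qed
  have m: "(\<lambda>(u, v). \<lambda>i\<in>J. (u i, v i)) \<in> measurable (?UJ \<Otimes>\<^sub>M ?PJ) ?QJ"
    unfolding case_prod_beta' Q_def by (intro measurable_restrict) simp
  \<comment> \<open>The mean under the index order is a constant, integrated here over the marks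
    \<open>w\<close>. For almost every \<open>w\<close> the marks are distinct, hence admissible
    keys, and may replace the index.\<close>
  have "(\<integral>\<^sup>+t. G real t \<partial>?PJ) = (\<integral>\<^sup>+w. (\<integral>\<^sup>+t. G real t \<partial>?PJ) \<partial>?UJ)"
    by (simp add: UJ.emeasure_space_1)
  also have "\<dots> = (\<integral>\<^sup>+w. (\<integral>\<^sup>+t. G w t \<partial>?PJ) \<partial>?UJ)"
  proof (rule nn_integral_cong_AE)
    show "AE w in ?UJ. (\<integral>\<^sup>+t. G real t \<partial>?PJ) = (\<integral>\<^sup>+t. G w t \<partial>?PJ)"
      using AE_PiM_inj_on[OF U setsU U0 J]
      by eventually_elim (unfold G_def, rule pivots_key_invariant[OF P \<rho> y J, symmetric])
  qed
  also have "\<dots> = (\<integral>\<^sup>+w. (\<integral>\<^sup>+t. H ((\<lambda>(u, v). \<lambda>i\<in>J. (u i, v i)) (w, t)) \<partial>?PJ) \<partial>?UJ)"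
  proof (intro nn_integral_cong)
    fix w t
    show "G w t = H ((\<lambda>(u, v). \<lambda>i\<in>J. (u i, v i)) (w, t))"
      unfolding G_def H_def
      by (intro arg_cong[where f = ennreal] arg_cong[where f = real] pivots_cong)
        (auto simp: f_def g_def z_def lex_less_def)
  qed
  also have "\<dots> = (\<integral>\<^sup>+x. H ((\<lambda>(u, v). \<lambda>i\<in>J. (u i, v i)) x) \<partial>(?UJ \<Otimes>\<^sub>M ?PJ))"
    by (rule PJ.nn_integral_fst) (rule measurable_compose[OF m Hm])
  also have "\<dots> = (\<integral>\<^sup>+s. H s \<partial>distr (?UJ \<Otimes>\<^sub>M ?PJ) ?QJ (\<lambda>(u, v). \<lambda>i\<in>J. (u i, v i)))"
    by (rule nn_integral_distr[symmetric, OF m]) (use Hm in simp)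
  also have "\<dots> = (\<integral>\<^sup>+s. H s \<partial>?QJ)"
    unfolding Q_def distr_PiM_pair[OF U P J] ..
  finally have "(\<integral>\<^sup>+t. G real t \<partial>?PJ) = (\<integral>\<^sup>+s. H s \<partial>?QJ)" .
  also have "\<dots> \<le> (\<integral>\<^sup>+s. (\<Sum>c\<in>J. ennreal (real (T s c))) \<partial>?QJ)"
  proof (rule nn_integral_mono_AE)
    show "AE s in ?QJ. H s \<le> (\<Sum>c\<in>J. ennreal (real (T s c)))"
      using injQ AE_space
    proof eventually_elim
      case (elim s)
      interpret fo: finite_order "lex_less (\<lambda>a. f (s a)) (\<lambda>a. g (s a))" J
        by (rule finite_order_lex_less[OF J elim(1)])
      have "z (s a) \<le> 1" if "a \<in> J" for a
        using elim(2) that by (intro z1) (auto simp: space_PiM)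
      then have "pivots k (lex_less (\<lambda>a. f (s a)) (\<lambda>a. g (s a))) (\<lambda>a. z (s a)) J b \<le> (\<Sum>c\<in>J. T s c)"
        using fo.pivots_le[of "\<lambda>a. z (s a)" b k] b k kJ unfolding T_def D_def \<theta>_def fo.below_def by simp
      then have "real (pivots k (lex_less (\<lambda>a. f (s a)) (\<lambda>a. g (s a))) (\<lambda>a. z (s a)) J b) \<le> (\<Sum>c\<in>J. real (T s c))"
        by (simp only: of_nat_le_iff of_nat_sum[symmetric])
      then show ?case unfolding H_def by (subst sum_ennreal) (auto intro: ennreal_leI)
    qed
  qed
  also have "\<dots> = (\<Sum>c\<in>J. \<integral>\<^sup>+s. ennreal (real (T s c)) \<partial>?QJ)"
    using Tm by (intro nn_integral_sum) measurable
  also have "\<dots> \<le> (\<Sum>c\<in>J. \<integral>\<^sup>+s. ennreal (pivot_bound k * of_bool (card (D s c) = k)) \<partial>?QJ)"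
    unfolding T_def D_def \<theta>_def
    by (intro sum_mono nn_integral_term_le[OF Q f g z z1 J _ k(1) b])
  also have "\<dots> = (\<integral>\<^sup>+s. (\<Sum>c\<in>J. ennreal (pivot_bound k * of_bool (card (D s c) = k))) \<partial>?QJ)"
  proof (rule nn_integral_sum[symmetric])
    fix c assume "c \<in> J"
    note [measurable] = Dm[OF this]
    show "(\<lambda>s. ennreal (pivot_bound k * of_bool (card (D s c) = k))) \<in> borel_measurable ?QJ" by measurable
  qed
  also have "\<dots> \<le> (\<integral>\<^sup>+s. ennreal (pivot_bound k) \<partial>?QJ)"
  proof (rule nn_integral_mono_AE)
    show "AE s in ?QJ. (\<Sum>c\<in>J. ennreal (pivot_bound k * of_bool (card (D s c) = k))) \<le> ennreal (pivot_bound k)"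
      using injQ
    proof eventually_elim
      case (elim s)
      interpret fo: finite_order "lex_less (\<lambda>a. f (s a)) (\<lambda>a. g (s a))" J
        by (rule finite_order_lex_less[OF J elim])
      have "card {c \<in> J. card (D s c) = k} \<le> 1"
      proof -
        have "is_singleton {c \<in> J. card (D s c) = k} \<or> {c \<in> J. card (D s c) = k} = {}"
          using fo.inj_card_below unfolding fo.below_def D_def is_singleton_def inj_on_def by blast
        then show ?thesis
        proof
          assume "{c \<in> J. card (D s c) = k} = {}"
          then show ?thesis by (simp only: card.empty)
        qed (simp add: is_singleton_altdef)
      qed
      moreover have "(\<Sum>c\<in>J. pivot_bound k * of_bool (card (D s c) = k)) = pivot_bound k * real (card {c \<in> J. card (D s c) = k})"
        using J by (simp add: sum_distrib_left[symmetric] Int_def)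
      ultimately have "(\<Sum>c\<in>J. pivot_bound k * of_bool (card (D s c) = k)) \<le> pivot_bound k"
        using mult_left_mono[of "real (card {c \<in> J. card (D s c) = k})" 1 "pivot_bound k"] pivot_bound_nonneg[of k] by simp
      then show ?case using pivot_bound_nonneg by (subst sum_ennreal) (auto intro: ennreal_leI)
    qed
  qed
  also have "\<dots> = ennreal (pivot_bound k)" by (simp add: QJ.emeasure_space_1)
  finally show ?thesis unfolding G_def .
qed

section \<open>The classifier as a majority vote\<close>

lemma knn_eq_nearest: "knn k x e u = nearest k (lex_less (\<lambda>i. norm (x i - u)) real) e"
  by (simp add: knn_def nearest_def lex_less_def)

abbreviation vote :: "nat \<Rightarrow> (nat \<Rightarrow> real ^ 'd) \<Rightarrow> (nat \<Rightarrow> nat) \<Rightarrow> nat set \<Rightarrow> nat \<Rightarrow> real ^ 'd \<Rightarrow> bool" where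
  "vote k x y e b u \<equiv> majority k (lex_less (\<lambda>i. norm (x i - u)) real) y e b"

lemma knn_classifier_eq_vote:
  assumes "1 \<le> k" "b \<le> 1"
  shows "knn_classifier k x y e b u = of_bool (vote k x y e b u)"
proof -
  let ?s = "\<Sum>i\<in>knn k x e u. y i"
  have v: "(1 / real k) * (\<Sum>i\<in>knn k x e u. real (y i)) = real ?s / real k" by simp
  have "real ?s / real k > 1 / 2 \<longleftrightarrow> k < 2 * ?s" "real ?s / real k < 1 / 2 \<longleftrightarrow> 2 * ?s < k"
    using assms by (auto simp: field_simps simp flip: of_nat_sum)
  then show ?thesis
    unfolding knn_classifier_def Let_def v majority_def knn_eq_nearest[symmetric]
    using assms by (cases "b = 0") auto
qed

section \<open>Influences within a block\<close>

text \<open>Only points above \<open>j\<close> lose a rank. As \<open>j\<close> does not vote, their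
  ranks are at least \<open>k + 1\<close> before the removal and at least \<open>k\<close> after
  it.\<close>

lemma (in finite_order) nearest_remove_outside:
  assumes j: "j \<in> e" "j \<notin> nearest k lt e"
  shows "nearest k lt (e - {j}) = nearest k lt e"
proof -
  have eq: "{a \<in> e - {j}. lt a i} = below i - {j}" for i by (auto simp: below_def)
  have nj: "k \<le> card (below j)" using j by (auto simp: nearest_def below_def)
  have "card (below i - {j}) < k \<longleftrightarrow> card (below i) < k" if i: "i \<in> e" for i
  proof (cases "j \<in> below i")
    case True
    then have "lt j i" by (simp add: below_def)
    then have "below j \<subseteq> below i - {j}"
      unfolding below_def using i j(1) irrefl[OF j(1)] by (blast intro: trans)
    then have "card (below j) \<le> card (below i - {j})" by (intro card_mono) auto
    moreover have "card (below i - {j}) \<le> card (below i)" by (rule card_Diff1_le)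
    ultimately show ?thesis using nj by linarith
  qed simp
  moreover have "\<not> card (below j) < k" using nj by simp
  ultimately have "{i \<in> e - {j}. card (below i - {j}) < k} = {i \<in> e. card (below i) < k}"
    by blast
  then have "{i \<in> e - {j}. card {a \<in> e - {j}. lt a i} < k} = {i \<in> e. card {a \<in> e. lt a i} < k}"
    unfolding eq unfolding below_def .
  then show ?thesis unfolding nearest_def .
qed

text \<open>In a sample of two points each is the only neighbour of the other, so the bound for
  \<open>k = 1\<close> reads \<open>1 \<le> \<gamma>\<close>. This serves to absorb additive
  constants into multiples of \<open>\<gamma>\<close>.\<close>

lemma stone_constant_ge_1:
  fixes \<nu> :: "(real ^ 'd) measure"
  assumes \<nu>: "prob_space \<nu>" and st: "stone_constant \<nu> \<gamma>"
  shows "1 \<le> \<gamma>"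
proof -
  interpret I: prob_space "\<Pi>\<^sub>M i\<in>{1, 2::nat}. \<nu>" by (rule prob_space_PiM) (rule \<nu>)
  have ae: "AE x in (\<Pi>\<^sub>M i\<in>{1, 2::nat}. \<nu>). \<forall>k\<ge>1. \<forall>i\<in>{1, 2}.
      real (card {j \<in> {1, 2} - {i}. i \<in> knn k x ({1, 2} - {j}) (x j)}) \<le> real k * \<gamma>"
    using st unfolding stone_constant_def by (elim allE[of _ "{1, 2}"]) simp
  obtain x :: "nat \<Rightarrow> real ^ 'd" where
    x: "\<forall>k\<ge>1. \<forall>i\<in>{1, 2::nat}. real (card {j \<in> {1, 2} - {i}. i \<in> knn k x ({1, 2} - {j}) (x j)}) \<le> real k * \<gamma>"
    using eventually_happens'[OF I.ae_filter_bot ae] by (rule exE)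
  have "1 \<in> knn 1 x {1} (x 2)" by (simp add: knn_def)
  moreover have "{1, 2} - {2} = {1::nat}" by auto
  ultimately have "{j \<in> {1, 2} - {1}. 1 \<in> knn 1 x ({1, 2} - {j}) (x j)} = {2}"
    by (intro set_eqI iffI) (auto simp del: One_nat_def)
  then show ?thesis using x[rule_format, of 1 1] by (simp del: One_nat_def)
qed

lemma knn_cong: "(\<And>a. a \<in> e \<Longrightarrow> x a = x' a) \<Longrightarrow> knn k x e u = knn k x' e u"
  unfolding knn_def by (rule Collect_cong, rule conj_cong[OF refl]) (simp cong: conj_cong)

text \<open>The canonical model: the coordinates \<open>1..n\<close> are the observations, and
  \<open>pos\<close> lists the coins as coordinates \<open>n + 1..N\<close>. Coins are given the
  type of the observations because \<open>efron_stein_constant\<close> concerns variables of a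
  single type; only their label component is read.\<close>

locale knn_sample =
  fixes n p k N :: nat and \<mu> :: "nat \<Rightarrow> ((real ^ 'd) \<times> nat) measure" and P :: "((real ^ 'd) \<times> nat) measure"
    and pos :: "nat set \<times> nat \<Rightarrow> nat" and \<gamma> :: real
  assumes \<mu>: "\<And>i. prob_space (\<mu> i)"
    and sets_\<mu>: "\<And>i. sets (\<mu> i) = sets (borel \<Otimes>\<^sub>M count_space {0, 1})"
    and \<mu>_P: "\<And>i. i \<in> {1..n} \<Longrightarrow> \<mu> i = P"
    and pos: "bij_betw pos (coin_index n p) {n + 1..N}"
    and nN: "n \<le> N"
    and p: "1 \<le> p" and k: "1 \<le> k" and pkn: "p + k \<le> n"
    and stone: "stone_constant (distr P borel fst) \<gamma>"
begin

abbreviation "UM \<equiv> Pi\<^sub>M {1..N} \<mu>"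

definition m :: nat where "m = n - p + 1"

definition blocks :: "nat set set" where "blocks = {v. v \<subseteq> {1..n} \<and> card v = m}"

definition pt :: "(nat \<Rightarrow> (real ^ 'd) \<times> nat) \<Rightarrow> nat \<Rightarrow> real ^ 'd" where "pt u a = fst (u a)"
definition lab :: "(nat \<Rightarrow> (real ^ 'd) \<times> nat) \<Rightarrow> nat \<Rightarrow> nat" where "lab u a = snd (u a)"
definition coin :: "(nat \<Rightarrow> (real ^ 'd) \<times> nat) \<Rightarrow> nat set \<Rightarrow> nat \<Rightarrow> nat" where "coin u e i = snd (u (pos (e, i)))"

text \<open>The coin is always that of the full training set \<open>v - {i}\<close>, even for
  smaller \<open>e\<close>, so that the votes with and without \<open>j\<close> differ by the
  removal of \<open>j\<close> only.\<close>

definition pred_vote :: "(nat \<Rightarrow> (real ^ 'd) \<times> nat) \<Rightarrow> nat set \<Rightarrow> nat \<Rightarrow> nat set \<Rightarrow> bool" where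
  "pred_vote u v i e = vote k (pt u) (lab u) e (coin u (v - {i}) i) (pt u i)"

text \<open>Counts the leave-one-out votes in \<open>v\<close> that have \<open>j\<close> as a
  pivot. The test point \<open>j\<close> is left out, as it does not belong to its own training
  set.\<close>

definition infl :: "nat set \<Rightarrow> nat \<Rightarrow> (nat \<Rightarrow> (real ^ 'd) \<times> nat) \<Rightarrow> nat" where
  "infl v j u = card {i \<in> v - {j}. pred_vote u v i (v - {i}) \<noteq> pred_vote u v i (v - {i} - {j})}"

text \<open>The summand \<open>1\<close> pays for the coins.\<close>

definition W :: "nat set \<Rightarrow> (nat \<Rightarrow> (real ^ 'd) \<times> nat) \<Rightarrow> (nat \<Rightarrow> (real ^ 'd) \<times> nat) \<Rightarrow> real" where
  "W v u u' = 1 + (1 / real m) * (\<Sum>j\<in>v. (1 + real (infl v j u) + real (infl v j (u(j := u' j))))\<^sup>2)"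

lemma m_bounds: "k + 1 \<le> m" "m \<le> n" "1 \<le> m" using p k pkn by (auto simp: m_def)

lemma blockD:
  assumes "v \<in> blocks" shows "v \<subseteq> {1..n}" "card v = m" "finite v"
  using assms finite_subset[of v "{1..n}"] by (simp_all add: blocks_def)

lemma finite_blocks: "finite blocks" by (simp add: blocks_def)

lemma coin_index_block:
  assumes "v \<in> blocks" "i \<in> v" shows "(v - {i}, i) \<in> coin_index n p"
  using assms pkn blockD[OF assms(1)] by (auto simp: coin_index_def training_sets_def m_def)

lemma pos_range:
  assumes "v \<in> blocks" "i \<in> v" shows "pos (v - {i}, i) \<in> {n + 1..N}"
  using bij_betwE[OF pos] coin_index_block[OF assms] by blast

lemma space_\<mu>: "space (\<mu> i) = UNIV \<times> {0, 1}"
  using sets_eq_imp_space_eq[OF sets_\<mu>] by (simp add: space_pair_measure)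

lemma snd_space: "u \<in> space UM \<Longrightarrow> i \<in> {1..N} \<Longrightarrow> snd (u i) \<le> 1"
  using PiE_mem[of u "{1..N}" "\<lambda>i. space (\<mu> i)" i] by (auto simp: space_PiM space_\<mu>)

lemma fst_\<mu>: "fst \<in> borel_measurable (\<mu> i)"
  using measurable_cong_sets[OF sets_\<mu> refl] measurable_fst by blast

lemma snd_\<mu>: "snd \<in> measurable (\<mu> i) (count_space UNIV)"
proof -
  have "snd \<in> measurable (borel \<Otimes>\<^sub>M count_space {0, 1::nat}) (count_space UNIV)"
    by (rule measurable_compose[OF measurable_snd]) simp
  then show ?thesis using measurable_cong_sets[OF sets_\<mu> refl] by blast
qed

lemma pt_measurable: "a \<in> {1..N} \<Longrightarrow> (\<lambda>u. pt u a) \<in> borel_measurable UM"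
  unfolding pt_def by (rule measurable_compose[where N = "\<mu> a"]) (rule measurable_component_singleton fst_\<mu> | assumption)+

lemma lab_measurable: "a \<in> {1..N} \<Longrightarrow> (\<lambda>u. lab u a) \<in> measurable UM (count_space UNIV)"
  unfolding lab_def by (rule measurable_compose[where N = "\<mu> a"]) (rule measurable_component_singleton snd_\<mu> | assumption)+

lemma coin_measurable:
  "v \<in> blocks \<Longrightarrow> i \<in> v \<Longrightarrow> (\<lambda>u. coin u (v - {i}) i) \<in> measurable UM (count_space UNIV)"
  unfolding coin_def using lab_measurable[of "pos (v - {i}, i)"] pos_range[of v i] by (simp add: lab_def)

lemma pred_vote_measurable:
  assumes v: "v \<in> blocks" "i \<in> v" "e \<subseteq> v"
  shows "Measurable.pred UM (\<lambda>u. pred_vote u v i e)"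
proof -
  have vN: "v \<subseteq> {1..N}" using blockD[OF v(1)] nN by auto
  have fin: "finite e" using v blockD finite_subset by blast
  show ?thesis
    unfolding pred_vote_def
  proof (rule majority_measurable[OF fin])
    fix a b assume "a \<in> e" "b \<in> e"
    then have "a \<in> {1..N}" "b \<in> {1..N}" "i \<in> {1..N}" using v vN by auto
    note [measurable] = this[THEN pt_measurable]
    show "Measurable.pred UM (\<lambda>u. lex_less (\<lambda>a. norm (pt u a - pt u i)) real a b)"
      by (rule lex_less_measurable) measurable
  next
    fix a assume "a \<in> e"
    then show "(\<lambda>u. lab u a) \<in> measurable UM (count_space UNIV)" using v vN by (intro lab_measurable) auto
  next
    show "(\<lambda>u. coin u (v - {i}) i) \<in> measurable UM (count_space UNIV)" using v by (intro coin_measurable)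
  qed
qed

lemma infl_measurable:
  assumes v: "v \<in> blocks"
  shows "(\<lambda>u. infl v j u) \<in> measurable UM (count_space UNIV)"
  unfolding infl_def
proof (rule measurable_card_filter)
  fix i assume i: "i \<in> v - {j}"
  have "Measurable.pred UM (\<lambda>u. pred_vote u v i (v - {i}))" "Measurable.pred UM (\<lambda>u. pred_vote u v i (v - {i} - {j}))"
    by (rule pred_vote_measurable[OF v]; use i in blast)+
  then show "Measurable.pred UM (\<lambda>u. pred_vote u v i (v - {i}) \<noteq> pred_vote u v i (v - {i} - {j}))"
    by measurable
qed (use blockD[OF v] in simp)

lemma update_measurable: "j \<in> {1..N} \<Longrightarrow> (\<lambda>(u, u'). u(j := u' j)) \<in> measurable (UM \<Otimes>\<^sub>M UM) UM"
proof -
  assume j: "j \<in> {1..N}"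
  have "(\<lambda>x. (fst x)(j := snd x j)) \<in> measurable (UM \<Otimes>\<^sub>M UM) UM"
  proof (rule measurable_PiM_single')
    fix i assume "i \<in> {1..N}"
    then show "(\<lambda>x. ((fst x)(j := snd x j)) i) \<in> measurable (UM \<Otimes>\<^sub>M UM) (\<mu> i)"
      using j by (cases "i = j") simp_all
  next
    show "(\<lambda>x. (fst x)(j := snd x j)) \<in> space (UM \<Otimes>\<^sub>M UM) \<rightarrow> (\<Pi>\<^sub>E i\<in>{1..N}. space (\<mu> i))"
      using j by (auto simp: space_pair_measure space_PiM PiE_iff extensional_def)
  qed
  then show ?thesis by (simp add: case_prod_beta')
qed

lemma infl_update_measurable:
  assumes v: "v \<in> blocks" and j: "j \<in> v"
  shows "(\<lambda>(u, u'). infl v j (u(j := u' j))) \<in> measurable (UM \<Otimes>\<^sub>M UM) (count_space UNIV)"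
proof -
  have "j \<in> {1..N}" using blockD[OF v] j nN by auto
  from measurable_compose[OF update_measurable[OF this] infl_measurable[OF v]]
  show ?thesis by (simp add: case_prod_beta')
qed

lemma W_measurable:
  assumes v: "v \<in> blocks"
  shows "(\<lambda>(u, u'). W v u u') \<in> borel_measurable (UM \<Otimes>\<^sub>M UM)"
proof -
  have [measurable]: "(\<lambda>x. infl v j ((fst x)(j := snd x j))) \<in> measurable (UM \<Otimes>\<^sub>M UM) (count_space UNIV)" if "j \<in> v" for j
    using infl_update_measurable[OF v that] by (simp add: case_prod_beta')
  have [measurable]: "(\<lambda>x. infl v j (fst x)) \<in> measurable (UM \<Otimes>\<^sub>M UM) (count_space UNIV)" for j
    by (rule measurable_compose[OF measurable_fst infl_measurable[OF v]])
  show ?thesis unfolding W_def case_prod_beta' by measurable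
qed

lemma W_ge_1: "1 \<le> W v u u'"
  by (simp add: W_def sum_nonneg)

lemma P: "prob_space P" "sets P = sets (borel \<Otimes>\<^sub>M count_space {0, 1})"
  using \<mu>[of 1] sets_\<mu>[of 1] \<mu>_P[of 1] p k pkn by auto

lemma P_measurable: "fst \<in> borel_measurable P" "snd \<in> measurable P (count_space UNIV)"
  and P_label: "z \<in> space P \<Longrightarrow> snd z \<le> 1"
proof -
  have *: "P = \<mu> 1" using \<mu>_P[of 1] p pkn by simp
  show "fst \<in> borel_measurable P" "snd \<in> measurable P (count_space UNIV)"
    unfolding * by (rule fst_\<mu> snd_\<mu>)+
  show "z \<in> space P \<Longrightarrow> snd z \<le> 1" unfolding * space_\<mu> by auto
qed

lemma prob_space_UM: "prob_space UM" by (rule prob_space_PiM) (rule \<mu>)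

text \<open>With all coordinates outside \<open>v - {i}\<close> frozen, in particular the test point
  and the coin, the remaining points are independent with law \<open>P\<close> and are ordered by
  their distance to a constant.\<close>

lemma nn_integral_pivots_le:
  assumes v: "v \<in> blocks" and i: "i \<in> v"
  shows "(\<integral>\<^sup>+u. ennreal (real (pivots k (lex_less (\<lambda>a. norm (pt u a - pt u i)) real) (lab u) (v - {i}) (coin u (v - {i}) i))) \<partial>UM)
    \<le> ennreal (pivot_bound k)"
proof -
  interpret \<mu>: prob_space "\<mu> j" for j by (rule \<mu>)
  interpret product_sigma_finite \<mu> ..
  define J where "J = v - {i}"
  define L where "L = {1..N} - J"
  have vn: "v \<subseteq> {1..n}" and vN: "v \<subseteq> {1..N}" using blockD[OF v] nN by auto
  have fin: "finite J" "finite L" using blockD[OF v] by (auto simp: J_def L_def)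
  have IJ: "{1..N} = L \<union> J" "L \<inter> J = {}" using vN by (auto simp: L_def J_def)
  have iL: "i \<in> L" using vN i by (auto simp: L_def J_def)
  have cN: "pos (J, i) \<in> {n + 1..N}" using pos_range[OF v i] by (simp add: J_def)
  \<comment> \<open>The coin sits beyond \<open>n\<close>, hence outside the block, and is frozen
    with the coordinates in \<open>L\<close>.\<close>
  have "pos (J, i) \<notin> v" using cN vn by force
  then have cL: "pos (J, i) \<in> L" using cN unfolding L_def J_def by simp
  interpret PL: prob_space "Pi\<^sub>M L \<mu>" by (rule prob_space_PiM) (rule \<mu>)
  let ?F = "\<lambda>u. ennreal (real (pivots k (lex_less (\<lambda>a. norm (pt u a - pt u i)) real) (lab u) J (coin u J i)))"
  have "(\<lambda>u. pivots k (lex_less (\<lambda>a. norm (pt u a - pt u i)) real) (lab u) J (coin u J i)) \<in> measurable UM (count_space UNIV)"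
  proof (rule pivots_measurable[OF fin(1)])
    fix a b assume "a \<in> J" "b \<in> J"
    then have "a \<in> {1..N}" "b \<in> {1..N}" "i \<in> {1..N}" using i vN by (auto simp: J_def)
    note [measurable] = this[THEN pt_measurable]
    show "Measurable.pred UM (\<lambda>u. lex_less (\<lambda>a. norm (pt u a - pt u i)) real a b)"
      by (rule lex_less_measurable) measurable
  next
    fix a assume "a \<in> J"
    then show "(\<lambda>u. lab u a) \<in> measurable UM (count_space UNIV)" using vN by (intro lab_measurable) (auto simp: J_def)
  next
    show "(\<lambda>u. coin u J i) \<in> measurable UM (count_space UNIV)" using coin_measurable[OF v i] by (simp add: J_def)
  qed
  then have F: "?F \<in> borel_measurable (Pi\<^sub>M (L \<union> J) \<mu>)" unfolding IJ(1)[symmetric] by measurable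
  have PJ: "Pi\<^sub>M J \<mu> = (\<Pi>\<^sub>M j\<in>J. P)"
    using vn by (intro PiM_cong refl \<mu>_P) (auto simp: J_def)
  have "(\<integral>\<^sup>+u. ?F u \<partial>UM) = (\<integral>\<^sup>+x. (\<integral>\<^sup>+t. ?F (merge L J (x, t)) \<partial>Pi\<^sub>M J \<mu>) \<partial>Pi\<^sub>M L \<mu>)"
    unfolding IJ(1) by (rule product_nn_integral_fold[OF IJ(2) fin(2,1) F])
  also have "\<dots> \<le> (\<integral>\<^sup>+x. ennreal (pivot_bound k) \<partial>Pi\<^sub>M L \<mu>)"
  proof (rule nn_integral_mono)
    fix x assume x: "x \<in> space (Pi\<^sub>M L \<mu>)"
    have b: "snd (x (pos (J, i))) \<le> 1" using PiE_mem[of x L "\<lambda>i. space (\<mu> i)", OF _ cL] x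
      by (auto simp: space_PiM space_\<mu>)
    have mg: "merge L J (x, t) a = (if a \<in> J then t a else x a)" if "a \<in> J \<or> a \<in> L" for t a
      using that IJ(2) by (auto simp: merge_def)
    have iJ: "i \<notin> J" and cJ: "pos (J, i) \<notin> J" using iL cL IJ(2) by auto
    have "(\<integral>\<^sup>+t. ?F (merge L J (x, t)) \<partial>Pi\<^sub>M J \<mu>)
        = (\<integral>\<^sup>+t. ennreal (real (pivots k (lex_less (\<lambda>a. norm (fst (t a) - fst (x i))) real) (\<lambda>a. snd (t a)) J (snd (x (pos (J, i)))))) \<partial>(\<Pi>\<^sub>M j\<in>J. P))"
      unfolding PJ
    proof (intro nn_integral_cong arg_cong[where f = ennreal] arg_cong[where f = real])
      fix t
      have c: "coin (merge L J (x, t)) J i = snd (x (pos (J, i)))"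
        using mg[of "pos (J, i)" t] cL cJ by (simp add: coin_def)
      have pi: "pt (merge L J (x, t)) i = fst (x i)" using mg[of i t] iL iJ by (simp add: pt_def)
      show "pivots k (lex_less (\<lambda>a. norm (pt (merge L J (x, t)) a - pt (merge L J (x, t)) i)) real) (lab (merge L J (x, t))) J (coin (merge L J (x, t)) J i)
          = pivots k (lex_less (\<lambda>a. norm (fst (t a) - fst (x i))) real) (\<lambda>a. snd (t a)) J (snd (x (pos (J, i))))"
        unfolding c pi by (rule pivots_cong) (simp_all add: lex_less_def pt_def lab_def mg)
    qed
    also have "\<dots> \<le> ennreal (pivot_bound k)"
    proof (rule expected_pivots_le[OF P(1) _ _ _ fin(1) k _ b])
      note [measurable] = P_measurable(1)
      show "(\<lambda>z. norm (fst z - fst (x i))) \<in> borel_measurable P" by measurable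
      show "snd \<in> measurable P (count_space UNIV)" by (rule P_measurable(2))
      show "snd z \<le> 1" if "z \<in> space P" for z using that by (rule P_label)
      show "k \<le> card J" using m_bounds(1) blockD[OF v] i by (simp add: J_def)
    qed
    finally show "(\<integral>\<^sup>+t. ?F (merge L J (x, t)) \<partial>Pi\<^sub>M J \<mu>) \<le> ennreal (pivot_bound k)" .
  qed
  also have "\<dots> = ennreal (pivot_bound k)" by (simp add: PL.emeasure_space_1)
  finally show ?thesis unfolding J_def .
qed

text \<open>Double counting of the pairs \<open>(i, j)\<close> for which removing \<open>j\<close>
  changes the vote at \<open>i\<close>. The right side has the test points fixed, where the binomial
  estimate applies.\<close>

lemma sum_infl_eq:
  assumes v: "v \<in> blocks"
  shows "(\<Sum>j\<in>v. infl v j u)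
    = (\<Sum>i\<in>v. pivots k (lex_less (\<lambda>a. norm (pt u a - pt u i)) real) (lab u) (v - {i}) (coin u (v - {i}) i))"
proof -
  have fin: "finite v" using blockD[OF v] by simp
  have "(\<Sum>j\<in>v. infl v j u) = (\<Sum>j\<in>v. \<Sum>i\<in>v. of_bool (i \<noteq> j \<and> pred_vote u v i (v - {i}) \<noteq> pred_vote u v i (v - {i} - {j})))"
    using fin by (simp add: infl_def Int_def conj_assoc)
  also have "\<dots> = (\<Sum>i\<in>v. \<Sum>j\<in>v. of_bool (i \<noteq> j \<and> pred_vote u v i (v - {i}) \<noteq> pred_vote u v i (v - {i} - {j})))"
    by (rule sum.swap)
  also have "\<dots> = (\<Sum>i\<in>v. pivots k (lex_less (\<lambda>a. norm (pt u a - pt u i)) real) (lab u) (v - {i}) (coin u (v - {i}) i))"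
  proof (rule sum.cong[OF refl])
    fix i assume "i \<in> v"
    have "(\<Sum>j\<in>v. of_bool (i \<noteq> j \<and> pred_vote u v i (v - {i}) \<noteq> pred_vote u v i (v - {i} - {j})))
        = card {j \<in> v. i \<noteq> j \<and> pred_vote u v i (v - {i}) \<noteq> pred_vote u v i (v - {i} - {j})}"
      using fin by (simp add: Int_def)
    also have "{j \<in> v. i \<noteq> j \<and> pred_vote u v i (v - {i}) \<noteq> pred_vote u v i (v - {i} - {j})}
        = {j \<in> v - {i}. pred_vote u v i (v - {i}) \<noteq> pred_vote u v i (v - {i} - {j})}" by blast
    finally show "(\<Sum>j\<in>v. of_bool (i \<noteq> j \<and> pred_vote u v i (v - {i}) \<noteq> pred_vote u v i (v - {i} - {j})))
        = pivots k (lex_less (\<lambda>a. norm (pt u a - pt u i)) real) (lab u) (v - {i}) (coin u (v - {i}) i)"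
      by (simp add: pivots_def pred_vote_def)
  qed
  finally show ?thesis .
qed

lemma nn_integral_sum_infl_le:
  assumes v: "v \<in> blocks"
  shows "(\<integral>\<^sup>+u. ennreal (\<Sum>j\<in>v. real (infl v j u)) \<partial>UM) \<le> ennreal (real m * pivot_bound k)"
proof -
  let ?p = "\<lambda>u i. pivots k (lex_less (\<lambda>a. norm (pt u a - pt u i)) real) (lab u) (v - {i}) (coin u (v - {i}) i)"
  have pm: "(\<lambda>u. ennreal (real (?p u i))) \<in> borel_measurable UM" if i: "i \<in> v" for i
  proof -
    have "(\<lambda>u. card {j \<in> v - {i}. pred_vote u v i (v - {i}) \<noteq> pred_vote u v i (v - {i} - {j})}) \<in> measurable UM (count_space UNIV)"
    proof (rule measurable_card_filter)
      fix j
      have "Measurable.pred UM (\<lambda>u. pred_vote u v i (v - {i}))" "Measurable.pred UM (\<lambda>u. pred_vote u v i (v - {i} - {j}))"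
        by (rule pred_vote_measurable[OF v]; use i in blast)+
      then show "Measurable.pred UM (\<lambda>u. pred_vote u v i (v - {i}) \<noteq> pred_vote u v i (v - {i} - {j}))" by measurable
    qed (use blockD[OF v] in simp)
    then have "(\<lambda>u. ?p u i) \<in> measurable UM (count_space UNIV)" unfolding pivots_def pred_vote_def .
    then show ?thesis by (rule measurable_compose) simp
  qed
  have "(\<integral>\<^sup>+u. ennreal (\<Sum>j\<in>v. real (infl v j u)) \<partial>UM) = (\<integral>\<^sup>+u. (\<Sum>i\<in>v. ennreal (real (?p u i))) \<partial>UM)"
  proof (rule nn_integral_cong)
    fix u
    have "(\<Sum>j\<in>v. real (infl v j u)) = real (\<Sum>j\<in>v. infl v j u)" by (rule of_nat_sum[symmetric])
    also have "\<dots> = real (\<Sum>i\<in>v. ?p u i)" by (rule arg_cong[where f = real, OF sum_infl_eq[OF v]])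
    also have "\<dots> = (\<Sum>i\<in>v. real (?p u i))" by (rule of_nat_sum)
    finally show "ennreal (\<Sum>j\<in>v. real (infl v j u)) = (\<Sum>i\<in>v. ennreal (real (?p u i)))"
      by (simp only: sum_ennreal of_nat_0_le_iff)
  qed
  also have "\<dots> = (\<Sum>i\<in>v. \<integral>\<^sup>+u. ennreal (real (?p u i)) \<partial>UM)"
    using pm by (rule nn_integral_sum)
  also have "\<dots> \<le> (\<Sum>i\<in>v. ennreal (pivot_bound k))"
    by (intro sum_mono nn_integral_pivots_le[OF v])
  also have "\<dots> = ennreal (real m * pivot_bound k)"
    using blockD[OF v] pivot_bound_nonneg[of k] by (simp add: ennreal_mult ennreal_of_nat_eq_real_of_nat)
  finally show ?thesis .
qed

lemma gamma_ge_1: "1 \<le> \<gamma>"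
proof -
  have "prob_space (distr P borel fst)" using P_measurable(1) by (rule prob_space.prob_space_distr[OF P(1)])
  then show ?thesis using stone by (rule stone_constant_ge_1)
qed

text \<open>Removing a point that is not a neighbour has no effect on the vote, so every pivot is a
  neighbour.\<close>

lemma infl_le_neighbours:
  assumes v: "v \<in> blocks" and j: "j \<in> v"
  shows "infl v j u \<le> card {i \<in> v - {j}. j \<in> knn k (pt u) (v - {i}) (pt u i)}"
  unfolding infl_def
proof (rule card_mono)
  show "finite {i \<in> v - {j}. j \<in> knn k (pt u) (v - {i}) (pt u i)}" using blockD[OF v] by simp
  show "{i \<in> v - {j}. pred_vote u v i (v - {i}) \<noteq> pred_vote u v i (v - {i} - {j})}
      \<subseteq> {i \<in> v - {j}. j \<in> knn k (pt u) (v - {i}) (pt u i)}"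
  proof (rule subsetI, rule ccontr)
    fix i assume "i \<in> {i \<in> v - {j}. pred_vote u v i (v - {i}) \<noteq> pred_vote u v i (v - {i} - {j})}"
      and "i \<notin> {i \<in> v - {j}. j \<in> knn k (pt u) (v - {i}) (pt u i)}"
    then have i: "i \<in> v" "i \<noteq> j" and ne: "pred_vote u v i (v - {i}) \<noteq> pred_vote u v i (v - {i} - {j})"
      and nk: "j \<notin> knn k (pt u) (v - {i}) (pt u i)" by auto
    interpret fo: finite_order "lex_less (\<lambda>a. norm (pt u a - pt u i)) real" "v - {i}"
      by (rule finite_order_lex_less) (use blockD[OF v] in \<open>auto simp: inj_on_def\<close>)
    have "nearest k (lex_less (\<lambda>a. norm (pt u a - pt u i)) real) (v - {i} - {j})
        = nearest k (lex_less (\<lambda>a. norm (pt u a - pt u i)) real) (v - {i})"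
      using i j nk by (intro fo.nearest_remove_outside) (auto simp: knn_eq_nearest)
    then show False using ne by (simp add: pred_vote_def majority_def)
  qed
qed

text \<open>In Stone's property the neighbours of a point are taken among the other points of the
  family; for the family \<open>v\<close> these are exactly the leave-one-out neighbours. The
  property is pulled back from the point laws to \<open>P\<close>, then to the coordinates in
  \<open>v\<close>, then to \<open>UM\<close>.\<close>

lemma AE_infl_le:
  assumes v: "v \<in> blocks"
  shows "AE u in UM. \<forall>j\<in>v. real (infl v j u) \<le> real k * \<gamma>"
proof -
  let ?\<nu> = "distr P borel fst"
  let ?S = "\<lambda>x. \<forall>k\<ge>1. \<forall>i\<in>v. real (card {j \<in> v - {i}. i \<in> knn k x (v - {j}) (x j)}) \<le> real k * \<gamma>"
  have fin: "finite v" and vn: "v \<subseteq> {1..n}" and vN: "v \<subseteq> {1..N}" using blockD[OF v] nN by auto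
  note fstP = P_measurable(1)
  have \<nu>: "prob_space ?\<nu>" using fstP by (rule prob_space.prob_space_distr[OF P(1)])
  have fst\<nu>: "fst \<in> measurable P ?\<nu>" using fstP by simp
  have rm: "(\<lambda>u. \<lambda>a\<in>v. u a) \<in> measurable UM (Pi\<^sub>M v \<mu>)"
    by (intro measurable_restrict measurable_component_singleton) (rule subsetD[OF vN])
  have cm: "compose v fst \<in> measurable (\<Pi>\<^sub>M i\<in>v. P) (\<Pi>\<^sub>M i\<in>v. ?\<nu>)"
    unfolding compose_def by (intro measurable_restrict measurable_PiM_component_compose fst\<nu>)
  have "AE x in (\<Pi>\<^sub>M i\<in>v. ?\<nu>). ?S x"
    by (rule stone[unfolded stone_constant_def, THEN spec, THEN mp, OF fin])
  also have "(\<Pi>\<^sub>M i\<in>v. ?\<nu>) = distr (\<Pi>\<^sub>M i\<in>v. P) (\<Pi>\<^sub>M i\<in>v. ?\<nu>) (compose v fst)"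
    unfolding distr_PiM_finite_prob_space'[OF fin P(1) \<nu> fst\<nu>] by (intro PiM_cong refl distr_cong) simp_all
  finally have "AE t in (\<Pi>\<^sub>M i\<in>v. P). ?S (compose v fst t)"
    by (rule AE_distrD[OF cm])
  also have "(\<Pi>\<^sub>M i\<in>v. P) = Pi\<^sub>M v \<mu>" using vn by (intro PiM_cong refl \<mu>_P[symmetric]) blast
  also have "Pi\<^sub>M v \<mu> = distr UM (Pi\<^sub>M v \<mu>) (\<lambda>u. \<lambda>a\<in>v. u a)"
    by (rule distr_PiM_reindex[of "{1..N}" \<mu> "\<lambda>a. a" v, OF \<mu>, symmetric]) (use vN in \<open>simp_all add: inj_on_def Pi_iff subset_iff\<close>)
  finally have "AE u in UM. ?S (compose v fst (\<lambda>a\<in>v. u a))"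
    by (rule AE_distrD[OF rm])
  then show ?thesis
  proof eventually_elim
    case (elim u)
    show ?case
    proof
      fix j assume j: "j \<in> v"
      have c: "compose v fst (\<lambda>a\<in>v. u a) a = pt u a" if "a \<in> v" for a using that by (simp add: compose_def pt_def)
      have kn: "knn k (compose v fst (\<lambda>a\<in>v. u a)) (v - {i}) (compose v fst (\<lambda>a\<in>v. u a) i) = knn k (pt u) (v - {i}) (pt u i)"
        if "i \<in> v" for i
        unfolding c[OF that] by (rule knn_cong) (simp add: c)
      have "{i \<in> v - {j}. j \<in> knn k (compose v fst (\<lambda>a\<in>v. u a)) (v - {i}) (compose v fst (\<lambda>a\<in>v. u a) i)}
          = {i \<in> v - {j}. j \<in> knn k (pt u) (v - {i}) (pt u i)}" using kn by auto
      then have "real (card {i \<in> v - {j}. j \<in> knn k (pt u) (v - {i}) (pt u i)}) \<le> real k * \<gamma>"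
        using elim[rule_format, OF k j] by (simp only:)
      then show "real (infl v j u) \<le> real k * \<gamma>"
        using infl_le_neighbours[OF v j, of u] by linarith
    qed
  qed
qed

end

section \<open>Averages over blocks\<close>

text \<open>Glue a bijection from \<open>A\<close> to \<open>B\<close> to one between the
  complements.\<close>

lemma ex_permutes_image:
  assumes "finite S" "A \<subseteq> S" "B \<subseteq> S" "card A = card B"
  shows "\<exists>\<tau>. \<tau> permutes S \<and> \<tau> ` A = B"
proof -
  have fin: "finite A" "finite B" using assms finite_subset by blast+
  obtain f where f: "bij_betw f A B" using finite_same_card_bij[OF fin assms(4)] by blast
  have "card (S - A) = card (S - B)" using assms fin by (simp add: card_Diff_subset)
  then obtain g where g: "bij_betw g (S - A) (S - B)"
    using finite_same_card_bij[of "S - A" "S - B"] assms(1) by blast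
  define \<tau> where "\<tau> x = (if x \<in> A then f x else if x \<in> S then g x else x)" for x
  have \<tau>A: "bij_betw \<tau> A B" by (rule bij_betw_cong[THEN iffD1, OF _ f]) (simp add: \<tau>_def)
  have \<tau>C: "bij_betw \<tau> (S - A) (S - B)" by (rule bij_betw_cong[THEN iffD1, OF _ g]) (simp add: \<tau>_def)
  have "bij_betw \<tau> (A \<union> (S - A)) (B \<union> (S - B))" by (rule bij_betw_combine[OF \<tau>A \<tau>C]) blast
  moreover have "A \<union> (S - A) = S" "B \<union> (S - B) = S" using assms by blast+
  ultimately have "bij_betw \<tau> S S" by simp
  then have "\<tau> permutes S" using assms(2) by (intro bij_imp_permutes) (auto simp: \<tau>_def)
  moreover have "\<tau> ` A = B" using \<tau>A by (simp add: bij_betw_def)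
  ultimately show ?thesis by blast
qed

text \<open>The sum over all permutations depends on \<open>A\<close> only through its size, since
  sets of equal size are carried to each other by a permutation that can be composed in. It may
  therefore be averaged over all such sets, and for a fixed permutation the images run through
  \<open>Bs\<close> once.\<close>

lemma sum_permutes_image:
  fixes F :: "'a set \<Rightarrow> real"
  assumes S: "finite S" and A: "A \<subseteq> S"
  defines "Bs \<equiv> {B. B \<subseteq> S \<and> card B = card A}"
  shows "real (card Bs) * (\<Sum>\<sigma> | \<sigma> permutes S. F (\<sigma> ` A)) = fact (card S) * (\<Sum>B\<in>Bs. F B)"
proof -
  let ?Ps = "{\<sigma>. \<sigma> permutes S}"
  have same: "(\<Sum>\<sigma>\<in>?Ps. F (\<sigma> ` B)) = (\<Sum>\<sigma>\<in>?Ps. F (\<sigma> ` A))" if B: "B \<in> Bs" for B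
  proof -
    obtain \<tau> where \<tau>: "\<tau> permutes S" "\<tau> ` A = B"
      using ex_permutes_image[OF S A, of B] B by (auto simp: Bs_def)
    have "bij_betw (\<lambda>\<sigma>. \<sigma> \<circ> \<tau>) ?Ps ?Ps"
    proof (rule bij_betwI[where g = "\<lambda>\<sigma>. \<sigma> \<circ> inv \<tau>"])
      show "(\<lambda>\<sigma>. \<sigma> \<circ> \<tau>) \<in> ?Ps \<rightarrow> ?Ps" using \<tau>(1) by (auto intro: permutes_compose)
      show "(\<lambda>\<sigma>. \<sigma> \<circ> inv \<tau>) \<in> ?Ps \<rightarrow> ?Ps" using permutes_inv[OF \<tau>(1)] by (auto intro: permutes_compose)
      show "(\<sigma> \<circ> \<tau>) \<circ> inv \<tau> = \<sigma>" for \<sigma> by (simp add: comp_assoc permutes_inv_o[OF \<tau>(1)])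
      show "(\<sigma> \<circ> inv \<tau>) \<circ> \<tau> = \<sigma>" for \<sigma> by (simp add: comp_assoc permutes_inv_o[OF \<tau>(1)])
    qed
    then have "(\<Sum>\<sigma>\<in>?Ps. F ((\<sigma> \<circ> \<tau>) ` A)) = (\<Sum>\<sigma>\<in>?Ps. F (\<sigma> ` A))"
      by (rule sum.reindex_bij_betw)
    then show ?thesis unfolding image_comp[symmetric] \<tau>(2) .
  qed
  have "real (card Bs) * (\<Sum>\<sigma>\<in>?Ps. F (\<sigma> ` A)) = (\<Sum>B\<in>Bs. \<Sum>\<sigma>\<in>?Ps. F (\<sigma> ` B))"
    by (simp add: same)
  also have "\<dots> = (\<Sum>\<sigma>\<in>?Ps. \<Sum>B\<in>Bs. F (\<sigma> ` B))" by (rule sum.swap)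
  also have "\<dots> = (\<Sum>\<sigma>\<in>?Ps. \<Sum>B\<in>Bs. F B)"
  proof (rule sum.cong[OF refl])
    fix \<sigma> assume "\<sigma> \<in> ?Ps"
    then have \<sigma>: "\<sigma> permutes S" by simp
    have "bij_betw (image \<sigma>) Bs Bs"
    proof (rule bij_betwI[where g = "image (inv \<sigma>)"])
      have im: "\<tau> ` B \<in> Bs" if "\<tau> permutes S" "B \<in> Bs" for \<tau> B
        using that permutes_image[OF that(1)] card_image[OF permutes_inj_on[OF that(1)], of B] by (auto simp: Bs_def)
      show "image \<sigma> \<in> Bs \<rightarrow> Bs" using im[OF \<sigma>] by blast
      show "image (inv \<sigma>) \<in> Bs \<rightarrow> Bs" using im[OF permutes_inv[OF \<sigma>]] by blast
      show "inv \<sigma> ` \<sigma> ` B = B" for B by (simp add: image_comp permutes_inv_o[OF \<sigma>])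
      show "\<sigma> ` inv \<sigma> ` B = B" for B by (simp add: image_comp permutes_inv_o[OF \<sigma>])
    qed
    then show "(\<Sum>B\<in>Bs. F (\<sigma> ` B)) = (\<Sum>B\<in>Bs. F B)" by (rule sum.reindex_bij_betw)
  qed
  also have "\<dots> = fact (card S) * (\<Sum>B\<in>Bs. F B)"
    using card_permutations[OF refl S] by simp
  finally show ?thesis .
qed

lemma majority_cong:
  assumes "\<And>a b. a \<in> e \<Longrightarrow> b \<in> e \<Longrightarrow> lt' a b \<longleftrightarrow> lt a b" and "\<And>a. a \<in> e \<Longrightarrow> y' a = y a"
  shows "majority k lt' y' e b = majority k lt y e b"
proof -
  have "nearest k lt' e = nearest k lt e"
    unfolding nearest_def
  proof (rule Collect_cong, rule conj_cong[OF refl])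
    fix i assume "i \<in> e"
    then have "{j \<in> e. lt' j i} = {j \<in> e. lt j i}" using assms(1) by blast
    then show "card {j \<in> e. lt' j i} < k \<longleftrightarrow> card {j \<in> e. lt j i} < k" by (simp only:)
  qed
  moreover have "(\<Sum>i\<in>nearest k lt e. y' i) = (\<Sum>i\<in>nearest k lt e. y i)"
    by (rule sum.cong[OF refl], rule assms(2)) (simp add: nearest_def)
  ultimately show ?thesis by (simp only: majority_def)
qed

section \<open>Almost sure and mean bounds for \<open>W\<close> on a single block\<close>

context knn_sample
begin

definition Wmax :: real where "Wmax = 1 + (1 + 2 * (real k * \<gamma>))\<^sup>2"
text \<open>If \<open>a\<close> and \<open>b\<close> are the two influences of a point, then
  \<open>(1 + a + b)\<^sup>2 \<le> 1 + (2 + 2 * k * \<gamma>) * (a + b)\<close>, because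
  \<open>a + b \<le> 2 * k * \<gamma>\<close> almost surely. The sums of \<open>a\<close> and of
  \<open>b\<close> over a block have means of at most \<open>m * pivot_bound k\<close>. Division by
  \<open>m\<close> and the leading \<open>1\<close> of \<open>W\<close> give this value.\<close>

definition Wmean :: real where "Wmean = 2 + (2 + 2 * (real k * \<gamma>)) * (2 * pivot_bound k)"

lemma Wmax_pos: "0 < Wmax"
  unfolding Wmax_def using zero_le_power2[of "1 + 2 * (real k * \<gamma>)"] by linarith

lemma Wmean_pos: "0 < Wmean"
  unfolding Wmean_def using gamma_ge_1 pivot_bound_nonneg[of k] by (simp add: add_pos_nonneg)

lemma block_N: "v \<in> blocks \<Longrightarrow> j \<in> v \<Longrightarrow> j \<in> {1..N}"
  using blockD(1)[of v] nN by force

text \<open>By \<open>distr_PiM_update\<close>, resampling one coordinate preserves the law, so the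
  almost sure bound survives it.\<close>

lemma AE_infl_pair:
  assumes v: "v \<in> blocks"
  shows "AE x in UM \<Otimes>\<^sub>M UM. \<forall>j\<in>v. real (infl v j (fst x)) \<le> real k * \<gamma>
    \<and> real (infl v j ((fst x)(j := snd x j))) \<le> real k * \<gamma>"
proof -
  interpret U: prob_space UM by (rule prob_space_UM)
  have "AE u in distr (UM \<Otimes>\<^sub>M UM) UM fst. \<forall>j\<in>v. real (infl v j u) \<le> real k * \<gamma>"
    unfolding U.distr_pair_fst by (rule AE_infl_le[OF v])
  then have 1: "AE x in UM \<Otimes>\<^sub>M UM. \<forall>j\<in>v. real (infl v j (fst x)) \<le> real k * \<gamma>"
    by (rule AE_distrD[OF measurable_fst])
  have "AE x in UM \<Otimes>\<^sub>M UM. real (infl v j ((fst x)(j := snd x j))) \<le> real k * \<gamma>" if j: "j \<in> v" for j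
  proof -
    note jN = block_N[OF v j]
    have "AE u in UM. real (infl v j u) \<le> real k * \<gamma>" using AE_infl_le[OF v] by eventually_elim (use j in blast)
    then have "AE u in distr (UM \<Otimes>\<^sub>M UM) UM (\<lambda>(u, u'). u(j := u' j)). real (infl v j u) \<le> real k * \<gamma>"
      unfolding distr_PiM_update[where M = \<mu>, OF \<mu> finite_atLeastAtMost jN] .
    from AE_distrD[OF update_measurable[OF jN] this] show ?thesis by (simp add: case_prod_beta')
  qed
  then have "AE x in UM \<Otimes>\<^sub>M UM. \<forall>j\<in>v. real (infl v j ((fst x)(j := snd x j))) \<le> real k * \<gamma>"
    using blockD(3)[OF v] by (intro AE_finite_allI)
  with 1 show ?thesis by eventually_elim blast
qed

lemma W_le_Wmax:
  assumes v: "v \<in> blocks" and a: "\<forall>j\<in>v. real (infl v j u) \<le> real k * \<gamma> \<and> real (infl v j (u(j := u' j))) \<le> real k * \<gamma>"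
  shows "W v u u' \<le> Wmax"
proof -
  have "(\<Sum>j\<in>v. (1 + real (infl v j u) + real (infl v j (u(j := u' j))))\<^sup>2) \<le> (\<Sum>j\<in>v. (1 + 2 * (real k * \<gamma>))\<^sup>2)"
  proof (rule sum_mono, rule power_mono)
    fix j assume "j \<in> v"
    then have "real (infl v j u) \<le> real k * \<gamma>" "real (infl v j (u(j := u' j))) \<le> real k * \<gamma>" using a by blast+
    then show "1 + real (infl v j u) + real (infl v j (u(j := u' j))) \<le> 1 + 2 * (real k * \<gamma>)" by linarith
  qed simp
  also have "\<dots> = real m * (1 + 2 * (real k * \<gamma>))\<^sup>2" using blockD(2)[OF v] by simp
  finally show ?thesis using m_bounds(3) by (simp add: W_def Wmax_def field_simps)
qed

lemma AE_W_le:
  assumes v: "v \<in> blocks"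
  shows "AE x in UM \<Otimes>\<^sub>M UM. W v (fst x) (snd x) \<le> Wmax"
  using AE_infl_pair[OF v] by eventually_elim (rule W_le_Wmax[OF v])

text \<open>One of the two factors of the square is bounded almost surely and the other in the mean,
  as described at \<open>Wmean\<close>. The influences after resampling have the same means as those
  before.\<close>

lemma nn_integral_W_le:
  assumes v: "v \<in> blocks"
  shows "(\<integral>\<^sup>+x. ennreal (W v (fst x) (snd x)) \<partial>(UM \<Otimes>\<^sub>M UM)) \<le> ennreal Wmean"
proof -
  interpret U: prob_space UM by (rule prob_space_UM)
  interpret UU: pair_prob_space UM UM ..
  let ?a = "\<lambda>j x. real (infl v j (fst x))" and ?b = "\<lambda>j x. real (infl v j ((fst x)(j := snd x j)))"
  define c where "c = (2 + 2 * (real k * \<gamma>)) / real m"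
  have c0: "0 \<le> c" using gamma_ge_1 by (simp add: c_def)
  have am: "(\<lambda>x. ?a j x) \<in> borel_measurable (UM \<Otimes>\<^sub>M UM)" for j
    by (rule measurable_compose[OF measurable_fst measurable_compose[OF infl_measurable[OF v]]]) simp
  have bm: "(\<lambda>x. ?b j x) \<in> borel_measurable (UM \<Otimes>\<^sub>M UM)" if "j \<in> v" for j
  proof -
    have "(\<lambda>x. infl v j ((fst x)(j := snd x j))) \<in> measurable (UM \<Otimes>\<^sub>M UM) (count_space UNIV)"
      using infl_update_measurable[OF v that] by (simp add: case_prod_beta')
    then show ?thesis by (rule measurable_compose) simp
  qed
  have sa: "(\<integral>\<^sup>+x. ennreal (\<Sum>j\<in>v. ?a j x) \<partial>(UM \<Otimes>\<^sub>M UM)) \<le> ennreal (real m * pivot_bound k)"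
  proof -
    have mm: "(\<lambda>u. ennreal (\<Sum>j\<in>v. real (infl v j u))) \<in> borel_measurable UM"
      by (intro measurable_compose[OF _ measurable_ennreal] borel_measurable_sum measurable_compose[OF infl_measurable[OF v]]) simp
    have "(\<integral>\<^sup>+x. ennreal (\<Sum>j\<in>v. ?a j x) \<partial>(UM \<Otimes>\<^sub>M UM))
        = (\<integral>\<^sup>+u. ennreal (\<Sum>j\<in>v. real (infl v j u)) \<partial>distr (UM \<Otimes>\<^sub>M UM) UM fst)"
      using mm by (subst nn_integral_distr[OF measurable_fst]) simp_all
    also have "\<dots> \<le> ennreal (real m * pivot_bound k)"
      unfolding U.distr_pair_fst by (rule nn_integral_sum_infl_le[OF v])
    finally show ?thesis .
  qed
  have sb: "(\<integral>\<^sup>+x. ennreal (\<Sum>j\<in>v. ?b j x) \<partial>(UM \<Otimes>\<^sub>M UM)) \<le> ennreal (real m * pivot_bound k)"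
  proof -
    have im: "(\<lambda>u. ennreal (real (infl v j u))) \<in> borel_measurable UM" for j
      by (rule measurable_compose[OF infl_measurable[OF v]]) simp
    have "(\<integral>\<^sup>+x. ennreal (\<Sum>j\<in>v. ?b j x) \<partial>(UM \<Otimes>\<^sub>M UM)) = (\<integral>\<^sup>+x. (\<Sum>j\<in>v. ennreal (?b j x)) \<partial>(UM \<Otimes>\<^sub>M UM))"
      by (intro nn_integral_cong) (simp add: sum_ennreal)
    also have "\<dots> = (\<Sum>j\<in>v. \<integral>\<^sup>+x. ennreal (?b j x) \<partial>(UM \<Otimes>\<^sub>M UM))"
      by (intro nn_integral_sum measurable_compose[OF _ measurable_ennreal] bm)
    also have "\<dots> = (\<Sum>j\<in>v. \<integral>\<^sup>+u. ennreal (real (infl v j u)) \<partial>UM)"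
    proof (rule sum.cong[OF refl])
      fix j assume j: "j \<in> v"
      note jN = block_N[OF v j]
      have "(\<integral>\<^sup>+u. ennreal (real (infl v j u)) \<partial>UM)
          = (\<integral>\<^sup>+u. ennreal (real (infl v j u)) \<partial>distr (UM \<Otimes>\<^sub>M UM) UM (\<lambda>(u, u'). u(j := u' j)))"
        unfolding distr_PiM_update[where M = \<mu>, OF \<mu> finite_atLeastAtMost jN] ..
      also have "\<dots> = (\<integral>\<^sup>+x. ennreal (?b j x) \<partial>(UM \<Otimes>\<^sub>M UM))"
        using im by (subst nn_integral_distr[OF update_measurable[OF jN]]) (simp_all add: case_prod_beta')
      finally show "(\<integral>\<^sup>+x. ennreal (?b j x) \<partial>(UM \<Otimes>\<^sub>M UM)) = (\<integral>\<^sup>+u. ennreal (real (infl v j u)) \<partial>UM)" ..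
    qed
    also have "\<dots> = (\<integral>\<^sup>+u. (\<Sum>j\<in>v. ennreal (real (infl v j u))) \<partial>UM)"
      by (intro nn_integral_sum[symmetric] im)
    also have "\<dots> = (\<integral>\<^sup>+u. ennreal (\<Sum>j\<in>v. real (infl v j u)) \<partial>UM)"
      by (intro nn_integral_cong) (simp add: sum_ennreal)
    finally show ?thesis using nn_integral_sum_infl_le[OF v] by simp
  qed
  have "(\<integral>\<^sup>+x. ennreal (W v (fst x) (snd x)) \<partial>(UM \<Otimes>\<^sub>M UM))
      \<le> (\<integral>\<^sup>+x. ennreal 2 + ennreal c * (ennreal (\<Sum>j\<in>v. ?a j x) + ennreal (\<Sum>j\<in>v. ?b j x)) \<partial>(UM \<Otimes>\<^sub>M UM))"
  proof (rule nn_integral_mono_AE)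
    show "AE x in UM \<Otimes>\<^sub>M UM. ennreal (W v (fst x) (snd x))
        \<le> ennreal 2 + ennreal c * (ennreal (\<Sum>j\<in>v. ?a j x) + ennreal (\<Sum>j\<in>v. ?b j x))"
      using AE_infl_pair[OF v]
    proof eventually_elim
      case (elim x)
      have "(\<Sum>j\<in>v. (1 + ?a j x + ?b j x)\<^sup>2) \<le> (\<Sum>j\<in>v. 1 + (2 + 2 * (real k * \<gamma>)) * (?a j x + ?b j x))"
      proof (rule sum_mono)
        fix j assume "j \<in> v"
        then have "?a j x + ?b j x \<le> 2 * (real k * \<gamma>)" using elim by fastforce
        then have "(?a j x + ?b j x) * (?a j x + ?b j x) \<le> 2 * (real k * \<gamma>) * (?a j x + ?b j x)"
          by (intro mult_right_mono) auto
        then show "(1 + ?a j x + ?b j x)\<^sup>2 \<le> 1 + (2 + 2 * (real k * \<gamma>)) * (?a j x + ?b j x)"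
          by (simp add: power2_eq_square algebra_simps)
      qed
      also have "\<dots> = real m + (2 + 2 * (real k * \<gamma>)) * ((\<Sum>j\<in>v. ?a j x) + (\<Sum>j\<in>v. ?b j x))"
        using blockD(2)[OF v] by (simp add: sum.distrib sum_distrib_left[symmetric])
      finally have "W v (fst x) (snd x) \<le> 1 + (1 / real m) * (real m + (2 + 2 * (real k * \<gamma>)) * ((\<Sum>j\<in>v. ?a j x) + (\<Sum>j\<in>v. ?b j x)))"
        unfolding W_def by (intro add_left_mono mult_left_mono) auto
      also have "\<dots> = 2 + c * ((\<Sum>j\<in>v. ?a j x) + (\<Sum>j\<in>v. ?b j x))"
        using m_bounds(3) by (simp add: c_def field_simps)
      finally have "ennreal (W v (fst x) (snd x)) \<le> ennreal (2 + c * ((\<Sum>j\<in>v. ?a j x) + (\<Sum>j\<in>v. ?b j x)))"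
        by (rule ennreal_leI)
      also have "\<dots> = ennreal 2 + ennreal c * (ennreal (\<Sum>j\<in>v. ?a j x) + ennreal (\<Sum>j\<in>v. ?b j x))"
        using c0 by (simp add: ennreal_plus ennreal_mult sum_nonneg del: ennreal_numeral)
      finally show ?case .
    qed
  qed
  also have "\<dots> = ennreal 2 + ennreal c * ((\<integral>\<^sup>+x. ennreal (\<Sum>j\<in>v. ?a j x) \<partial>(UM \<Otimes>\<^sub>M UM)) + (\<integral>\<^sup>+x. ennreal (\<Sum>j\<in>v. ?b j x) \<partial>(UM \<Otimes>\<^sub>M UM)))"
  proof -
    have [measurable]: "(\<lambda>x. ennreal (\<Sum>j\<in>v. ?a j x)) \<in> borel_measurable (UM \<Otimes>\<^sub>M UM)"
      by (intro measurable_compose[OF _ measurable_ennreal] borel_measurable_sum am)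
    have [measurable]: "(\<lambda>x. ennreal (\<Sum>j\<in>v. ?b j x)) \<in> borel_measurable (UM \<Otimes>\<^sub>M UM)"
      by (intro measurable_compose[OF _ measurable_ennreal] borel_measurable_sum bm)
    show ?thesis
      by (simp add: nn_integral_add nn_integral_cmult UU.emeasure_space_1 del: ennreal_numeral One_nat_def)
  qed
  also have "\<dots> \<le> ennreal 2 + ennreal c * (ennreal (real m * pivot_bound k) + ennreal (real m * pivot_bound k))"
    by (intro add_left_mono mult_left_mono add_mono sa sb) auto
  also have "\<dots> = ennreal (2 + c * (real m * pivot_bound k + real m * pivot_bound k))"
  proof -
    have A: "0 \<le> real m * pivot_bound k" using pivot_bound_nonneg[of k] by simp
    show ?thesis
      using c0 A by (simp only: ennreal_plus[symmetric] ennreal_mult[symmetric] add_nonneg_nonneg mult_nonneg_nonneg zero_le_numeral)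
  qed
  also have "2 + c * (real m * pivot_bound k + real m * pivot_bound k) = Wmean"
    using m_bounds(3) by (simp add: c_def Wmean_def field_simps)
  finally show ?thesis .
qed

definition dep :: "nat set \<Rightarrow> nat set" where "dep v = v \<union> (\<lambda>i. pos (v - {i}, i)) ` v"

text \<open>The test point that a coin belongs to lies in the block of that coin, so disjoint blocks
  share no coin; and coins sit beyond \<open>n\<close>, where no block has points.\<close>

lemma dep_disjoint:
  assumes v: "v \<in> blocks" "w \<in> blocks" "v \<inter> w = {}"
  shows "dep v \<inter> dep w = {}"
proof -
  have "pos (v - {i}, i) \<noteq> pos (w - {j}, j)" if "i \<in> v" "j \<in> w" for i j
  proof
    assume "pos (v - {i}, i) = pos (w - {j}, j)"
    then have "(v - {i}, i) = (w - {j}, j)"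
      using bij_betw_imp_inj_on[OF pos] coin_index_block v that by (blast dest: inj_onD)
    then show False using that v(3) by blast
  qed
  moreover have "pos (v - {i}, i) \<notin> w" if "i \<in> v" for i
    using pos_range[OF v(1) that] blockD(1)[OF v(2)] by force
  moreover have "pos (w - {i}, i) \<notin> v" if "i \<in> w" for i
    using pos_range[OF v(2) that] blockD(1)[OF v(1)] by force
  ultimately show ?thesis unfolding dep_def using v(3) by blast
qed

text \<open>Votes with a deleted point still use the coin of \<open>v - {i}\<close>, so no
  coordinate outside \<open>dep v\<close> is read.\<close>

lemma infl_local:
  assumes uw: "\<And>a. a \<in> dep v \<Longrightarrow> u a = w a"
  shows "infl v j u = infl v j w"
proof -
  have "pred_vote u v i e = pred_vote w v i e" if "i \<in> v" "e \<subseteq> v" for i e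
  proof -
    have c: "coin u (v - {i}) i = coin w (v - {i}) i"
      unfolding coin_def using that(1) by (subst uw) (simp_all add: dep_def)
    have e: "pt u a = pt w a" "lab u a = lab w a" if "a \<in> v" for a
      unfolding pt_def lab_def using that by (simp_all add: uw dep_def)
    show ?thesis
      unfolding pred_vote_def c
      by (rule majority_cong) (use that e in \<open>simp_all add: lex_less_def subset_iff\<close>)
  qed
  then have "{i \<in> v - {j}. pred_vote u v i (v - {i}) \<noteq> pred_vote u v i (v - {i} - {j})}
      = {i \<in> v - {j}. pred_vote w v i (v - {i}) \<noteq> pred_vote w v i (v - {i} - {j})}"
    by (intro Collect_cong conj_cong refl) (simp add: subset_iff)
  then show ?thesis unfolding infl_def by (rule arg_cong)
qed

lemma W_local:
  assumes "\<And>a. a \<in> dep v \<Longrightarrow> u a = w a" "\<And>a. a \<in> dep v \<Longrightarrow> u' a = w' a"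
  shows "W v u u' = W v w w'"
proof -
  have "infl v j u = infl v j w" for j by (rule infl_local) (rule assms(1))
  moreover have "infl v j (u(j := u' j)) = infl v j (w(j := w' j))" for j
    by (rule infl_local) (use assms in auto)
  ultimately show ?thesis by (simp add: W_def)
qed

text \<open>Convexity bounds \<open>exp\<close> on the range of \<open>t * W\<close> by its chord
  from \<open>0\<close> to \<open>t * Wmax\<close>, which is linear in \<open>W\<close>. Hence the
  mean of \<open>W\<close> is all that enters, and \<open>1 + x \<le> exp x\<close>
  finishes.\<close>

lemma nn_integral_exp_W_le:
  assumes v: "v \<in> blocks" and t: "0 \<le> t"
  shows "(\<integral>\<^sup>+x. ennreal (exp (t * W v (fst x) (snd x))) \<partial>(UM \<Otimes>\<^sub>M UM))
    \<le> ennreal (exp (Wmean * (exp (t * Wmax) - 1) / Wmax))"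
proof -
  interpret U: prob_space UM by (rule prob_space_UM)
  interpret UU: pair_prob_space UM UM ..
  define c where "c = (exp (t * Wmax) - 1) / Wmax"
  have c0: "0 \<le> c" using t Wmax_pos by (simp add: c_def)
  have Wm: "(\<lambda>x. ennreal (W v (fst x) (snd x))) \<in> borel_measurable (UM \<Otimes>\<^sub>M UM)"
    using W_measurable[OF v] by (simp add: case_prod_beta')
  have "(\<integral>\<^sup>+x. ennreal (exp (t * W v (fst x) (snd x))) \<partial>(UM \<Otimes>\<^sub>M UM))
      \<le> (\<integral>\<^sup>+x. 1 + ennreal c * ennreal (W v (fst x) (snd x)) \<partial>(UM \<Otimes>\<^sub>M UM))"
  proof (rule nn_integral_mono_AE)
    show "AE x in UM \<Otimes>\<^sub>M UM. ennreal (exp (t * W v (fst x) (snd x))) \<le> 1 + ennreal c * ennreal (W v (fst x) (snd x))"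
      using AE_W_le[OF v]
    proof eventually_elim
      case (elim x)
      define w where "w = W v (fst x) (snd x)"
      have w: "0 \<le> w" "w \<le> Wmax" using W_ge_1[of v "fst x" "snd x"] elim by (auto simp: w_def)
      have "exp ((1 - w / Wmax) *\<^sub>R 0 + (w / Wmax) *\<^sub>R (t * Wmax)) \<le> (1 - w / Wmax) * exp 0 + (w / Wmax) * exp (t * Wmax)"
        by (rule convex_onD[OF exp_convex]) (use w Wmax_pos in auto)
      also have "(1 - w / Wmax) *\<^sub>R 0 + (w / Wmax) *\<^sub>R (t * Wmax) = t * w" using Wmax_pos by simp
      also have "(1 - w / Wmax) * exp 0 + (w / Wmax) * exp (t * Wmax) = 1 + c * w"
        using Wmax_pos by (simp add: c_def field_simps)
      finally have "ennreal (exp (t * w)) \<le> ennreal (1 + c * w)" by (rule ennreal_leI)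
      also have "\<dots> = 1 + ennreal c * ennreal w" using c0 w by (simp add: ennreal_plus ennreal_mult)
      finally show ?case by (simp add: w_def)
    qed
  qed
  also have "\<dots> = 1 + ennreal c * (\<integral>\<^sup>+x. ennreal (W v (fst x) (snd x)) \<partial>(UM \<Otimes>\<^sub>M UM))"
    using Wm by (simp add: nn_integral_add nn_integral_cmult UU.emeasure_space_1 del: One_nat_def)
  also have "\<dots> \<le> 1 + ennreal c * ennreal Wmean"
    by (intro add_left_mono mult_left_mono nn_integral_W_le[OF v]) simp
  also have "\<dots> = ennreal (1 + Wmean * c)" using c0 Wmean_pos by (simp add: ennreal_plus ennreal_mult mult.commute)
  also have "\<dots> \<le> ennreal (exp (Wmean * c))" by (intro ennreal_leI exp_ge_add_one_self)
  finally show ?thesis by (simp add: c_def)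
qed

section \<open>Moments of the average over all blocks\<close>

definition avgW :: "(nat \<Rightarrow> (real ^ 'd) \<times> nat) \<Rightarrow> (nat \<Rightarrow> (real ^ 'd) \<times> nat) \<Rightarrow> real" where
  "avgW u u' = (\<Sum>v\<in>blocks. W v u u') / real (card blocks)"

lemma card_blocks: "card blocks = n choose m" "0 < card blocks"
proof -
  show 1: "card blocks = n choose m" unfolding blocks_def using n_subsets[of "{1..n}" m] by simp
  show "0 < card blocks" unfolding 1 using m_bounds(2) by (simp add: zero_less_binomial)
qed

lemma avgW_ge_1: "1 \<le> avgW u u'"
proof -
  have "real (card blocks) * 1 \<le> (\<Sum>v\<in>blocks. W v u u')"
    by (rule sum_bounded_below) (rule W_ge_1)
  then show ?thesis using card_blocks(2) by (simp add: avgW_def field_simps)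
qed

lemma avgW_measurable: "(\<lambda>x. avgW (fst x) (snd x)) \<in> borel_measurable (UM \<Otimes>\<^sub>M UM)"
proof -
  have "(\<lambda>x. W v (fst x) (snd x)) \<in> borel_measurable (UM \<Otimes>\<^sub>M UM)" if "v \<in> blocks" for v
    using W_measurable[OF that] by (simp add: case_prod_beta')
  then show ?thesis unfolding avgW_def by (intro borel_measurable_divide borel_measurable_sum) auto
qed

lemma AE_avgW_le: "AE x in UM \<Otimes>\<^sub>M UM. avgW (fst x) (snd x) \<le> Wmax"
proof -
  have "AE x in UM \<Otimes>\<^sub>M UM. \<forall>v\<in>blocks. W v (fst x) (snd x) \<le> Wmax"
    using finite_blocks AE_W_le by (intro AE_finite_allI)
  then show ?thesis
  proof eventually_elim
    case (elim x)
    then have "(\<Sum>v\<in>blocks. W v (fst x) (snd x)) \<le> real (card blocks) * Wmax"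
      by (intro sum_bounded_above) blast
    then show ?case using card_blocks(2) by (simp add: avgW_def field_simps)
  qed
qed

lemma nn_integral_avgW_le: "(\<integral>\<^sup>+x. ennreal (avgW (fst x) (snd x)) \<partial>(UM \<Otimes>\<^sub>M UM)) \<le> ennreal Wmean"
proof -
  define c where "c = 1 / real (card blocks)"
  have c0: "0 \<le> c" by (simp add: c_def)
  have Wm: "(\<lambda>x. ennreal (W v (fst x) (snd x))) \<in> borel_measurable (UM \<Otimes>\<^sub>M UM)" if "v \<in> blocks" for v
    using W_measurable[OF that] by (simp add: case_prod_beta')
  have W0: "0 \<le> W v u u'" for v u u' using W_ge_1[of v u u'] by linarith
  have "(\<integral>\<^sup>+x. ennreal (avgW (fst x) (snd x)) \<partial>(UM \<Otimes>\<^sub>M UM))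
      = (\<integral>\<^sup>+x. ennreal c * (\<Sum>v\<in>blocks. ennreal (W v (fst x) (snd x))) \<partial>(UM \<Otimes>\<^sub>M UM))"
  proof (rule nn_integral_cong)
    fix x
    have "avgW (fst x) (snd x) = c * (\<Sum>v\<in>blocks. W v (fst x) (snd x))" by (simp add: avgW_def c_def)
    then show "ennreal (avgW (fst x) (snd x)) = ennreal c * (\<Sum>v\<in>blocks. ennreal (W v (fst x) (snd x)))"
      using c0 W0 by (simp add: ennreal_mult sum_nonneg sum_ennreal)
  qed
  also have "\<dots> = ennreal c * (\<Sum>v\<in>blocks. \<integral>\<^sup>+x. ennreal (W v (fst x) (snd x)) \<partial>(UM \<Otimes>\<^sub>M UM))"
    using Wm by (subst nn_integral_cmult) (auto simp: nn_integral_sum)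
  also have "\<dots> \<le> ennreal c * (\<Sum>v\<in>blocks. ennreal Wmean)"
    by (intro mult_left_mono sum_mono nn_integral_W_le) simp_all
  also have "\<dots> = ennreal (c * (real (card blocks) * Wmean))"
    using c0 Wmean_pos by (simp add: ennreal_mult ennreal_of_nat_eq_real_of_nat)
  also have "c * (real (card blocks) * Wmean) = Wmean" using card_blocks(2) by (simp add: c_def)
  finally show ?thesis .
qed

text \<open>Hoeffding's device for U-statistics. For each of the \<open>l\<close> disjoint intervals
  \<open>I b\<close>, the average over blocks equals the average of \<open>W\<close> over the images
  of \<open>I b\<close> under all permutations. So \<open>l * avgW\<close> is an average over
  permutations of sums of \<open>l\<close> independent terms. Convexity of \<open>exp\<close> takes
  that average outside, and the exponential of each sum factors.\<close>

lemma nn_integral_exp_avgW_le: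
  assumes t: "0 \<le> t"
  defines "l \<equiv> n div m"
  shows "(\<integral>\<^sup>+x. ennreal (exp (t * (real l * avgW (fst x) (snd x)))) \<partial>(UM \<Otimes>\<^sub>M UM))
    \<le> ennreal (exp (real l * (Wmean * (exp (t * Wmax) - 1) / Wmax)))"
proof -
  define I where "I b = {b * m + 1..b * m + m}" for b
  define Ps where "Ps = {\<sigma>. \<sigma> permutes {1..n}}"
  have finPs: "finite Ps" unfolding Ps_def by (rule finite_permutations) simp
  have cardPs: "real (card Ps) = fact n" unfolding Ps_def using card_permutations[of "{1..n}" n] by simp
  have I: "I b \<in> blocks" if "b < l" for b
  proof -
    have "Suc b * m \<le> l * m" using that by (intro mult_le_mono1) simp
    also have "\<dots> \<le> n" unfolding l_def by simp
    finally have "b * m + m \<le> n" by simp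
    then show ?thesis unfolding blocks_def I_def by simp
  qed
  have Idisj: "I b \<inter> I b' = {}" if "b \<noteq> b'" for b b'
  proof -
    have "I b \<inter> I b' = {}" if "b < b'" for b b'
    proof -
      have "Suc b * m \<le> b' * m" using that by (intro mult_le_mono1) simp
      then show ?thesis unfolding I_def by auto
    qed
    then show ?thesis using \<open>b \<noteq> b'\<close> by (metis Int_commute linorder_neqE_nat)
  qed
  have \<sigma>I: "\<sigma> ` I b \<in> blocks" if "\<sigma> \<in> Ps" "b < l" for \<sigma> b
  proof -
    have \<sigma>: "\<sigma> permutes {1..n}" using that by (simp add: Ps_def)
    have "\<sigma> ` I b \<subseteq> {1..n}" using permutes_image[OF \<sigma>] blockD(1)[OF I[OF that(2)]] by blast
    moreover have "card (\<sigma> ` I b) = m"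
      using card_image[OF permutes_inj_on[OF \<sigma>], of "I b"] blockD(2)[OF I[OF that(2)]] by simp
    ultimately show ?thesis by (simp add: blocks_def)
  qed
  have avg: "avgW u u' = (\<Sum>\<sigma>\<in>Ps. W (\<sigma> ` I b) u u') / fact n" if "b < l" for b u u'
  proof -
    have "real (card blocks) * (\<Sum>\<sigma>\<in>Ps. W (\<sigma> ` I b) u u') = fact n * (\<Sum>v\<in>blocks. W v u u')"
      using sum_permutes_image[of "{1..n}" "I b" "\<lambda>v. W v u u'"] blockD(1,2)[OF I[OF that]]
      unfolding Ps_def blocks_def by simp
    then show ?thesis using card_blocks(2) unfolding avgW_def
      by (simp add: frac_eq_eq mult.commute)
  qed
  have pointwise: "exp (t * (real l * avgW u u')) \<le> (\<Sum>\<sigma>\<in>Ps. (1 / fact n) * exp (t * (\<Sum>b<l. W (\<sigma> ` I b) u u')))" for u u'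
  proof -
    have "real l * avgW u u' = (\<Sum>b<l. avgW u u')" by simp
    also have "\<dots> = (\<Sum>b<l. (\<Sum>\<sigma>\<in>Ps. W (\<sigma> ` I b) u u') / fact n)"
      by (rule sum.cong[OF refl], rule avg) simp
    also have "\<dots> = (\<Sum>\<sigma>\<in>Ps. (\<Sum>b<l. W (\<sigma> ` I b) u u') / fact n)"
      unfolding sum_divide_distrib[symmetric] by (subst sum.swap) (rule refl)
    finally have "t * (real l * avgW u u') = (\<Sum>\<sigma>\<in>Ps. t * ((\<Sum>b<l. W (\<sigma> ` I b) u u') / fact n))"
      by (simp only: sum_distrib_left[of t _ Ps])
    also have "\<dots> = (\<Sum>\<sigma>\<in>Ps. (1 / fact n) *\<^sub>R (t * (\<Sum>b<l. W (\<sigma> ` I b) u u')))"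
      by (rule sum.cong[OF refl]) simp
    finally have e: "t * (real l * avgW u u') = (\<Sum>\<sigma>\<in>Ps. (1 / fact n) *\<^sub>R (t * (\<Sum>b<l. W (\<sigma> ` I b) u u')))" .
    have ne: "Ps \<noteq> {}" using cardPs by (metis card.empty fact_nonzero of_nat_0)
    show ?thesis
      unfolding e by (rule convex_on_sum[OF finPs ne exp_convex]) (simp_all add: cardPs)
  qed
  have em: "(\<lambda>x. ennreal (exp (t * (\<Sum>b<l. W (\<sigma> ` I b) (fst x) (snd x))))) \<in> borel_measurable (UM \<Otimes>\<^sub>M UM)" if "\<sigma> \<in> Ps" for \<sigma>
  proof -
    have "(\<lambda>x. W (\<sigma> ` I b) (fst x) (snd x)) \<in> borel_measurable (UM \<Otimes>\<^sub>M UM)" if "b < l" for b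
      using W_measurable[OF \<sigma>I[OF \<open>\<sigma> \<in> Ps\<close> that]] by (simp add: case_prod_beta')
    then have "(\<lambda>x. \<Sum>b<l. W (\<sigma> ` I b) (fst x) (snd x)) \<in> borel_measurable (UM \<Otimes>\<^sub>M UM)"
      by (intro borel_measurable_sum) blast
    then show ?thesis by measurable
  qed
  define E where "E = exp (Wmean * (exp (t * Wmax) - 1) / Wmax)"
  have block: "(\<integral>\<^sup>+x. ennreal (exp (t * (\<Sum>b<l. W (\<sigma> ` I b) (fst x) (snd x)))) \<partial>(UM \<Otimes>\<^sub>M UM)) \<le> ennreal (E ^ l)"
    if \<sigma>: "\<sigma> \<in> Ps" for \<sigma>
  proof -
    have per: "\<sigma> permutes {1..n}" using \<sigma> by (simp add: Ps_def)
    have "(\<integral>\<^sup>+x. ennreal (exp (t * (\<Sum>b<l. W (\<sigma> ` I b) (fst x) (snd x)))) \<partial>(UM \<Otimes>\<^sub>M UM))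
        = (\<integral>\<^sup>+(u, u'). (\<Prod>b<l. ennreal (exp (t * W (\<sigma> ` I b) u u'))) \<partial>(UM \<Otimes>\<^sub>M UM))"
      unfolding case_prod_beta' by (intro nn_integral_cong) (simp add: sum_distrib_left exp_sum prod_ennreal)
    also have "\<dots> = (\<Prod>b<l. \<integral>\<^sup>+(u, u'). ennreal (exp (t * W (\<sigma> ` I b) u u')) \<partial>(UM \<Otimes>\<^sub>M UM))"
    proof (rule nn_integral_PiM_pair_prod_disjoint[OF \<mu> _ _ _ , where K = "\<lambda>b. dep (\<sigma> ` I b)"])
      show "(\<lambda>(u, u'). ennreal (exp (t * W (\<sigma> ` I b) u u'))) \<in> borel_measurable (UM \<Otimes>\<^sub>M UM)" if "b \<in> {..<l}" for b
      proof -
        have "(\<lambda>x. W (\<sigma> ` I b) (fst x) (snd x)) \<in> borel_measurable (UM \<Otimes>\<^sub>M UM)"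
          using W_measurable[OF \<sigma>I[OF \<sigma>]] that by (simp add: case_prod_beta')
        then show ?thesis unfolding case_prod_beta' by measurable
      qed
      show "disjoint_family_on (\<lambda>b. dep (\<sigma> ` I b)) {..<l}"
        unfolding disjoint_family_on_def
      proof (intro ballI impI)
        fix b b' assume b: "b \<in> {..<l}" "b' \<in> {..<l}" "b \<noteq> b'"
        have "\<sigma> ` I b \<inter> \<sigma> ` I b' = \<sigma> ` (I b \<inter> I b')"
          by (rule image_Int[symmetric]) (rule permutes_inj[OF per])
        then show "dep (\<sigma> ` I b) \<inter> dep (\<sigma> ` I b') = {}"
          using b by (intro dep_disjoint \<sigma>I[OF \<sigma>]) (simp_all add: Idisj)
      qed
    next
      fix b and u v u' v' :: "nat \<Rightarrow> (real ^ 'd) \<times> nat"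
      assume "\<And>i. i \<in> dep (\<sigma> ` I b) \<Longrightarrow> u i = v i" "\<And>i. i \<in> dep (\<sigma> ` I b) \<Longrightarrow> u' i = v' i"
      then have "W (\<sigma> ` I b) u u' = W (\<sigma> ` I b) v v'" by (rule W_local)
      then show "ennreal (exp (t * W (\<sigma> ` I b) u u')) = ennreal (exp (t * W (\<sigma> ` I b) v v'))" by simp
    qed simp_all
    also have "\<dots> \<le> (\<Prod>b<l. ennreal E)"
    proof (rule prod_mono_ennreal)
      fix b assume "b \<in> {..<l}"
      then show "(\<integral>\<^sup>+(u, u'). ennreal (exp (t * W (\<sigma> ` I b) u u')) \<partial>(UM \<Otimes>\<^sub>M UM)) \<le> ennreal E"
        unfolding E_def case_prod_beta' by (intro nn_integral_exp_W_le[OF \<sigma>I[OF \<sigma>] t]) simp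
    qed
    also have "\<dots> = ennreal (E ^ l)" by (simp add: E_def ennreal_power)
    finally show ?thesis .
  qed
  have "(\<integral>\<^sup>+x. ennreal (exp (t * (real l * avgW (fst x) (snd x)))) \<partial>(UM \<Otimes>\<^sub>M UM))
      \<le> (\<integral>\<^sup>+x. (\<Sum>\<sigma>\<in>Ps. ennreal (1 / fact n) * ennreal (exp (t * (\<Sum>b<l. W (\<sigma> ` I b) (fst x) (snd x))))) \<partial>(UM \<Otimes>\<^sub>M UM))"
  proof (rule nn_integral_mono)
    fix x
    have "ennreal (exp (t * (real l * avgW (fst x) (snd x))))
        \<le> ennreal (\<Sum>\<sigma>\<in>Ps. (1 / fact n) * exp (t * (\<Sum>b<l. W (\<sigma> ` I b) (fst x) (snd x))))"
      by (rule ennreal_leI[OF pointwise])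
    also have "\<dots> = (\<Sum>\<sigma>\<in>Ps. ennreal ((1 / fact n) * exp (t * (\<Sum>b<l. W (\<sigma> ` I b) (fst x) (snd x)))))"
      by (rule sum_ennreal[symmetric]) simp
    finally show "ennreal (exp (t * (real l * avgW (fst x) (snd x))))
        \<le> (\<Sum>\<sigma>\<in>Ps. ennreal (1 / fact n) * ennreal (exp (t * (\<Sum>b<l. W (\<sigma> ` I b) (fst x) (snd x)))))"
      by (simp add: ennreal_mult[symmetric])
  qed
  also have "\<dots> = (\<Sum>\<sigma>\<in>Ps. ennreal (1 / fact n) * (\<integral>\<^sup>+x. ennreal (exp (t * (\<Sum>b<l. W (\<sigma> ` I b) (fst x) (snd x)))) \<partial>(UM \<Otimes>\<^sub>M UM)))"
    using em by (subst nn_integral_sum) (auto simp: nn_integral_cmult intro!: sum.cong)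
  also have "\<dots> \<le> (\<Sum>\<sigma>\<in>Ps. ennreal (1 / fact n) * ennreal (E ^ l))"
    by (intro sum_mono mult_left_mono block) simp_all
  also have "\<dots> = ennreal (\<Sum>\<sigma>\<in>Ps. (1 / fact n) * E ^ l)"
  proof -
    have "ennreal (1 / fact n) * ennreal (E ^ l) = ennreal ((1 / fact n) * E ^ l)"
      by (rule ennreal_mult[symmetric]) (simp_all add: E_def)
    then show ?thesis by (simp only:) (rule sum_ennreal, simp add: E_def)
  qed
  also have "(\<Sum>\<sigma>\<in>Ps. (1 / fact n) * E ^ l) = E ^ l" by (simp add: cardPs)
  also have "E ^ l = exp (real l * (Wmean * (exp (t * Wmax) - 1) / Wmax))"
    unfolding E_def by (rule exp_of_nat_mult[symmetric])
  finally show ?thesis .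
qed

text \<open>A power is dominated by an exponential, whose mean is known. With
  \<open>s = t * Wmax\<close>, the condition \<open>s \<le> 1\<close> gives
  \<open>exp s - 1 \<le> 2 * s\<close>, and the other upper bound for \<open>s\<close> then keeps
  the exponent of the exponential moment below \<open>2 * r\<close>. The minimum in \<open>s\<close>
  turns into the maximum of the statement.\<close>

lemma nn_integral_avgW_powr_le:
  assumes r: "0 < r"
  defines "l \<equiv> n div m"
  shows "(\<integral>\<^sup>+x. ennreal (avgW (fst x) (snd x) powr r) \<partial>(UM \<Otimes>\<^sub>M UM))
    \<le> ennreal ((exp 1 * max (r * Wmax / real l) Wmean) powr r)"
proof -
  have l: "0 < real l" unfolding l_def using m_bounds by (simp add: div_greater_zero_iff)
  define s where "s = min 1 (r * Wmax / (real l * Wmean))"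
  have s: "0 < s" "s \<le> 1" "s \<le> r * Wmax / (real l * Wmean)"
    using r l Wmax_pos Wmean_pos by (auto simp: s_def)
  define t where "t = s / Wmax"
  have t: "0 < t" using s Wmax_pos by (simp add: t_def)
  \<comment> \<open>\<open>c powr r\<close> is the best factor in
    \<open>x powr r \<le> c powr r * exp (t * (l * x))\<close>; equality holds at
    \<open>x = r / (t * l)\<close>.\<close>
  define c where "c = r / (exp 1 * (t * real l))"
  have c: "0 < c" using r t l by (simp add: c_def)
  have pw: "x powr r \<le> c powr r * exp (t * (real l * x))" if x: "0 < x" for x
  proof -
    define y where "y = t * (real l * x) / r"
    have y: "0 < y" using r t l x by (simp add: y_def)
    have "y \<le> exp (y - 1)" using exp_ge_add_one_self[of "y - 1"] by simp
    then have "y powr r \<le> exp (y - 1) powr r" using y r by (intro powr_mono2) auto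
    also have "\<dots> = exp (t * (real l * x)) / exp 1 powr r"
      using r by (simp add: powr_def y_def algebra_simps exp_diff[symmetric])
    finally have 1: "y powr r \<le> exp (t * (real l * x)) / exp 1 powr r" .
    have "x = y * (r / (t * real l))" using r t l by (simp add: y_def)
    then have "x powr r = y powr r * (r / (t * real l)) powr r"
      using y r t l by (metis powr_mult less_imp_le)
    also have "\<dots> \<le> (exp (t * (real l * x)) / exp 1 powr r) * (r / (t * real l)) powr r"
      by (intro mult_right_mono 1) simp
    also have "\<dots> = c powr r * exp (t * (real l * x))"
      using r t l by (simp add: c_def powr_divide powr_mult)
    finally show ?thesis .
  qed
  have "(\<integral>\<^sup>+x. ennreal (avgW (fst x) (snd x) powr r) \<partial>(UM \<Otimes>\<^sub>M UM))
      \<le> (\<integral>\<^sup>+x. ennreal (c powr r) * ennreal (exp (t * (real l * avgW (fst x) (snd x)))) \<partial>(UM \<Otimes>\<^sub>M UM))"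
  proof (rule nn_integral_mono)
    fix x
    have "0 < avgW (fst x) (snd x)" using avgW_ge_1[of "fst x" "snd x"] by linarith
    from ennreal_leI[OF pw[OF this]]
    show "ennreal (avgW (fst x) (snd x) powr r) \<le> ennreal (c powr r) * ennreal (exp (t * (real l * avgW (fst x) (snd x))))"
      by (simp add: ennreal_mult)
  qed
  also have "\<dots> = ennreal (c powr r) * (\<integral>\<^sup>+x. ennreal (exp (t * (real l * avgW (fst x) (snd x)))) \<partial>(UM \<Otimes>\<^sub>M UM))"
    using avgW_measurable by (intro nn_integral_cmult) measurable
  also have "\<dots> \<le> ennreal (c powr r) * ennreal (exp (real l * (Wmean * (exp (t * Wmax) - 1) / Wmax)))"
    unfolding l_def using t by (intro mult_left_mono nn_integral_exp_avgW_le) auto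
  also have "\<dots> \<le> ennreal (c powr r) * ennreal (exp 2 powr r)"
  proof (intro mult_left_mono ennreal_leI)
    have "exp s \<le> 1 + s + s\<^sup>2" using s by (intro exp_bound) auto
    moreover have "s\<^sup>2 \<le> s" using s mult_left_mono[of s 1 s] by (simp add: power2_eq_square)
    ultimately have "exp (t * Wmax) - 1 \<le> 2 * s" using Wmax_pos by (simp add: t_def)
    then have "real l * (Wmean * (exp (t * Wmax) - 1) / Wmax) \<le> real l * (Wmean * (2 * s) / Wmax)"
      using Wmean_pos Wmax_pos l by (intro mult_left_mono divide_right_mono) auto
    also have "\<dots> \<le> 2 * r" using s(3) l Wmax_pos Wmean_pos by (simp add: field_simps)
    finally show "exp (real l * (Wmean * (exp (t * Wmax) - 1) / Wmax)) \<le> exp 2 powr r"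
      by (simp add: powr_def mult.commute)
  qed simp
  also have "\<dots> = ennreal ((c * exp 2) powr r)"
    using c by (simp add: powr_mult ennreal_mult[symmetric])
  also have "c * exp 2 = exp 1 * max (r * Wmax / real l) Wmean"
  proof -
    have e2: "exp 2 = exp 1 * exp (1::real)" by (simp add: exp_add[symmetric])
    have "c * exp 2 = exp 1 * (r * Wmax / (s * real l))"
      using Wmax_pos s l by (simp add: c_def t_def e2 field_simps)
    also have "r * Wmax / (s * real l) = max (r * Wmax / real l) Wmean"
    proof (cases "1 \<le> r * Wmax / (real l * Wmean)")
      case True
      then have "s = 1" by (simp add: s_def)
      moreover have "Wmean \<le> r * Wmax / real l" using True l Wmean_pos by (simp add: field_simps)
      ultimately show ?thesis by simp
    next
      case False
      then have "s = r * Wmax / (real l * Wmean)" by (simp add: s_def)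
      then have "r * Wmax = Wmean * (s * real l)" using l Wmean_pos by (simp add: field_simps)
      then have "r * Wmax / (s * real l) = Wmean" using s(1) l by simp
      moreover have "r * Wmax / real l \<le> Wmean" using False l Wmean_pos by (simp add: field_simps)
      ultimately show ?thesis by simp
    qed
    finally show ?thesis .
  qed
  finally show ?thesis .
qed

section \<open>The risk as an average over blocks, and its increments\<close>

definition risk :: "(nat \<Rightarrow> (real ^ 'd) \<times> nat) \<Rightarrow> real" where
  "risk u = lpo_risk k p n (pt u) (lab u) (coin u)"

definition loss :: "(nat \<Rightarrow> (real ^ 'd) \<times> nat) \<Rightarrow> nat set \<Rightarrow> nat \<Rightarrow> real" where
  "loss u v i = of_bool ((of_bool (pred_vote u v i (v - {i})) :: nat) \<noteq> lab u i)"

text \<open>Here the blocks arise: a test point joined to its training set gives the block, and the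
  block with the marked test point gives both back.\<close>

lemma bij_coin_index: "bij_betw (\<lambda>(v, i). (v - {i}, i)) (SIGMA v:blocks. v) (coin_index n p)"
proof (rule bij_betwI[where g = "\<lambda>(e, i). (insert i e, i)"])
  show "(\<lambda>(v, i). (v - {i}, i)) \<in> (SIGMA v:blocks. v) \<rightarrow> coin_index n p"
    using coin_index_block by auto
  show "(\<lambda>(e, i). (insert i e, i)) \<in> coin_index n p \<rightarrow> (SIGMA v:blocks. v)"
  proof
    fix c assume "c \<in> coin_index n p"
    then obtain e i where c: "c = (e, i)" "e \<subseteq> {1..n}" "card e = n - p" "i \<in> {1..n}" "i \<notin> e"
      by (auto simp: coin_index_def training_sets_def)
    then have "finite e" using finite_subset by blast
    then show "(\<lambda>(e, i). (insert i e, i)) c \<in> (SIGMA v:blocks. v)"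
      using c by (simp add: blocks_def m_def)
  qed
qed (auto simp: coin_index_def insert_absorb)

lemma sum_coin_index:
  "(\<Sum>(e, i)\<in>coin_index n p. f e i) = (\<Sum>v\<in>blocks. \<Sum>i\<in>v. f (v - {i}) i)"
proof -
  have "(\<Sum>v\<in>blocks. \<Sum>i\<in>v. f (v - {i}) i) = (\<Sum>(v, i)\<in>(SIGMA v:blocks. v). f (v - {i}) i)"
    using finite_blocks blockD(3) by (intro sum.Sigma) auto
  also have "\<dots> = (\<Sum>(e, i)\<in>coin_index n p. f e i)"
    using sum.reindex_bij_betw[OF bij_coin_index, of "\<lambda>(e, i). f e i"] by (simp add: case_prod_beta')
  finally show ?thesis ..
qed

lemma finite_training: "finite (training_sets n p)"
  by (simp add: training_sets_def)

text \<open>The two counts identify the normalisation of \<open>lpo_risk\<close> with the one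
  natural for blocks.\<close>

lemma card_coin_index: "card (coin_index n p) = (n choose p) * p" "card (coin_index n p) = card blocks * m"
proof -
  have pn: "p \<le> n" using pkn by simp
  have "card (coin_index n p) = (\<Sum>e\<in>training_sets n p. card ({1..n} - e))"
    unfolding coin_index_def using finite_training by (intro card_SigmaI) auto
  also have "\<dots> = (\<Sum>e\<in>training_sets n p. p)"
  proof (rule sum.cong[OF refl])
    fix e assume "e \<in> training_sets n p"
    then have e: "e \<subseteq> {1..n}" "card e = n - p" by (auto simp: training_sets_def)
    then show "card ({1..n} - e) = p" using finite_subset[OF e(1)] pn by (simp add: card_Diff_subset)
  qed
  also have "\<dots> = (n choose (n - p)) * p"
    unfolding training_sets_def using n_subsets[of "{1..n}" "n - p"] by simp
  finally show "card (coin_index n p) = (n choose p) * p" using binomial_symmetric[OF pn] by simp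
  have "card (coin_index n p) = card (SIGMA v:blocks. v)" using bij_betw_same_card[OF bij_coin_index] by simp
  also have "\<dots> = (\<Sum>v\<in>blocks. card v)" using finite_blocks blockD(3) by (intro card_SigmaI) auto
  also have "\<dots> = card blocks * m" using blockD(2) by simp
  finally show "card (coin_index n p) = card blocks * m" .
qed

text \<open>\<open>1 / (n choose p)\<close> and \<open>1 / p\<close> combine to one over the number
  of predictions. In \<open>space UM\<close> all coins are at most \<open>1\<close>, as the reading
  of the classifier as a vote requires.\<close>

lemma risk_eq:
  assumes u: "u \<in> space UM"
  shows "risk u = (\<Sum>v\<in>blocks. \<Sum>i\<in>v. loss u v i) / real (card (coin_index n p))"
proof -
  have cl: "knn_classifier k (pt u) (lab u) e (coin u e i) (pt u i) = of_bool (vote k (pt u) (lab u) e (coin u e i) (pt u i))"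
    if "(e, i) \<in> coin_index n p" for e i
  proof (rule knn_classifier_eq_vote[OF k])
    have "pos (e, i) \<in> {1..N}" using bij_betwE[OF pos] that nN by force
    then show "coin u e i \<le> 1" unfolding coin_def by (rule snd_space[OF u])
  qed
  define \<phi> where "\<phi> e i = (of_bool (knn_classifier k (pt u) (lab u) e (coin u e i) (pt u i) \<noteq> lab u i) :: real)" for e i
  have "risk u = (1 / real (n choose p)) * (1 / real p) * (\<Sum>e\<in>training_sets n p. \<Sum>i\<in>{1..n} - e. \<phi> e i)"
    unfolding risk_def lpo_risk_def \<phi>_def by (simp add: sum_distrib_left mult.assoc)
  also have "(\<Sum>e\<in>training_sets n p. \<Sum>i\<in>{1..n} - e. \<phi> e i) = (\<Sum>(e, i)\<in>coin_index n p. \<phi> e i)"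
    unfolding coin_index_def using finite_training by (intro sum.Sigma) auto
  also have "\<dots> = (\<Sum>v\<in>blocks. \<Sum>i\<in>v. \<phi> (v - {i}) i)" by (rule sum_coin_index)
  also have "\<dots> = (\<Sum>v\<in>blocks. \<Sum>i\<in>v. loss u v i)"
  proof (intro sum.cong refl)
    fix v i assume "v \<in> blocks" "i \<in> v"
    then show "\<phi> (v - {i}) i = loss u v i"
      unfolding \<phi>_def loss_def pred_vote_def by (subst cl) (simp_all add: coin_index_block)
  qed
  finally show ?thesis using card_coin_index(1) by simp
qed

lemma loss_bounds: "0 \<le> loss u v i" "loss u v i \<le> 1"
  by (simp_all add: loss_def)

lemma risk_bounds:
  assumes u: "u \<in> space UM" shows "0 \<le> risk u" "risk u \<le> 1"
proof -
  have "(\<Sum>v\<in>blocks. \<Sum>i\<in>v. loss u v i) \<le> (\<Sum>v\<in>blocks. \<Sum>i\<in>v. 1)"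
    by (intro sum_mono loss_bounds)
  also have "\<dots> = (\<Sum>v\<in>blocks. real m)" by (rule sum.cong[OF refl]) (simp add: blockD(2))
  also have "\<dots> = real (card (coin_index n p))" by (simp add: card_coin_index(2))
  finally show "risk u \<le> 1" unfolding risk_eq[OF u] by (auto simp: divide_le_eq_1)
  show "0 \<le> risk u" unfolding risk_eq[OF u] by (intro divide_nonneg_nonneg sum_nonneg loss_bounds) simp
qed

lemma risk_measurable: "risk \<in> borel_measurable UM"
proof -
  have lm: "(\<lambda>u. loss u v i) \<in> borel_measurable UM" if vi: "v \<in> blocks" "i \<in> v" for v i
  proof -
    have [measurable]: "Measurable.pred UM (\<lambda>u. pred_vote u v i (v - {i}))"
      using vi by (intro pred_vote_measurable) auto
    have [measurable]: "(\<lambda>u. lab u i) \<in> measurable UM (count_space UNIV)"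
      using block_N[OF vi] by (rule lab_measurable)
    show ?thesis unfolding loss_def by measurable
  qed
  have "(\<lambda>u. (\<Sum>v\<in>blocks. \<Sum>i\<in>v. loss u v i) / real (card (coin_index n p))) \<in> borel_measurable UM"
    by (intro borel_measurable_divide borel_measurable_sum lm) auto
  then show ?thesis by (subst measurable_cong[OF risk_eq])
qed

text \<open>Each point lies in equally many blocks, and the right side also counts the pairs of a
  block and a point in it.\<close>

lemma card_blocks_containing:
  assumes j: "j \<in> {1..n}"
  shows "n * card {v \<in> blocks. j \<in> v} = card (coin_index n p)"
proof -
  have "bij_betw (\<lambda>v. v - {j}) {v \<in> blocks. j \<in> v} {w. w \<subseteq> {1..n} - {j} \<and> card w = m - 1}"
  proof (rule bij_betwI[where g = "insert j"])
    show "(\<lambda>v. v - {j}) \<in> {v \<in> blocks. j \<in> v} \<rightarrow> {w. w \<subseteq> {1..n} - {j} \<and> card w = m - 1}"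
      using blockD by fastforce
    show "insert j \<in> {w. w \<subseteq> {1..n} - {j} \<and> card w = m - 1} \<rightarrow> {v \<in> blocks. j \<in> v}"
    proof
      fix w assume "w \<in> {w. w \<subseteq> {1..n} - {j} \<and> card w = m - 1}"
      then have w: "w \<subseteq> {1..n} - {j}" "card w = m - 1" by auto
      have "finite w" by (rule finite_subset[OF w(1)]) simp
      moreover have "j \<notin> w" using w by blast
      ultimately have "card (insert j w) = m" using w m_bounds(3) by simp
      then show "insert j w \<in> {v \<in> blocks. j \<in> v}" using w j by (auto simp: blocks_def)
    qed
  qed auto
  then have "card {v \<in> blocks. j \<in> v} = card {w. w \<subseteq> {1..n} - {j} \<and> card w = m - 1}"
    by (rule bij_betw_same_card)
  also have "\<dots> = (n - 1 choose (m - 1))" using n_subsets[of "{1..n} - {j}" "m - 1"] j by simp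
  finally show ?thesis
    using times_binomial_minus1_eq[of m n] m_bounds(3) card_blocks(1) card_coin_index(2)
    by (simp add: mult.commute)
qed

text \<open>For \<open>i \<noteq> j\<close>, the vote at \<open>i\<close> without \<open>j\<close>
  is the same for \<open>u\<close> and \<open>u2\<close>. A change of the loss at \<open>i\<close>
  hence makes \<open>j\<close> a pivot of this vote under \<open>u\<close> or under
  \<open>u2\<close>. The summand \<open>1\<close> pays for the test point \<open>j\<close>
  itself.\<close>

lemma loss_diff_block:
  assumes v: "v \<in> blocks" and j: "j \<in> {1..n}" and u2: "u2 = u(j := z)"
  shows "(\<Sum>i\<in>v. \<bar>loss u v i - loss u2 v i\<bar>) \<le> of_bool (j \<in> v) * (1 + real (infl v j u) + real (infl v j u2))"
proof -
  have u2_eq: "u2 a = u a" if "a \<noteq> j" for a using that by (simp add: u2)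
  have coin_eq: "coin u2 (v - {i}) i = coin u (v - {i}) i" if "i \<in> v" for i
  proof -
    have "pos (v - {i}, i) \<noteq> j" using pos_range[OF v that] j by auto
    then show ?thesis by (simp add: coin_def u2_eq)
  qed
  have pv: "pred_vote u v i e = pred_vote u2 v i e" if "i \<in> v" "i \<noteq> j" "j \<notin> e" for i e
    unfolding pred_vote_def coin_eq[OF that(1)]
  proof (rule majority_cong)
    fix a assume "a \<in> e"
    then have "a \<noteq> j" using that by blast
    then show "lab u a = lab u2 a" by (simp add: lab_def u2_eq)
  next
    fix a b assume "a \<in> e" "b \<in> e"
    then have "a \<noteq> j" "b \<noteq> j" using that by blast+
    then show "lex_less (\<lambda>a. norm (pt u a - pt u i)) real a b = lex_less (\<lambda>a. norm (pt u2 a - pt u2 i)) real a b"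
      using that(2) by (simp add: pt_def u2_eq lex_less_def)
  qed
  show ?thesis
  proof (cases "j \<in> v")
    case False
    have "loss u v i = loss u2 v i" if "i \<in> v" for i
    proof -
      have "i \<noteq> j" using that False by blast
      then show ?thesis using pv[OF that, of "v - {i}"] False by (simp add: loss_def lab_def u2_eq)
    qed
    then show ?thesis using False by simp
  next
    case True
    have fin: "finite v" using blockD(3)[OF v] .
    let ?\<chi> = "\<lambda>u i. of_bool (pred_vote u v i (v - {i}) \<noteq> pred_vote u v i (v - {i} - {j})) :: real"
    have d: "\<bar>loss u v i - loss u2 v i\<bar> \<le> ?\<chi> u i + ?\<chi> u2 i" if i: "i \<in> v - {j}" for i
    proof -
      have "pred_vote u v i (v - {i} - {j}) = pred_vote u2 v i (v - {i} - {j})" using i by (intro pv) auto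
      moreover have "lab u2 i = lab u i" using i by (simp add: lab_def u2_eq)
      ultimately show ?thesis by (auto simp: loss_def)
    qed
    have c: "(\<Sum>i\<in>v - {j}. ?\<chi> w i) = real (infl v j w)" for w
      using fin by (simp add: infl_def Int_def)
    have "(\<Sum>i\<in>v. \<bar>loss u v i - loss u2 v i\<bar>) = \<bar>loss u v j - loss u2 v j\<bar> + (\<Sum>i\<in>v - {j}. \<bar>loss u v i - loss u2 v i\<bar>)"
      by (rule sum.remove[OF fin True])
    also have "\<dots> \<le> 1 + (\<Sum>i\<in>v - {j}. ?\<chi> u i + ?\<chi> u2 i)"
    proof (rule add_mono)
      show "\<bar>loss u v j - loss u2 v j\<bar> \<le> 1" using loss_bounds[of u v j] loss_bounds[of u2 v j] by linarith
      show "(\<Sum>i\<in>v - {j}. \<bar>loss u v i - loss u2 v i\<bar>) \<le> (\<Sum>i\<in>v - {j}. ?\<chi> u i + ?\<chi> u2 i)"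
        by (rule sum_mono) (rule d)
    qed
    also have "\<dots> = 1 + real (infl v j u) + real (infl v j u2)" unfolding sum.distrib c by simp
    finally show ?thesis using True by simp
  qed
qed

lemma update_space:
  assumes "u \<in> space UM" "u' \<in> space UM" "j \<in> {1..N}"
  shows "u(j := u' j) \<in> space UM"
  using measurable_space[OF update_measurable[OF assms(3)], of "(u, u')"] assms by (simp add: space_pair_measure del: One_nat_def)

text \<open>Only the blocks that contain \<open>j\<close> change. Cauchy-Schwarz over these blocks
  costs a factor equal to their number, \<open>card (coin_index n p) / n\<close>; this is where the
  \<open>1 / n\<close> in the final estimate comes from.\<close>

lemma risk_diff_data:
  assumes u: "u \<in> space UM" "u' \<in> space UM" and j: "j \<in> {1..n}"
  shows "(risk u - risk (u(j := u' j)))\<^sup>2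
    \<le> (\<Sum>v\<in>{v \<in> blocks. j \<in> v}. (1 + real (infl v j u) + real (infl v j (u(j := u' j))))\<^sup>2)
        / (real n * real (card (coin_index n p)))"
proof -
  let ?u2 = "u(j := u' j)" and ?K = "real (card (coin_index n p))" and ?V = "{v \<in> blocks. j \<in> v}"
  let ?\<Delta> = "\<lambda>v. 1 + real (infl v j u) + real (infl v j ?u2)"
  have jN: "j \<in> {1..N}" using j nN by auto
  have K: "?K > 0" using card_coin_index(2) card_blocks(2) m_bounds(3) by simp
  have n0: "real n > 0" using m_bounds by simp
  have "\<bar>risk u - risk ?u2\<bar> = \<bar>\<Sum>v\<in>blocks. \<Sum>i\<in>v. loss u v i - loss ?u2 v i\<bar> / ?K"
    unfolding risk_eq[OF u(1)] risk_eq[OF update_space[OF u jN]] using K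
    by (simp add: diff_divide_distrib[symmetric] sum_subtractf abs_divide)
  also have "\<dots> \<le> (\<Sum>v\<in>blocks. \<Sum>i\<in>v. \<bar>loss u v i - loss ?u2 v i\<bar>) / ?K"
    using K by (intro divide_right_mono order_trans[OF sum_abs] sum_mono) auto
  also have "\<dots> \<le> (\<Sum>v\<in>blocks. of_bool (j \<in> v) * ?\<Delta> v) / ?K"
    using K by (intro divide_right_mono sum_mono loss_diff_block[OF _ j refl]) auto
  also have "(\<Sum>v\<in>blocks. of_bool (j \<in> v) * ?\<Delta> v) = (\<Sum>v\<in>?V. ?\<Delta> v)"
    using finite_blocks by (intro sum.mono_neutral_cong_right) auto
  finally have "\<bar>risk u - risk ?u2\<bar> \<le> (\<Sum>v\<in>?V. ?\<Delta> v) / ?K" .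
  then have "\<bar>risk u - risk ?u2\<bar>\<^sup>2 \<le> ((\<Sum>v\<in>?V. ?\<Delta> v) / ?K)\<^sup>2" by (rule power_mono) simp
  then have "(risk u - risk ?u2)\<^sup>2 \<le> (\<Sum>v\<in>?V. ?\<Delta> v)\<^sup>2 / ?K\<^sup>2" by (simp add: power_divide)
  also have "\<dots> \<le> ((\<Sum>v\<in>?V. (?\<Delta> v)\<^sup>2) * real (card ?V)) / ?K\<^sup>2"
  proof (intro divide_right_mono)
    show "(\<Sum>v\<in>?V. ?\<Delta> v)\<^sup>2 \<le> (\<Sum>v\<in>?V. (?\<Delta> v)\<^sup>2) * real (card ?V)"
      by (rule sum_squared_le_sum_of_squares)
  qed simp
  also have "real (card ?V) = ?K / real n"
    using arg_cong[OF card_blocks_containing[OF j], of real] n0 by (simp add: field_simps)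
  also have "((\<Sum>v\<in>?V. (?\<Delta> v)\<^sup>2) * (?K / real n)) / ?K\<^sup>2 = (\<Sum>v\<in>?V. (?\<Delta> v)\<^sup>2) / (real n * ?K)"
    using K n0 by (simp add: power2_eq_square)
  finally show ?thesis .
qed

text \<open>Each coin serves a single prediction, whose weight in the risk is
  \<open>1 / card (coin_index n p)\<close>.\<close>

lemma risk_diff_coin:
  assumes u: "u \<in> space UM" "u' \<in> space UM" and j: "j \<in> {n + 1..N}"
  shows "(risk u - risk (u(j := u' j)))\<^sup>2 \<le> 1 / (real (card (coin_index n p)))\<^sup>2"
proof -
  let ?u2 = "u(j := u' j)" and ?K = "real (card (coin_index n p))"
  have jN: "j \<in> {1..N}" using j by auto
  have K: "?K > 0" using card_coin_index(2) card_blocks(2) m_bounds(3) by simp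
  have d: "\<bar>loss u v i - loss ?u2 v i\<bar> \<le> of_bool (pos (v - {i}, i) = j)" if v: "v \<in> blocks" "i \<in> v" for v i
  proof (cases "pos (v - {i}, i) = j")
    case True
    then show ?thesis using loss_bounds[of u v i] loss_bounds[of ?u2 v i] by simp
  next
    case False
    have a: "?u2 a = u a" if "a \<in> v" for a using that blockD(1)[OF v(1)] j by force
    have c: "coin ?u2 (v - {i}) i = coin u (v - {i}) i" using False by (simp add: coin_def)
    have "pred_vote u v i (v - {i}) = pred_vote ?u2 v i (v - {i})"
      unfolding pred_vote_def c
      by (rule majority_cong) (use a v(2) in \<open>simp_all add: lex_less_def pt_def lab_def del: fun_upd_apply\<close>)
    moreover have "lab ?u2 i = lab u i" using a[OF v(2)] by (simp add: lab_def del: fun_upd_apply)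
    ultimately show ?thesis using False by (simp add: loss_def)
  qed
  have "\<bar>risk u - risk ?u2\<bar> = \<bar>\<Sum>v\<in>blocks. \<Sum>i\<in>v. loss u v i - loss ?u2 v i\<bar> / ?K"
    unfolding risk_eq[OF u(1)] risk_eq[OF update_space[OF u jN]] using K
    by (simp add: diff_divide_distrib[symmetric] sum_subtractf abs_divide)
  also have "\<dots> \<le> (\<Sum>v\<in>blocks. \<Sum>i\<in>v. \<bar>loss u v i - loss ?u2 v i\<bar>) / ?K"
    using K by (intro divide_right_mono order_trans[OF sum_abs] sum_mono) auto
  also have "\<dots> \<le> (\<Sum>v\<in>blocks. \<Sum>i\<in>v. of_bool (pos (v - {i}, i) = j)) / ?K"
    using K by (intro divide_right_mono sum_mono d) auto
  also have "(\<Sum>v\<in>blocks. \<Sum>i\<in>v. of_bool (pos (v - {i}, i) = j)) = (\<Sum>(e, i)\<in>coin_index n p. of_bool (pos (e, i) = j))"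
    by (rule sum_coin_index[symmetric])
  also have "\<dots> = (\<Sum>c\<in>coin_index n p. of_bool (pos c = j))" by (simp add: case_prod_beta')
  also have "\<dots> = (\<Sum>i\<in>{n + 1..N}. of_bool (i = j))"
    by (rule sum.reindex_bij_betw[OF pos])
  also have "\<dots> = 1" using j by (simp add: of_bool_def)
  finally have "\<bar>risk u - risk ?u2\<bar> \<le> 1 / ?K" .
  then have "\<bar>risk u - risk ?u2\<bar>\<^sup>2 \<le> (1 / ?K)\<^sup>2" by (rule power_mono) simp
  then show ?thesis by (simp add: power_divide)
qed

text \<open>Over the observations, \<open>risk_diff_data\<close> sums up to
  \<open>(avgW u u' - 1) / n\<close>; all coins together add
  \<open>1 / card (coin_index n p)\<close>, which is at most the missing
  \<open>1 / n\<close>.\<close>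

lemma sum_risk_diff_le:
  assumes u: "u \<in> space UM" "u' \<in> space UM"
  shows "(\<Sum>i=1..N. (risk u - risk (u(i := u' i)))\<^sup>2) \<le> avgW u u' / real n"
proof -
  let ?K = "real (card (coin_index n p))"
  let ?D = "\<lambda>i. (risk u - risk (u(i := u' i)))\<^sup>2"
  let ?\<Delta> = "\<lambda>v j. (1 + real (infl v j u) + real (infl v j (u(j := u' j))))\<^sup>2"
  have K: "?K > 0" using card_coin_index(2) card_blocks(2) m_bounds(3) by simp
  have n0: "real n > 0" using m_bounds by simp
  have Keq: "?K = real (card blocks) * real m" using card_coin_index(2) by simp
  have split: "{1..N} = {1..n} \<union> {n + 1..N}" using nN by auto
  have "(\<Sum>i=1..N. ?D i) = (\<Sum>i\<in>{1..n}. ?D i) + (\<Sum>i\<in>{n + 1..N}. ?D i)"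
    unfolding split by (rule sum.union_disjoint) auto
  also have "\<dots> \<le> (\<Sum>j\<in>{1..n}. (\<Sum>v\<in>{v \<in> blocks. j \<in> v}. ?\<Delta> v j) / (real n * ?K)) + (\<Sum>i\<in>{n + 1..N}. 1 / ?K\<^sup>2)"
    by (intro add_mono sum_mono risk_diff_data[OF u] risk_diff_coin[OF u])
  also have "(\<Sum>i\<in>{n + 1..N}. 1 / ?K\<^sup>2) = 1 / ?K"
    using bij_betw_same_card[OF pos] K by (simp add: power2_eq_square)
  also have "(\<Sum>j\<in>{1..n}. (\<Sum>v\<in>{v \<in> blocks. j \<in> v}. ?\<Delta> v j) / (real n * ?K))
      = (\<Sum>v\<in>blocks. \<Sum>j\<in>v. ?\<Delta> v j) / (real n * ?K)"
  proof -
    have "(\<Sum>j\<in>{1..n}. \<Sum>v\<in>{v \<in> blocks. j \<in> v}. ?\<Delta> v j) = (\<Sum>v\<in>blocks. \<Sum>j\<in>{j \<in> {1..n}. j \<in> v}. ?\<Delta> v j)"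
      by (rule sum.swap_restrict) (simp_all add: finite_blocks)
    also have "\<dots> = (\<Sum>v\<in>blocks. \<Sum>j\<in>v. ?\<Delta> v j)"
    proof (rule sum.cong[OF refl])
      fix v assume "v \<in> blocks"
      then have "{j \<in> {1..n}. j \<in> v} = v" using blockD(1)[of v] by blast
      then show "(\<Sum>j\<in>{j \<in> {1..n}. j \<in> v}. ?\<Delta> v j) = (\<Sum>j\<in>v. ?\<Delta> v j)" by (simp only:)
    qed
    finally show ?thesis by (simp only: sum_divide_distrib[symmetric])
  qed
  also have "(\<Sum>v\<in>blocks. \<Sum>j\<in>v. ?\<Delta> v j) = (\<Sum>v\<in>blocks. real m * (W v u u' - 1))"
    using m_bounds(3) by (intro sum.cong refl) (simp add: W_def)
  also have "\<dots> = ?K * (avgW u u' - 1)"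
    using card_blocks(2) unfolding Keq by (simp add: avgW_def sum_distrib_left[symmetric] sum_subtractf field_simps)
  also have "?K * (avgW u u' - 1) / (real n * ?K) = (avgW u u' - 1) / real n" using K by simp
  \<comment> \<open>\<open>?K\<close> is a positive multiple of \<open>n\<close>.\<close>
  also have "1 / ?K \<le> 1 / real n"
  proof -
    have n1: "1 \<in> {1..n}" using m_bounds by auto
    have "card {v \<in> blocks. 1 \<in> v} \<noteq> 0"
      using card_blocks_containing[OF n1] K by (metis mult_0_right of_nat_0 less_irrefl)
    then have "n * 1 \<le> n * card {v \<in> blocks. 1 \<in> v}" by (intro mult_le_mono2) simp
    then have "n \<le> card (coin_index n p)" unfolding card_blocks_containing[OF n1] by (simp only: mult_1_right)
    then have "real n \<le> ?K" by simp
    then show ?thesis using n0 by (intro divide_left_mono) auto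
  qed
  also have "(avgW u u' - 1) / real n + 1 / real n = avgW u u' / real n" by (simp add: diff_divide_distrib)
  finally show ?thesis by (simp del: fun_upd_apply)
qed

end

section \<open>Moments of the risk\<close>

text \<open>Tested on a fair choice between \<open>a\<close> and \<open>b\<close>, with the
  indicator of \<open>a\<close> as \<open>f\<close>: the left side is \<open>1/2\<close>, whereas a
  negative \<open>\<kappa>\<close> would make the right side nonpositive.\<close>

lemma efron_stein_constant_nonneg:
  fixes a b :: 'u
  assumes es: "efron_stein_constant TYPE('u) \<kappa>" and ab: "a \<noteq> b"
  shows "0 \<le> \<kappa>"
proof (rule ccontr)
  assume neg: "\<not> 0 \<le> \<kappa>"
  let ?M = "measure_pmf (pmf_of_set {a, b})"
  define \<mu> :: "nat \<Rightarrow> 'u measure" where "\<mu> = (\<lambda>_. ?M)"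
  let ?P = "Pi\<^sub>M {1..1} \<mu>"
  define f :: "(nat \<Rightarrow> 'u) \<Rightarrow> real" where "f u = of_bool (u 1 = a)" for u
  have \<mu>: "prob_space (\<mu> i)" for i unfolding \<mu>_def by (rule measure_pmf.prob_space_axioms)
  interpret P: prob_space ?P by (rule prob_space_PiM) (rule \<mu>)
  have c: "(\<lambda>u. u 1) \<in> measurable ?P ?M"
    using measurable_component_singleton[of 1 "{1..1}" \<mu>] by (simp add: \<mu>_def)
  have f: "f \<in> borel_measurable ?P"
    unfolding f_def by (rule measurable_compose[OF c, of "\<lambda>x. of_bool (x = a)"]) simp
  have d: "distr ?P ?M (\<lambda>u. u 1) = ?M"
  proof -
    interpret product_prob_space \<mu> "{1..1}" by (rule product_prob_spaceI) (rule \<mu>)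
    show ?thesis using PiM_component[of 1] by (simp add: \<mu>_def)
  qed
  have "(\<integral>u. f u \<partial>?P) = (\<integral>x. of_bool (x = a) \<partial>distr ?P ?M (\<lambda>u. u 1))"
    unfolding f_def by (subst integral_distr[OF c]) simp_all
  also have "\<dots> = 1 / 2" unfolding d using ab by (subst integral_pmf_of_set) auto
  finally have Ef: "(\<integral>u. f u \<partial>?P) = 1 / 2" .
  have "\<bar>f u - 1 / 2\<bar> powr 2 = 1 / 4" for u by (simp add: f_def power2_eq_square)
  then have L: "Lq_norm 2 ?P (\<lambda>u. f u - (\<integral>v. f v \<partial>?P)) = (1 / 4) powr (1 / 2)"
  proof -
    assume "\<And>u. \<bar>f u - 1 / 2\<bar> powr 2 = 1 / 4"
    then show ?thesis unfolding Lq_norm_def Ef by (simp only: lebesgue_integral_const P.prob_space) simp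
  qed
  have "integrable ?P (\<lambda>u. \<bar>f u\<bar> powr 2)"
  proof (rule P.integrable_const_bound[where B = 1])
    show "AE u in ?P. norm (\<bar>f u\<bar> powr 2) \<le> 1" by (intro AE_I2) (simp add: f_def)
    show "(\<lambda>u. \<bar>f u\<bar> powr 2) \<in> borel_measurable ?P" using f by measurable
  qed
  then have "Lq_norm 2 ?P (\<lambda>u. f u - (\<integral>v. f v \<partial>?P)) \<le> sqrt (2 * \<kappa> * 2) *
      sqrt (Lq_norm (2 / 2) (?P \<Otimes>\<^sub>M ?P) (\<lambda>(u, u'). \<Sum>i=1..1. (f u - f (u(i := u' i)))\<^sup>2))"
    using es[unfolded efron_stein_constant_def, rule_format, of 1 \<mu> f 2] f \<mu> by blast
  \<comment> \<open>The real \<open>sqrt\<close> is an odd function, so it is negative at a negative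
    argument.\<close>
  also have "\<dots> \<le> 0"
    using neg by (intro mult_nonpos_nonneg) (auto simp: Lq_norm_def)
  finally have "(1 / 4) powr (1 / 2 :: real) \<le> 0" unfolding L .
  moreover have "0 < (1 / 4) powr (1 / 2 :: real)" by simp
  ultimately show False by linarith
qed

lemma powr_eq_power2_powr: "0 \<le> x \<Longrightarrow> x powr q = (x\<^sup>2) powr (q / 2)" for x q :: real
  by (cases "x = 0") (simp_all add: powr_powr flip: powr_numeral)

context knn_sample
begin

abbreviation "Erisk \<equiv> (\<integral>v. risk v \<partial>UM)"

text \<open>The Efron-Stein inequality raised to the power \<open>q\<close>: the root of the norm of
  order \<open>q / 2\<close> becomes an integral of the power \<open>q / 2\<close>. Each bound of
  the theorem is thereby reduced to a moment of \<open>avgW / n\<close>.\<close>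

lemma moment_le:
  assumes es: "efron_stein_constant TYPE((real ^ 'd) \<times> nat) \<kappa>" and \<kappa>: "0 \<le> \<kappa>" and q: "2 \<le> q" and B0: "0 \<le> B"
    and B: "(\<integral>\<^sup>+x. ennreal ((avgW (fst x) (snd x) / real n) powr (q / 2)) \<partial>(UM \<Otimes>\<^sub>M UM)) \<le> ennreal B"
  shows "(\<integral>u. \<bar>risk u - Erisk\<bar> powr q \<partial>UM) \<le> (2 * \<kappa> * q) powr (q / 2) * B"
proof -
  interpret U: prob_space UM by (rule prob_space_UM)
  define a where "a = (\<integral>u. \<bar>risk u - Erisk\<bar> powr q \<partial>UM)"
  define V where "V = (\<lambda>(u, u'). \<Sum>i=1..N. (risk u - risk (u(i := u' i)))\<^sup>2)"
  define b where "b = (\<integral>w. \<bar>V w\<bar> powr (q / 2) \<partial>(UM \<Otimes>\<^sub>M UM))"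
  have a0: "0 \<le> a" and b0: "0 \<le> b" unfolding a_def b_def by (intro integral_nonneg_AE AE_I2; simp)+
  \<comment> \<open>The integrability demanded by \<open>efron_stein_constant\<close> holds because
    the risk lies between \<open>0\<close> and \<open>1\<close>.\<close>
  have "integrable UM (\<lambda>u. \<bar>risk u\<bar> powr q)"
  proof (rule U.integrable_const_bound[where B = 1])
    show "AE u in UM. norm (\<bar>risk u\<bar> powr q) \<le> 1"
      using AE_space
    proof eventually_elim
      case (elim u)
      then show ?case using powr_mono2[of q "\<bar>risk u\<bar>" 1] q risk_bounds[OF elim] by simp
    qed
    show "(\<lambda>u. \<bar>risk u\<bar> powr q) \<in> borel_measurable UM"
      using risk_measurable by measurable
  qed
  then have "Lq_norm q UM (\<lambda>u. risk u - Erisk) \<le> sqrt (2 * \<kappa> * q) * sqrt (Lq_norm (q / 2) (UM \<Otimes>\<^sub>M UM) V)"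
    using es[unfolded efron_stein_constant_def, rule_format, of N \<mu> risk q] risk_measurable \<mu> q
    unfolding V_def by blast
  then have "a powr (1 / q) \<le> sqrt (2 * \<kappa> * q) * sqrt (b powr (1 / (q / 2)))"
    unfolding Lq_norm_def a_def b_def .
  then have "(a powr (1 / q)) powr q \<le> (sqrt (2 * \<kappa> * q) * sqrt (b powr (1 / (q / 2)))) powr q"
    using q by (intro powr_mono2) auto
  also have "(a powr (1 / q)) powr q = a" using a0 q by (simp add: powr_powr)
  also have "(sqrt (2 * \<kappa> * q) * sqrt (b powr (1 / (q / 2)))) powr q
      = (sqrt (2 * \<kappa> * q)) powr q * (sqrt (b powr (1 / (q / 2)))) powr q"
    by (rule powr_mult)
  also have "(sqrt (2 * \<kappa> * q)) powr q = (2 * \<kappa> * q) powr (q / 2)"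
    using \<kappa> q powr_eq_power2_powr[of "sqrt (2 * \<kappa> * q)" q] by simp
  also have "(sqrt (b powr (1 / (q / 2)))) powr q = (b powr (1 / (q / 2))) powr (q / 2)"
    using powr_eq_power2_powr[of "sqrt (b powr (1 / (q / 2)))" q] by simp
  also have "(b powr (1 / (q / 2))) powr (q / 2) = b" using b0 q by (simp add: powr_powr)
  finally have ab: "a \<le> (2 * \<kappa> * q) powr (q / 2) * b" .
  have "(\<integral>\<^sup>+w. ennreal (\<bar>V w\<bar> powr (q / 2)) \<partial>(UM \<Otimes>\<^sub>M UM)) \<le> (\<integral>\<^sup>+x. ennreal ((avgW (fst x) (snd x) / real n) powr (q / 2)) \<partial>(UM \<Otimes>\<^sub>M UM))"
  proof (intro nn_integral_mono ennreal_leI powr_mono2)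
    fix w assume "w \<in> space (UM \<Otimes>\<^sub>M UM)"
    then have "fst w \<in> space UM" "snd w \<in> space UM" by (auto simp: space_pair_measure)
    from sum_risk_diff_le[OF this]
    show "\<bar>V w\<bar> \<le> avgW (fst w) (snd w) / real n"
      unfolding V_def case_prod_beta' by (subst abs_of_nonneg) (auto intro: sum_nonneg simp del: fun_upd_apply)
  qed (use q in auto)
  also note B
  finally have "b \<le> B" unfolding b_def by (rule integral_real_bounded[OF B0])
  then have "(2 * \<kappa> * q) powr (q / 2) * b \<le> (2 * \<kappa> * q) powr (q / 2) * B" by (rule mult_left_mono) simp
  then show ?thesis using ab unfolding a_def by linarith
qed

section \<open>Comparison of \<open>Wmax\<close> and \<open>Wmean\<close> with the constants\<close>

lemma Wmax_le: "Wmax \<le> 10 * (real k * \<gamma>)\<^sup>2"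
proof -
  have "1 * 1 \<le> real k * \<gamma>" using k gamma_ge_1 by (intro mult_mono) auto
  then have "1 \<le> real k * \<gamma>" by simp
  moreover from this have "real k * \<gamma> \<le> (real k * \<gamma>)\<^sup>2"
    using mult_left_mono[of 1 "real k * \<gamma>" "real k * \<gamma>"] by (simp add: power2_eq_square)
  moreover have "Wmax = 2 + 4 * (real k * \<gamma>) + 4 * (real k * \<gamma>)\<^sup>2"
    by (simp add: Wmax_def power2_eq_square algebra_simps)
  ultimately show ?thesis by linarith
qed

text \<open>The constant is dictated by \<open>C1\<close>: multiplied by
  \<open>4 * \<kappa>\<close>, the right side is \<open>C1 * k powr (3/2)\<close>. The factor
  \<open>4 * \<kappa>\<close> is \<open>2 * \<kappa> * q\<close> at \<open>q = 2\<close>.\<close>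

lemma Wmean_le: "Wmean \<le> 32 * \<gamma> / sqrt (2 * pi) * real k powr (3 / 2)"
proof -
  \<comment> \<open>Since \<open>sqrt (2 * pi) \<le> 2.51\<close> and
    \<open>12.74 * 2.51 \<le> 32\<close>, it is enough to prove the bound with the factor
    \<open>12.74\<close>.\<close>
  have "sqrt (2 * pi) \<le> sqrt ((251 / 100)\<^sup>2)"
    using pi_approx(2) by (intro real_sqrt_le_mono) (simp add: power2_eq_square)
  then have sp: "sqrt (2 * pi) \<le> 251 / 100" by simp
  have sp0: "0 < sqrt (2 * pi)" by simp
  have "1274 / 100 * sqrt (2 * pi) \<le> 1274 / 100 * (251 / 100)" by (intro mult_left_mono sp) simp
  then have c: "1274 / 100 \<le> 32 / sqrt (2 * pi)" using sp0 by (simp add: field_simps)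
  define s where "s = sqrt (real k)"
  have s1: "1 \<le> s" using k by (simp add: s_def)
  have ks: "real k powr (3 / 2) = real k * s"
  proof -
    have "real k powr (3 / 2) = real k powr (1 + 1 / 2)" by simp
    also have "\<dots> = real k powr 1 * real k powr (1 / 2)" by (rule powr_add)
    finally show ?thesis using k by (simp add: s_def powr_half_sqrt)
  qed
  have g: "1 \<le> \<gamma>" by (rule gamma_ge_1)
  have main: "Wmean \<le> \<gamma> * (1274 / 100 * (real k * s))"
  proof (cases "k = 1")
    case True
    \<comment> \<open>The special value of \<open>pivot_bound\<close> at \<open>1\<close> enters
      here; \<open>\<gamma> \<ge> 1\<close> then gives
      \<open>6 + 4 * \<gamma> \<le> 10 * \<gamma>\<close>.\<close>
    have W: "Wmean = 6 + 4 * \<gamma>" unfolding Wmean_def unfolding pivot_bound_def True by simp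
    have "real k = 1" "s = 1" using True by (simp_all add: s_def)
    then show ?thesis unfolding W using g by simp
  next
    case False
    then have k2: "2 \<le> real k" using k by simp
    \<comment> \<open>After \<open>2 * s \<le> k * s\<close> is used, the comparison comes down to
      \<open>2 \<le> 1.48 * s\<close>, for which \<open>1.4 \<le> s\<close> is enough.\<close>
    have s14: "14 / 10 \<le> s"
    proof -
      have "sqrt ((14 / 10)\<^sup>2) \<le> s" unfolding s_def using k2 by (intro real_sqrt_le_mono) (simp add: power2_eq_square)
      then show ?thesis by simp
    qed
    have ss: "s * s = real k" by (simp add: s_def)
    have "pivot_bound k = 2 * real k / sqrt (real k + 1)" using False by (simp add: pivot_bound_def)
    also have "\<dots> \<le> 2 * real k / s" unfolding s_def using k by (intro divide_left_mono) auto
    also have "\<dots> = 2 * s" using ss s1 by (simp add: field_simps)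
    finally have Q: "pivot_bound k \<le> 2 * s" .
    have "Wmean \<le> 2 + (2 + 2 * (real k * \<gamma>)) * (2 * (2 * s))"
      unfolding Wmean_def using Q g by (intro add_left_mono mult_left_mono) auto
    also have "\<dots> = (2 + 8 * s) + \<gamma> * (8 * (real k * s))" by (simp add: algebra_simps)
    also have "\<dots> \<le> \<gamma> * (2 + 8 * s) + \<gamma> * (8 * (real k * s))"
      using g s1 by (intro add_right_mono) (simp add: mult_le_cancel_right1)
    also have "\<dots> = \<gamma> * (2 + 8 * s + 8 * (real k * s))" by (simp add: algebra_simps)
    also have "\<dots> \<le> \<gamma> * (1274 / 100 * (real k * s))"
    proof (rule mult_left_mono)
      have "2 * s \<le> real k * s" using k2 s1 by (intro mult_right_mono) auto
      then show "2 + 8 * s + 8 * (real k * s) \<le> 1274 / 100 * (real k * s)" using s14 by linarith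
    qed (use g in simp)
    finally show ?thesis .
  qed
  also have "\<dots> \<le> \<gamma> * (32 / sqrt (2 * pi) * (real k * s))"
    using g s1 c by (intro mult_left_mono mult_right_mono) auto
  also have "\<dots> = 32 * \<gamma> / sqrt (2 * pi) * (real k * s)" by simp
  finally show ?thesis unfolding ks .
qed

theorem risk_moment_bounds:
  assumes es: "efron_stein_constant TYPE((real ^ 'd) \<times> nat) \<kappa>"
    and C1: "C1 = 128 * \<kappa> * \<gamma> / sqrt (2 * pi)" and C2: "C2 = 4 * \<gamma> * sqrt (2 * \<kappa>)"
    and \<Gamma>: "\<Gamma> = 2 * sqrt (2 * exp 1) * max (sqrt (2 * C1)) (2 * C2)"
  defines "l \<equiv> real (n div m)"
  shows "(\<integral>u. \<bar>risk u - Erisk\<bar> powr 2 \<partial>UM) \<le> C1 * (real k powr (3/2) / (real m * l))"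
    and "(\<integral>u. \<bar>risk u - Erisk\<bar> powr 2 \<partial>UM) \<le> C1 * (real k powr (3/2) / real m)"
    and "2 < q \<Longrightarrow> (\<integral>u. \<bar>risk u - Erisk\<bar> powr q \<partial>UM) \<le> (C2 * real k) powr q * (q / real m) powr (q / 2)"
    and "2 < q \<Longrightarrow> (\<integral>u. \<bar>risk u - Erisk\<bar> powr q \<partial>UM)
      \<le> l * \<Gamma> powr q * (max (real k powr (3/2) / (real m * l) * q) ((real k)\<^sup>2 / (real m * l\<^sup>2) * q ^ 3)) powr (q / 2)"
proof -
  interpret U: prob_space UM by (rule prob_space_UM)
  interpret UU: pair_prob_space UM UM ..
  have \<kappa>: "0 \<le> \<kappa>" by (rule efron_stein_constant_nonneg[OF es, of "(0, 0)" "(0, 1)"]) simp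
  have g: "1 \<le> \<gamma>" by (rule gamma_ge_1)
  have mr: "1 \<le> real m" using m_bounds(3) by simp
  have l1: "1 \<le> l"
  proof -
    have "1 \<le> n div m" using div_le_mono[OF m_bounds(2), of m] m_bounds(3) by simp
    then show ?thesis by (simp add: l_def)
  qed
  have ml: "real m * l \<le> real n"
    unfolding l_def of_nat_mult[symmetric] of_nat_le_iff by (rule times_div_less_eq_dividend)
  have ml0: "0 < real m * l" using mr l1 by simp
  have mn: "real m \<le> real n" using m_bounds(2) by simp
  have n0: "0 < real n" using mn mr by linarith
  let ?k = "real k powr (3/2)"
  have C10: "0 \<le> C1" and C20: "0 \<le> C2" using \<kappa> g by (simp_all add: C1 C2)
  have W1: "4 * \<kappa> * Wmean \<le> C1 * ?k"
    using mult_left_mono[OF Wmean_le, of "4 * \<kappa>"] \<kappa> by (simp add: C1 mult_ac)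
  have C2sq: "C2\<^sup>2 = 32 * \<kappa> * \<gamma>\<^sup>2" using \<kappa> by (simp add: C2 power_mult_distrib)
  have avg0: "0 \<le> avgW u u'" for u u' using avgW_ge_1[of u u'] by linarith
  \<comment> \<open>The variance is bounded with \<open>1 / n\<close>; the two stated forms follow
    from \<open>m \<le> n\<close> and \<open>m * l \<le> n\<close>.\<close>
  have var: "(\<integral>u. \<bar>risk u - Erisk\<bar> powr 2 \<partial>UM) \<le> C1 * (?k / real n)"
  proof -
    have "(\<integral>\<^sup>+x. ennreal ((avgW (fst x) (snd x) / real n) powr (2 / 2)) \<partial>(UM \<Otimes>\<^sub>M UM))
        = (\<integral>\<^sup>+x. ennreal (1 / real n) * ennreal (avgW (fst x) (snd x)) \<partial>(UM \<Otimes>\<^sub>M UM))"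
      using n0 avg0 by (intro nn_integral_cong) (simp add: ennreal_mult[symmetric])
    also have "\<dots> = ennreal (1 / real n) * (\<integral>\<^sup>+x. ennreal (avgW (fst x) (snd x)) \<partial>(UM \<Otimes>\<^sub>M UM))"
      using avgW_measurable by (intro nn_integral_cmult) measurable
    also have "\<dots> \<le> ennreal (1 / real n) * ennreal Wmean"
      by (intro mult_left_mono nn_integral_avgW_le) simp
    also have "\<dots> = ennreal (Wmean / real n)" using n0 Wmean_pos by (simp add: ennreal_mult[symmetric])
    finally have "(\<integral>u. \<bar>risk u - Erisk\<bar> powr 2 \<partial>UM) \<le> (2 * \<kappa> * 2) powr (2 / 2) * (Wmean / real n)"
      using Wmean_pos n0 by (intro moment_le[OF es \<kappa>]) auto
    also have "\<dots> = 4 * \<kappa> * Wmean / real n" using \<kappa> by simp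
    also have "\<dots> \<le> C1 * ?k / real n" using W1 n0 by (intro divide_right_mono) auto
    finally show ?thesis by simp
  qed
  show "(\<integral>u. \<bar>risk u - Erisk\<bar> powr 2 \<partial>UM) \<le> C1 * (?k / (real m * l))"
  proof (rule order_trans[OF var mult_left_mono[OF _ C10]])
    show "?k / real n \<le> ?k / (real m * l)" using ml ml0 n0 by (intro divide_left_mono) auto
  qed
  show "(\<integral>u. \<bar>risk u - Erisk\<bar> powr 2 \<partial>UM) \<le> C1 * (?k / real m)"
  proof (rule order_trans[OF var mult_left_mono[OF _ C10]])
    show "?k / real n \<le> ?k / real m" using mn mr n0 by (intro divide_left_mono) auto
  qed
  show "(\<integral>u. \<bar>risk u - Erisk\<bar> powr q \<partial>UM) \<le> (C2 * real k) powr q * (q / real m) powr (q / 2)" if q: "2 < q"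
  proof -
    have "(\<integral>\<^sup>+x. ennreal ((avgW (fst x) (snd x) / real n) powr (q / 2)) \<partial>(UM \<Otimes>\<^sub>M UM))
        \<le> (\<integral>\<^sup>+x. ennreal ((Wmax / real n) powr (q / 2)) \<partial>(UM \<Otimes>\<^sub>M UM))"
    proof (rule nn_integral_mono_AE)
      show "AE x in UM \<Otimes>\<^sub>M UM. ennreal ((avgW (fst x) (snd x) / real n) powr (q / 2)) \<le> ennreal ((Wmax / real n) powr (q / 2))"
        using AE_avgW_le
      proof eventually_elim
        case (elim x)
        then show ?case using q n0 avg0 by (intro ennreal_leI powr_mono2 divide_right_mono) auto
      qed
    qed
    also have "\<dots> = ennreal ((Wmax / real n) powr (q / 2))" by (simp add: UU.emeasure_space_1 del: One_nat_def)
    finally have "(\<integral>u. \<bar>risk u - Erisk\<bar> powr q \<partial>UM) \<le> (2 * \<kappa> * q) powr (q / 2) * (Wmax / real n) powr (q / 2)"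
      using q by (intro moment_le[OF es \<kappa>]) auto
    also have "\<dots> = (2 * \<kappa> * q * (Wmax / real n)) powr (q / 2)"
      by (rule powr_mult[symmetric])
    also have "\<dots> \<le> ((C2 * real k)\<^sup>2 * (q / real m)) powr (q / 2)"
    proof (rule powr_mono2)
      \<comment> \<open>\<open>16\<close> in place of the \<open>10\<close> of
        \<open>Wmax_le\<close> makes the right side equal to
        \<open>(C2 * k)\<^sup>2 * (q / m)\<close>.\<close>
      have "2 * \<kappa> * q * (Wmax / real n) \<le> 2 * \<kappa> * q * (16 * (real k * \<gamma>)\<^sup>2 / real m)"
      proof (rule mult_left_mono)
        have "Wmax / real n \<le> Wmax / real m" using mn mr n0 Wmax_pos by (intro divide_left_mono) auto
        also have "\<dots> \<le> 16 * (real k * \<gamma>)\<^sup>2 / real m"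
          using Wmax_le zero_le_power2[of "real k * \<gamma>"] mr by (intro divide_right_mono) linarith+
        finally show "Wmax / real n \<le> 16 * (real k * \<gamma>)\<^sup>2 / real m" .
      qed (use \<kappa> q in simp)
      also have "\<dots> = (C2 * real k)\<^sup>2 * (q / real m)" unfolding power_mult_distrib C2sq by simp
      finally show "2 * \<kappa> * q * (Wmax / real n) \<le> (C2 * real k)\<^sup>2 * (q / real m)" .
    qed (use \<kappa> q Wmax_pos n0 in auto)
    also have "\<dots> = ((C2 * real k)\<^sup>2) powr (q / 2) * (q / real m) powr (q / 2)"
      by (rule powr_mult)
    also have "((C2 * real k)\<^sup>2) powr (q / 2) = (C2 * real k) powr q"
      using C20 by (intro powr_eq_power2_powr[symmetric]) simp
    finally show ?thesis .
  qed
  show "(\<integral>u. \<bar>risk u - Erisk\<bar> powr q \<partial>UM)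
      \<le> l * \<Gamma> powr q * (max (?k / (real m * l) * q) ((real k)\<^sup>2 / (real m * l\<^sup>2) * q ^ 3)) powr (q / 2)" if q: "2 < q"
  proof -
    let ?T = "max (?k / (real m * l) * q) ((real k)\<^sup>2 / (real m * l\<^sup>2) * q ^ 3)"
    \<comment> \<open>The two entries of this maximum are matched with those of \<open>?T\<close>:
      the one with \<open>Wmax\<close> goes with the term in \<open>q ^ 3\<close>, the one with
      \<open>Wmean\<close> with the term in \<open>q\<close>.\<close>
    define A where "A = exp 1 * max (q / 2 * Wmax / l) Wmean"
    have A0: "0 \<le> A" using Wmean_pos by (simp add: A_def le_max_iff_disj)
    have "(\<integral>\<^sup>+x. ennreal ((avgW (fst x) (snd x) / real n) powr (q / 2)) \<partial>(UM \<Otimes>\<^sub>M UM))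
        = (\<integral>\<^sup>+x. ennreal ((1 / real n) powr (q / 2)) * ennreal (avgW (fst x) (snd x) powr (q / 2)) \<partial>(UM \<Otimes>\<^sub>M UM))"
      using n0 avg0 by (intro nn_integral_cong) (simp add: ennreal_mult[symmetric] powr_divide)
    also have "\<dots> = ennreal ((1 / real n) powr (q / 2)) * (\<integral>\<^sup>+x. ennreal (avgW (fst x) (snd x) powr (q / 2)) \<partial>(UM \<Otimes>\<^sub>M UM))"
      using avgW_measurable by (intro nn_integral_cmult) measurable
    also have "\<dots> \<le> ennreal ((1 / real n) powr (q / 2)) * ennreal (A powr (q / 2))"
      unfolding A_def l_def using q by (intro mult_left_mono nn_integral_avgW_powr_le) auto
    also have "\<dots> = ennreal ((A / real n) powr (q / 2))"
      using A0 n0 by (simp add: ennreal_mult[symmetric] powr_divide)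
    finally have "(\<integral>u. \<bar>risk u - Erisk\<bar> powr q \<partial>UM) \<le> (2 * \<kappa> * q) powr (q / 2) * (A / real n) powr (q / 2)"
      using q by (intro moment_le[OF es \<kappa>]) auto
    also have "\<dots> = (2 * \<kappa> * q * (A / real n)) powr (q / 2)"
      by (rule powr_mult[symmetric])
    also have "\<dots> \<le> (\<Gamma>\<^sup>2 * ?T) powr (q / 2)"
    proof (rule powr_mono2)
      define mx where "mx = max (sqrt (2 * C1)) (2 * C2)"
      have mx: "2 * C1 \<le> mx\<^sup>2" "4 * C2\<^sup>2 \<le> mx\<^sup>2"
      proof -
        have "(sqrt (2 * C1))\<^sup>2 \<le> mx\<^sup>2" by (rule power_mono) (use C10 in \<open>simp_all add: mx_def\<close>)
        moreover have "(2 * C2)\<^sup>2 \<le> mx\<^sup>2" by (rule power_mono) (use C20 in \<open>simp_all add: mx_def\<close>)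
        ultimately show "2 * C1 \<le> mx\<^sup>2" "4 * C2\<^sup>2 \<le> mx\<^sup>2" using C10 by (simp_all add: power_mult_distrib)
      qed
      have \<Gamma>2: "\<Gamma>\<^sup>2 = 8 * exp 1 * mx\<^sup>2" unfolding \<Gamma> mx_def[symmetric] by (simp add: power_mult_distrib)
      have first: "2 * \<kappa> * q * (exp 1 * (q / 2 * Wmax / l) / real n) \<le> \<Gamma>\<^sup>2 * ((real k)\<^sup>2 / (real m * l\<^sup>2) * q ^ 3)"
      proof -
        have "2 * \<kappa> * q * (exp 1 * (q / 2 * Wmax / l) / real n) = exp 1 * \<kappa> * q\<^sup>2 / l * (Wmax / real n)"
          by (simp add: power2_eq_square)
        also have "\<dots> \<le> exp 1 * \<kappa> * q\<^sup>2 / l * (10 * (real k * \<gamma>)\<^sup>2 / (real m * l))"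
          using \<kappa> l1 ml ml0 n0 Wmax_pos Wmax_le by (intro mult_left_mono frac_le) auto
        also have "\<dots> = exp 1 * (10 * \<kappa> * \<gamma>\<^sup>2) * ((real k)\<^sup>2 / (real m * l\<^sup>2) * q\<^sup>2)"
          by (simp add: power2_eq_square mult_ac)
        \<comment> \<open>\<open>1024 = 8 * 4 * 32\<close>, where \<open>8 * exp 1\<close> stems
          from \<open>\<Gamma>\<^sup>2\<close>, the \<open>4\<close> from \<open>2 * C2\<close> and
          the \<open>32\<close> from \<open>C2\<^sup>2\<close>.\<close>
        also have "\<dots> \<le> exp 1 * (1024 * \<kappa> * \<gamma>\<^sup>2) * ((real k)\<^sup>2 / (real m * l\<^sup>2) * q ^ 3)"
        proof (intro mult_mono mult_left_mono)
          show "q\<^sup>2 \<le> q ^ 3" using q by (intro power_increasing) auto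
        qed (use \<kappa> q mr in auto)
        also have "\<dots> = exp 1 * 8 * (4 * C2\<^sup>2) * ((real k)\<^sup>2 / (real m * l\<^sup>2) * q ^ 3)" unfolding C2sq by simp
        also have "\<dots> \<le> exp 1 * 8 * mx\<^sup>2 * ((real k)\<^sup>2 / (real m * l\<^sup>2) * q ^ 3)"
          using mx q mr by (intro mult_right_mono mult_left_mono) auto
        finally show ?thesis unfolding \<Gamma>2 by (simp add: mult_ac)
      qed
      have second: "2 * \<kappa> * q * (exp 1 * Wmean / real n) \<le> \<Gamma>\<^sup>2 * (?k / (real m * l) * q)"
      proof -
        have "2 * \<kappa> * q * (exp 1 * Wmean / real n) = exp 1 / 2 * q * ((4 * \<kappa> * Wmean) / real n)" by simp
        also have "\<dots> \<le> exp 1 / 2 * q * ((C1 * ?k) / (real m * l))"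
          using q W1 C10 ml ml0 \<kappa> Wmean_pos by (intro mult_left_mono frac_le) auto
        also have "\<dots> = exp 1 * (1 / 2 * C1) * (?k / (real m * l) * q)" by simp
        also have "\<dots> \<le> exp 1 * (8 * mx\<^sup>2) * (?k / (real m * l) * q)"
        proof (intro mult_right_mono mult_left_mono)
          show "1 / 2 * C1 \<le> 8 * mx\<^sup>2" using mx(1) C10 by linarith
        qed (use q ml0 in auto)
        finally show ?thesis unfolding \<Gamma>2 by (simp add: mult_ac)
      qed
      have T: "\<Gamma>\<^sup>2 * (?k / (real m * l) * q) \<le> \<Gamma>\<^sup>2 * ?T" "\<Gamma>\<^sup>2 * ((real k)\<^sup>2 / (real m * l\<^sup>2) * q ^ 3) \<le> \<Gamma>\<^sup>2 * ?T"
        by (intro mult_left_mono max.cobounded1 max.cobounded2 zero_le_power2)+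
      show "2 * \<kappa> * q * (A / real n) \<le> \<Gamma>\<^sup>2 * ?T"
        using order_trans[OF first T(2)] order_trans[OF second T(1)] unfolding A_def max_def by (simp split: if_splits)
    qed (use \<kappa> q A0 n0 in auto)
    also have "\<dots> = (\<Gamma>\<^sup>2) powr (q / 2) * ?T powr (q / 2)"
      by (rule powr_mult)
    also have "(\<Gamma>\<^sup>2) powr (q / 2) = \<Gamma> powr q"
    proof (rule powr_eq_power2_powr[symmetric])
      show "0 \<le> \<Gamma>" unfolding \<Gamma> using C10 by (intro mult_nonneg_nonneg) (auto simp: le_max_iff_disj)
    qed
    \<comment> \<open>The leading factor of the statement comes in through
      \<open>1 \<le> l\<close>.\<close>
    also have "\<Gamma> powr q * ?T powr (q / 2) \<le> l * (\<Gamma> powr q * ?T powr (q / 2))"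
      using mult_right_mono[OF l1, of "\<Gamma> powr q * ?T powr (q / 2)"] by simp
    finally show ?thesis by (simp only: mult.assoc)
  qed
qed

end

section \<open>Transfer from the given probability space to the product\<close>

lemma lpo_risk_cong:
  assumes x: "\<And>i. i \<in> {1..n} \<Longrightarrow> x i = x' i" and y: "\<And>i. i \<in> {1..n} \<Longrightarrow> y i = y' i"
    and b: "\<And>e i. (e, i) \<in> coin_index n p \<Longrightarrow> b e i = b' e i"
  shows "lpo_risk k p n x y b = lpo_risk k p n x' y' b'"
proof -
  have cl: "knn_classifier k x y e (b e i) (x i) = knn_classifier k x' y' e (b' e i) (x' i)"
    if "e \<in> training_sets n p" "i \<in> {1..n} - e" for e i
  proof -
    have e: "e \<subseteq> {1..n}" and i: "i \<in> {1..n}" using that by (auto simp: training_sets_def)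
    have bi: "b e i = b' e i" using that by (intro b) (simp add: coin_index_def)
    have kn: "knn k x e (x' i) = knn k x' e (x' i)" using e by (intro knn_cong x) blast
    have "(\<Sum>j\<in>knn k x' e (x' i). real (y j)) = (\<Sum>j\<in>knn k x' e (x' i). real (y' j))"
      using e by (intro sum.cong refl arg_cong[where f = real] y) (auto simp: knn_def)
    then show ?thesis unfolding knn_classifier_def x[OF i] bi kn by (simp only:)
  qed
  have sums: "(\<Sum>i\<in>{1..n} - e. of_bool (knn_classifier k x y e (b e i) (x i) \<noteq> y i) :: real)
      = (\<Sum>i\<in>{1..n} - e. of_bool (knn_classifier k x' y' e (b' e i) (x' i) \<noteq> y' i))"
    if "e \<in> training_sets n p" for e
  proof (rule sum.cong[OF refl])
    fix i assume i: "i \<in> {1..n} - e"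
    then have "i \<in> {1..n}" by blast
    then show "(of_bool (knn_classifier k x y e (b e i) (x i) \<noteq> y i) :: real)
        = of_bool (knn_classifier k x' y' e (b' e i) (x' i) \<noteq> y' i)"
      unfolding cl[OF that i] by (simp only: y)
  qed
  show ?thesis
    unfolding lpo_risk_def
    by (rule arg_cong[where f = "(*) (1 / real (n choose p))"], rule sum.cong[OF refl],
        rule arg_cong[where f = "(*) (1 / real p)"], erule sums)
qed

lemma (in prob_space) indep_vars_reindex:
  assumes X: "indep_vars (\<lambda>_. S) X I" and h: "inj_on h J" "\<And>j. j \<in> J \<Longrightarrow> h j \<in> I"
  shows "indep_vars (\<lambda>_. S) (\<lambda>j. X (h j)) J"
  unfolding indep_vars_def2
proof (intro conjI ballI)
  have rv: "X (h j) \<in> measurable M S" if "j \<in> J" for j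
    using X h(2)[OF that] unfolding indep_vars_def2 by blast
  then show "random_variable S (X (h j))" if "j \<in> J" for j using that by blast
  show "indep_sets (\<lambda>j. {X (h j) -` A \<inter> space M |A. A \<in> sets S}) J"
  proof (rule indep_setsI)
    fix j assume "j \<in> J"
    then show "{X (h j) -` A \<inter> space M |A. A \<in> sets S} \<subseteq> events" using measurable_sets[OF rv] by auto
  next
    fix A K assume K: "K \<noteq> {}" "K \<subseteq> J" "finite K" and A: "\<forall>j\<in>K. A j \<in> {X (h j) -` A \<inter> space M |A. A \<in> sets S}"
    then have "\<forall>j\<in>K. \<exists>E. E \<in> sets S \<and> A j = X (h j) -` E \<inter> space M" by blast
    from bchoice[OF this] obtain E where
      E: "\<And>j. j \<in> K \<Longrightarrow> E j \<in> sets S" "\<And>j. j \<in> K \<Longrightarrow> A j = X (h j) -` E j \<inter> space M" by blast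
    have inj: "inj_on h K" using h(1) K(2) by (rule inj_on_subset)
    define F where "F i = E (the_inv_into K h i)" for i
    have F: "F (h j) = E j" if "j \<in> K" for j
      unfolding F_def the_inv_into_f_f[OF inj that] ..
    have "prob (\<Inter>i\<in>h ` K. X i -` F i \<inter> space M) = (\<Prod>i\<in>h ` K. prob (X i -` F i \<inter> space M))"
    proof (rule indep_varsD[OF X])
      show "h ` K \<subseteq> I" using h(2) K(2) by blast
      show "F i \<in> sets S" if i: "i \<in> h ` K" for i
      proof -
        obtain j where j: "j \<in> K" "i = h j" using i by blast
        show ?thesis unfolding j(2) F[OF j(1)] by (rule E(1)[OF j(1)])
      qed
    qed (use K in simp_all)
    also have "(\<Inter>i\<in>h ` K. X i -` F i \<inter> space M) = (\<Inter>j\<in>K. A j)"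
      unfolding image_image by (intro INF_cong refl) (simp only: F E(2))
    also have "(\<Prod>i\<in>h ` K. prob (X i -` F i \<inter> space M)) = (\<Prod>j\<in>K. prob (A j))"
      unfolding prod.reindex[OF inj] comp_def by (intro prod.cong refl) (simp only: F E(2))
    finally show "prob (\<Inter>j\<in>K. A j) = (\<Prod>j\<in>K. prob (A j))" .
  qed
qed

text \<open>The hypothesis \<open>ind\<close> speaks of events that restrict every variable of a
  half. An event about a subset \<open>J\<close> is brought to this form by the trivial constraint
  \<open>space (S j)\<close> on the other variables.\<close>

lemma (in prob_space) indep_vars_join:
  assumes I: "finite I1" "finite I2" "I1 \<inter> I2 = {}"
    and X1: "indep_vars S X I1" and X2: "indep_vars S X I2"
    and ind: "\<And>E1 E2. \<lbrakk>\<And>j. j \<in> I1 \<Longrightarrow> E1 j \<in> sets (S j); \<And>j. j \<in> I2 \<Longrightarrow> E2 j \<in> sets (S j)\<rbrakk> \<Longrightarrow>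
      prob ({\<omega> \<in> space M. \<forall>j\<in>I1. X j \<omega> \<in> E1 j} \<inter> {\<omega> \<in> space M. \<forall>j\<in>I2. X j \<omega> \<in> E2 j})
        = prob {\<omega> \<in> space M. \<forall>j\<in>I1. X j \<omega> \<in> E1 j} * prob {\<omega> \<in> space M. \<forall>j\<in>I2. X j \<omega> \<in> E2 j}"
  shows "indep_vars S X (I1 \<union> I2)"
proof -
  have rv: "X j \<in> measurable M (S j)" if "j \<in> I1 \<union> I2" for j
    using X1 X2 that unfolding indep_vars_def2 by blast
  have part: "prob {\<omega> \<in> space M. \<forall>j\<in>J. X j \<omega> \<in> E j} = (\<Prod>j\<in>J. prob (X j -` E j \<inter> space M))"
    if iv: "indep_vars S X J" and J: "finite J" and E: "\<And>j. j \<in> J \<Longrightarrow> E j \<in> sets (S j)" for J E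
  proof (cases "J = {}")
    case True
    then show ?thesis by (simp add: prob_space)
  next
    case False
    have "{\<omega> \<in> space M. \<forall>j\<in>J. X j \<omega> \<in> E j} = (\<Inter>j\<in>J. X j -` E j \<inter> space M)" using False by auto
    then show ?thesis using indep_varsD[OF iv False J subset_refl E] by simp
  qed
  show ?thesis
    unfolding indep_vars_def2
  proof (intro conjI ballI rv)
    show "indep_sets (\<lambda>i. {X i -` A \<inter> space M |A. A \<in> sets (S i)}) (I1 \<union> I2)"
    proof (rule indep_setsI)
      fix i assume "i \<in> I1 \<union> I2"
      then show "{X i -` A \<inter> space M |A. A \<in> sets (S i)} \<subseteq> events" using measurable_sets[OF rv] by auto
    next
      fix A J assume J: "J \<noteq> {}" "J \<subseteq> I1 \<union> I2" "finite J" and A: "\<forall>j\<in>J. A j \<in> {X j -` A \<inter> space M |A. A \<in> sets (S j)}"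
      then have "\<forall>j\<in>J. \<exists>E. E \<in> sets (S j) \<and> A j = X j -` E \<inter> space M" by blast
      from bchoice[OF this] obtain E where
        E: "\<And>j. j \<in> J \<Longrightarrow> E j \<in> sets (S j)" "\<And>j. j \<in> J \<Longrightarrow> A j = X j -` E j \<inter> space M" by blast
      define F where "F j = (if j \<in> J then E j else space (S j))" for j
      have F: "F j \<in> sets (S j)" for j using E by (simp add: F_def)
      have triv: "X j -` space (S j) \<inter> space M = space M" if "j \<in> I1 \<union> I2" for j
        using measurable_space[OF rv[OF that]] by auto
      have PF: "(\<Prod>j\<in>I. prob (X j -` F j \<inter> space M)) = (\<Prod>j\<in>I \<inter> J. prob (A j))" if "finite I" "I \<subseteq> I1 \<union> I2" for I
      proof (rule prod.mono_neutral_cong_right)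
        show "\<forall>i\<in>I - I \<inter> J. prob (X i -` F i \<inter> space M) = 1"
          using that triv by (auto simp: F_def prob_space)
      qed (use that E in \<open>auto simp: F_def\<close>)
      have "(\<Inter>j\<in>J. A j) = {\<omega> \<in> space M. \<forall>j\<in>I1. X j \<omega> \<in> F j} \<inter> {\<omega> \<in> space M. \<forall>j\<in>I2. X j \<omega> \<in> F j}"
      proof (intro set_eqI iffI)
        fix \<omega> assume \<omega>: "\<omega> \<in> (\<Inter>j\<in>J. A j)"
        then have sp: "\<omega> \<in> space M" using J(1) E(2) by blast
        have "X j \<omega> \<in> F j" if "j \<in> I1 \<union> I2" for j
        proof (cases "j \<in> J")
          case True
          then have "\<omega> \<in> A j" using \<omega> by blast
          then show ?thesis using True by (simp add: E(2)[OF True] F_def)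
        next
          case False
          then show ?thesis using measurable_space[OF rv[OF that] sp] by (simp add: F_def)
        qed
        then show "\<omega> \<in> {\<omega> \<in> space M. \<forall>j\<in>I1. X j \<omega> \<in> F j} \<inter> {\<omega> \<in> space M. \<forall>j\<in>I2. X j \<omega> \<in> F j}"
          using sp by blast
      next
        fix \<omega> assume \<omega>: "\<omega> \<in> {\<omega> \<in> space M. \<forall>j\<in>I1. X j \<omega> \<in> F j} \<inter> {\<omega> \<in> space M. \<forall>j\<in>I2. X j \<omega> \<in> F j}"
        show "\<omega> \<in> (\<Inter>j\<in>J. A j)"
        proof
          fix j assume j: "j \<in> J"
          then have "X j \<omega> \<in> F j" using J(2) \<omega> by blast
          then show "\<omega> \<in> A j" unfolding E(2)[OF j] using j \<omega> by (simp add: F_def)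
        qed
      qed
      then have "prob (\<Inter>j\<in>J. A j) = prob {\<omega> \<in> space M. \<forall>j\<in>I1. X j \<omega> \<in> F j} * prob {\<omega> \<in> space M. \<forall>j\<in>I2. X j \<omega> \<in> F j}"
        using ind[of F F] F by simp
      also have "\<dots> = (\<Prod>j\<in>I1 \<inter> J. prob (A j)) * (\<Prod>j\<in>I2 \<inter> J. prob (A j))"
        unfolding part[OF X1 I(1) F] part[OF X2 I(2) F] PF[OF I(1) Un_upper1] PF[OF I(2) Un_upper2] ..
      also have "\<dots> = (\<Prod>j\<in>(I1 \<inter> J) \<union> (I2 \<inter> J). prob (A j))"
        using I J by (intro prod.union_disjoint[symmetric]) auto
      also have "(I1 \<inter> J) \<union> (I2 \<inter> J) = J" using J(2) by blast
      finally show "prob (\<Inter>j\<in>J. A j) = (\<Prod>j\<in>J. prob (A j))" .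
    qed
  qed
qed

theorem theorem3p2:
  fixes M :: "'w measure"
    and \<X> :: "(real ^ 'd) set"
    and X :: "nat \<Rightarrow> 'w \<Rightarrow> real ^ 'd"
    and Y :: "nat \<Rightarrow> 'w \<Rightarrow> nat"
    and B :: "nat set \<Rightarrow> nat \<Rightarrow> 'w \<Rightarrow> nat"
    and P :: "((real ^ 'd) \<times> nat) measure"
    and n p k :: nat
    and \<kappa> \<gamma> C1 C2 \<Gamma> m l :: real
    and R :: "'w \<Rightarrow> real"
  assumes "prob_space M"
    and "1 \<le> p" and "1 \<le> k" and "p + k \<le> n"
    \<comment> \<open>the sample: i.i.d. copies of a pair with law \<open>P\<close>\<close>
    and "\<And>i \<omega>. i \<in> {1..n} \<Longrightarrow> \<omega> \<in> space M \<Longrightarrow> X i \<omega> \<in> \<X>"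
    and "prob_space.indep_vars M (\<lambda>_. borel \<Otimes>\<^sub>M count_space {0, 1}) (\<lambda>i \<omega>. (X i \<omega>, Y i \<omega>)) {1..n}"
    and "\<And>i. i \<in> {1..n} \<Longrightarrow> distr M (borel \<Otimes>\<^sub>M count_space {0, 1}) (\<lambda>\<omega>. (X i \<omega>, Y i \<omega>)) = P"
    \<comment> \<open>the coins: fair, independent, and independent of the sample\<close>
    and "prob_space.indep_vars M (\<lambda>_. count_space {0, 1}) (\<lambda>(e, i). B e i) (coin_index n p)"
    and "\<And>e i. (e, i) \<in> coin_index n p \<Longrightarrow> measure M {\<omega> \<in> space M. B e i \<omega> = 1} = 1/2"
    and "prob_space.indep_set M
           (sets (vimage_algebra (space M) (\<lambda>\<omega>. \<lambda>i\<in>{1..n}. (X i \<omega>, Y i \<omega>))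
                    (\<Pi>\<^sub>M i\<in>{1..n}. borel \<Otimes>\<^sub>M count_space {0, 1})))
           (sets (vimage_algebra (space M) (\<lambda>\<omega>. \<lambda>c\<in>coin_index n p. B (fst c) (snd c) \<omega>)
                    (\<Pi>\<^sub>M c\<in>coin_index n p. count_space {0, 1})))"
    \<comment> \<open>the constants\<close>
    and "stone_constant (distr P borel fst) \<gamma>"
    and "efron_stein_constant TYPE((real ^ 'd) \<times> nat) \<kappa>" and "\<kappa> \<le> 1.271"
    and "C1 = 128 * \<kappa> * \<gamma> / sqrt (2 * pi)"
    and "C2 = 4 * \<gamma> * sqrt (2 * \<kappa>)"
    and "\<Gamma> = 2 * sqrt (2 * exp 1) * max (sqrt (2 * C1)) (2 * C2)"
    and "R = (\<lambda>\<omega>. lpo_risk k p n (\<lambda>i. X i \<omega>) (\<lambda>i. Y i \<omega>) (\<lambda>e i. B e i \<omega>))"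
    and "m = real n - real p + 1"
    and "l = of_int \<lfloor>real n / m\<rfloor>"
  shows "(\<integral>\<omega>. (R \<omega> - (\<integral>\<omega>'. R \<omega>' \<partial>M))\<^sup>2 \<partial>M) \<le> C1 * (real k powr (3/2) / m)
    \<and> (\<forall>q>2. (\<integral>\<omega>. \<bar>R \<omega> - (\<integral>\<omega>'. R \<omega>' \<partial>M)\<bar> powr q \<partial>M)
          \<le> (C2 * real k) powr q * (q / m) powr (q / 2))
    \<and> (real n / 2 + 1 < real p \<longrightarrow>
          (\<integral>\<omega>. (R \<omega> - (\<integral>\<omega>'. R \<omega>' \<partial>M))\<^sup>2 \<partial>M) \<le> C1 * (real k powr (3/2) / (m * l))
        \<and> (\<forall>q>2. (\<integral>\<omega>. \<bar>R \<omega> - (\<integral>\<omega>'. R \<omega>' \<partial>M)\<bar> powr q \<partial>M)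
              \<le> l * \<Gamma> powr q *
                 (max (real k powr (3/2) / (m * l) * q)
                      ((real k)\<^sup>2 / (m * l\<^sup>2) * q ^ 3)) powr (q / 2)))"
proof -
  interpret M: prob_space M by fact
  let ?S = "borel \<Otimes>\<^sub>M count_space {0, 1} :: ((real ^ 'd) \<times> nat) measure"
  let ?C = "coin_index n p"
  have finC: "finite ?C" by (simp add: coin_index_def training_sets_def)
  have n1: "1 \<in> {1..n}" using assms(3,4) by simp
  define N where "N = n + card ?C"
  obtain pos where pos: "bij_betw pos ?C {n + 1..N}"
  proof -
    have "card ?C = card {n + 1..N}" unfolding N_def by simp
    from finite_same_card_bij[OF finC finite_atLeastAtMost this] that show ?thesis by (elim exE)
  qed
  define inv_pos where "inv_pos = the_inv_into ?C pos"
  have inv_pos: "inv_pos i \<in> ?C" "pos (inv_pos i) = i" if "i \<in> {n + 1..N}" for i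
  proof -
    have i: "i \<in> pos ` ?C" using pos that unfolding bij_betw_def by simp
    show "inv_pos i \<in> ?C" unfolding inv_pos_def by (rule the_inv_into_into[OF bij_betw_imp_inj_on[OF pos] i subset_refl])
    show "pos (inv_pos i) = i" unfolding inv_pos_def by (rule f_the_inv_into_f[OF bij_betw_imp_inj_on[OF pos] i])
  qed
  have pos_inv: "inv_pos (pos c) = c" if "c \<in> ?C" for c
    unfolding inv_pos_def by (rule the_inv_into_f_f[OF bij_betw_imp_inj_on[OF pos] that])
  \<comment> \<open>A coin becomes the label of an observation with point \<open>0\<close>. The last
    branch makes \<open>U i\<close> a random variable for every index, because the locale asks for a
    probability measure \<open>\<mu> i\<close> at all \<open>i\<close>.\<close>
  define U :: "nat \<Rightarrow> 'w \<Rightarrow> (real ^ 'd) \<times> nat" where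
    "U i \<omega> = (if i \<in> {1..n} then (X i \<omega>, Y i \<omega>)
      else if i \<in> {n + 1..N} then (0, B (fst (inv_pos i)) (snd (inv_pos i)) \<omega>) else (X 1 \<omega>, Y 1 \<omega>))" for i \<omega>
  have rvZ: "(\<lambda>\<omega>. (X i \<omega>, Y i \<omega>)) \<in> measurable M ?S" if "i \<in> {1..n}" for i
    by (rule bspec[OF conjunct1[OF assms(6)[unfolded M.indep_vars_def2]] that])
  have rvB: "(\<lambda>\<omega>. B (fst c) (snd c) \<omega>) \<in> measurable M (count_space {0, 1})" if "c \<in> ?C" for c
    by (rule bspec[OF conjunct1[OF assms(8)[unfolded M.indep_vars_def2 case_prod_beta']] that])
  have U_eq: "i \<in> {1..n} \<Longrightarrow> U i = (\<lambda>\<omega>. (X i \<omega>, Y i \<omega>))"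
    "i \<in> {n + 1..N} \<Longrightarrow> U i = (\<lambda>\<omega>. (0, B (fst (inv_pos i)) (snd (inv_pos i)) \<omega>))" for i
  proof -
    show "U i = (\<lambda>\<omega>. (X i \<omega>, Y i \<omega>))" if "i \<in> {1..n}"
      by (rule ext) (simp only: U_def that if_True)
    show "U i = (\<lambda>\<omega>. (0, B (fst (inv_pos i)) (snd (inv_pos i)) \<omega>))" if "i \<in> {n + 1..N}"
    proof -
      have "i \<notin> {1..n}" using that by simp
      then show ?thesis by (intro ext) (simp only: U_def that if_True if_False)
    qed
  qed
  have rvU: "U i \<in> measurable M ?S" for i
  proof -
    consider "i \<in> {1..n}" | "i \<in> {n + 1..N}" | "i \<notin> {1..n}" "i \<notin> {n + 1..N}" by blast
    then show ?thesis
    proof cases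
      case 1
      then show ?thesis unfolding U_eq(1)[OF 1] by (rule rvZ)
    next
      case 2
      show ?thesis unfolding U_eq(2)[OF 2] using rvB[OF inv_pos(1)[OF 2]] by measurable
    next
      case 3
      have "U i \<omega> = (X 1 \<omega>, Y 1 \<omega>)" for \<omega> unfolding U_def if_not_P[OF 3(1)] if_not_P[OF 3(2)] ..
      then have "U i = (\<lambda>\<omega>. (X 1 \<omega>, Y 1 \<omega>))" by (rule ext)
      then show ?thesis using rvZ[OF n1] by (simp only:)
    qed
  qed
  have ivZ: "M.indep_vars (\<lambda>_. ?S) U {1..n}"
    using assms(6) by (rule M.indep_vars_cong[THEN iffD1, rotated -1]) (simp_all only: U_eq)
  have ivB: "M.indep_vars (\<lambda>_. ?S) U {n + 1..N}"
  proof -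
    have pm: "(\<lambda>b. (0, b)) \<in> measurable (count_space {0, 1}) ?S" by measurable
    have B: "M.indep_vars (\<lambda>_. count_space {0, 1}) (\<lambda>c \<omega>. B (fst c) (snd c) \<omega>) ?C"
      using assms(8) unfolding case_prod_beta' .
    have inj: "inj_on inv_pos {n + 1..N}" by (rule inj_on_inverseI[where g = pos]) (rule inv_pos(2))
    have "M.indep_vars (\<lambda>_. ?S) (\<lambda>i \<omega>. (0, B (fst (inv_pos i)) (snd (inv_pos i)) \<omega>)) {n + 1..N}"
      by (rule M.indep_vars_reindex[OF M.indep_vars_compose2[OF B pm] inj inv_pos(1)])
    then show ?thesis
      by (rule M.indep_vars_cong[THEN iffD1, rotated -1]) (simp_all only: U_eq)
  qed
  have iv: "M.indep_vars (\<lambda>_. ?S) U ({1..n} \<union> {n + 1..N})"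
  proof (rule M.indep_vars_join[OF _ _ _ ivZ ivB])
    fix E1 E2 :: "nat \<Rightarrow> ((real ^ 'd) \<times> nat) set"
    assume E1: "\<And>j. j \<in> {1..n} \<Longrightarrow> E1 j \<in> sets ?S" and E2: "\<And>j. j \<in> {n + 1..N} \<Longrightarrow> E2 j \<in> sets ?S"
    let ?Z = "\<lambda>\<omega>. \<lambda>i\<in>{1..n}. (X i \<omega>, Y i \<omega>)" and ?B = "\<lambda>\<omega>. \<lambda>c\<in>?C. B (fst c) (snd c) \<omega>"
    \<comment> \<open>Events about the coordinates \<open>U\<close> are rewritten as preimages under
      the two random vectors whose generated sigma-algebras are independent; for a coin,
      \<open>E2 (pos c)\<close> is cut down to the coin values whose pair with \<open>0\<close> lies
      in it.\<close>
    let ?D1 = "\<Pi>\<^sub>E j\<in>{1..n}. E1 j" and ?D2 = "\<Pi>\<^sub>E c\<in>?C. {b \<in> {0, 1}. (0, b) \<in> E2 (pos c)}"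
    have Z: "?Z \<omega> \<in> ?D1 \<longleftrightarrow> (\<forall>j\<in>{1..n}. U j \<omega> \<in> E1 j)" for \<omega>
      by (simp add: PiE_iff U_eq(1) del: One_nat_def atLeastAtMost_iff)
    have e1: "{\<omega> \<in> space M. \<forall>j\<in>{1..n}. U j \<omega> \<in> E1 j} = ?Z -` ?D1 \<inter> space M"
      by (rule set_eqI) (unfold mem_Collect_eq Int_iff vimage_eq Z, rule conj_commute)
    have D1: "?D1 \<in> sets (\<Pi>\<^sub>M i\<in>{1..n}. ?S)"
      by (rule sets_PiM_I_finite) (rule finite_atLeastAtMost, rule E1)
    have D2: "?D2 \<in> sets (\<Pi>\<^sub>M c\<in>?C. count_space {0, 1})"
      by (rule sets_PiM_I_finite[OF finC]) (auto simp: sets_count_space)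
    have e2: "{\<omega> \<in> space M. \<forall>j\<in>{n + 1..N}. U j \<omega> \<in> E2 j} = ?B -` ?D2 \<inter> space M"
    proof (intro set_eqI iffI)
      fix \<omega> assume \<omega>: "\<omega> \<in> {\<omega> \<in> space M. \<forall>j\<in>{n + 1..N}. U j \<omega> \<in> E2 j}"
      have "B (fst c) (snd c) \<omega> \<in> {b \<in> {0, 1}. (0, b) \<in> E2 (pos c)}" if c: "c \<in> ?C" for c
      proof -
        have pc: "pos c \<in> {n + 1..N}" by (rule bspec[OF bij_betwE[OF pos] c])
        then have "U (pos c) \<omega> \<in> E2 (pos c)" using \<omega> by blast
        then show ?thesis using measurable_space[OF rvB[OF c]] \<omega> by (simp add: U_eq(2)[OF pc] pos_inv[OF c])
      qed
      then show "\<omega> \<in> ?B -` ?D2 \<inter> space M" using \<omega> by (simp add: PiE_iff)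
    next
      fix \<omega> assume \<omega>: "\<omega> \<in> ?B -` ?D2 \<inter> space M"
      have "U j \<omega> \<in> E2 j" if j: "j \<in> {n + 1..N}" for j
      proof -
        have "B (fst (inv_pos j)) (snd (inv_pos j)) \<omega> \<in> {b \<in> {0, 1}. (0, b) \<in> E2 (pos (inv_pos j))}"
          using \<omega> inv_pos(1)[OF j] by (simp add: PiE_iff)
        then show ?thesis by (simp add: U_eq(2)[OF j] inv_pos(2)[OF j])
      qed
      then show "\<omega> \<in> {\<omega> \<in> space M. \<forall>j\<in>{n + 1..N}. U j \<omega> \<in> E2 j}" using \<omega> by blast
    qed
    show "M.prob ({\<omega> \<in> space M. \<forall>j\<in>{1..n}. U j \<omega> \<in> E1 j} \<inter> {\<omega> \<in> space M. \<forall>j\<in>{n + 1..N}. U j \<omega> \<in> E2 j})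
        = M.prob {\<omega> \<in> space M. \<forall>j\<in>{1..n}. U j \<omega> \<in> E1 j} * M.prob {\<omega> \<in> space M. \<forall>j\<in>{n + 1..N}. U j \<omega> \<in> E2 j}"
      unfolding e1 e2
      by (rule M.indep_setD[OF assms(10)]) (rule in_vimage_algebra[OF D1] in_vimage_algebra[OF D2])+
  next
    show "finite {1..n}" by (rule finite_atLeastAtMost)
    show "finite {n + 1..N}" by (rule finite_atLeastAtMost)
    show "{1..n} \<inter> {n + 1..N} = {}" by simp
  qed
  have N_union: "{1..n} \<union> {n + 1..N} = {1..N}" by (auto simp: N_def)
  define \<mu> where "\<mu> i = distr M ?S (U i)" for i
  have \<mu>: "prob_space (\<mu> i)" for i unfolding \<mu>_def by (rule M.prob_space_distr[OF rvU])
  have \<mu>P: "\<mu> i = P" if "i \<in> {1..n}" for i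
    unfolding \<mu>_def U_eq(1)[OF that] by (rule assms(7)[OF that])
  let ?U = "\<lambda>\<omega>. \<lambda>i\<in>{1..N}. U i \<omega>"
  interpret K: knn_sample n p k N \<mu> P pos \<gamma>
  proof (rule knn_sample.intro)
    show "prob_space (\<mu> i)" for i by (rule \<mu>)
    show "sets (\<mu> i) = sets ?S" for i by (simp only: \<mu>_def sets_distr)
    show "\<mu> i = P" if "i \<in> {1..n}" for i by (rule \<mu>P[OF that])
    show "bij_betw pos ?C {n + 1..N}" by (rule pos)
    show "n \<le> N" unfolding N_def by (rule le_add1)
  qed (fact assms(2) assms(3) assms(4) assms(11))+
  have Um: "?U \<in> measurable M (Pi\<^sub>M {1..N} \<mu>)"
  proof (rule measurable_restrict)
    show "U i \<in> measurable M (\<mu> i)" for i unfolding \<mu>_def using rvU[of i] by simp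
  qed
  \<comment> \<open>Independence means that the vector \<open>?U\<close> has the product of the
    marginal laws as its law, so expectations over \<open>M\<close> become integrals over the
    canonical model.\<close>
  have dU: "distr M (Pi\<^sub>M {1..N} \<mu>) ?U = Pi\<^sub>M {1..N} \<mu>"
  proof -
    have ne: "{1..N} \<noteq> {}" using n1 by (simp add: N_def)
    have "distr M (\<Pi>\<^sub>M i\<in>{1..N}. ?S) ?U = (\<Pi>\<^sub>M i\<in>{1..N}. \<mu> i)"
      unfolding \<mu>_def
      by (rule iffD1[OF M.indep_vars_iff_distr_eq_PiM[where X = U and M' = "\<lambda>_. ?S", OF ne rvU] iv[unfolded N_union]])
    moreover have "distr M (Pi\<^sub>M {1..N} \<mu>) ?U = distr M (\<Pi>\<^sub>M i\<in>{1..N}. ?S) ?U"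
    proof (rule distr_cong[OF refl _ refl])
      show "sets (Pi\<^sub>M {1..N} \<mu>) = sets (\<Pi>\<^sub>M i\<in>{1..N}. ?S)"
        by (rule sets_PiM_cong[OF refl]) (simp only: \<mu>_def sets_distr)
    qed
    ultimately show ?thesis by simp
  qed
  \<comment> \<open>The risk reads only the observations \<open>1..n\<close> and the coins in
    \<open>coin_index n p\<close>, all of which are coordinates of \<open>?U\<close>.\<close>
  have R: "R \<omega> = K.risk (?U \<omega>)" for \<omega>
    unfolding assms(17) K.risk_def
  proof (rule lpo_risk_cong)
    fix i assume i: "i \<in> {1..n}"
    have iN: "i \<in> {1..N}" using i unfolding N_def by (simp del: One_nat_def)
    have "?U \<omega> i = (X i \<omega>, Y i \<omega>)" unfolding restrict_apply'[OF iN] U_eq(1)[OF i] ..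
    then show "X i \<omega> = K.pt (?U \<omega>) i" "Y i \<omega> = K.lab (?U \<omega>) i" by (simp_all only: K.pt_def K.lab_def fst_conv snd_conv)
  next
    fix e i assume c: "(e, i) \<in> ?C"
    have pc: "pos (e, i) \<in> {n + 1..N}" by (rule bspec[OF bij_betwE[OF pos] c])
    have pN: "pos (e, i) \<in> {1..N}" using pc by simp
    have "?U \<omega> (pos (e, i)) = (0, B e i \<omega>)"
      unfolding restrict_apply'[OF pN] U_eq(2)[OF pc] pos_inv[OF c] fst_conv snd_conv ..
    then show "B e i \<omega> = K.coin (?U \<omega>) e i" by (simp only: K.coin_def snd_conv)
  qed
  have transfer: "(\<integral>\<omega>. f (R \<omega>) \<partial>M) = (\<integral>u. f (K.risk u) \<partial>Pi\<^sub>M {1..N} \<mu>)"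
    if f: "f \<in> borel_measurable borel" for f :: "real \<Rightarrow> real"
  proof -
    have "(\<lambda>u. f (K.risk u)) \<in> borel_measurable (Pi\<^sub>M {1..N} \<mu>)"
      by (rule measurable_compose[OF K.risk_measurable f])
    from integral_distr[OF Um this] show ?thesis unfolding dU R ..
  qed
  have ER: "(\<integral>\<omega>. R \<omega> \<partial>M) = K.Erisk" by (rule transfer[of "\<lambda>x. x"]) simp
  have mq: "(\<integral>\<omega>. \<bar>R \<omega> - (\<integral>\<omega>'. R \<omega>' \<partial>M)\<bar> powr q \<partial>M) = (\<integral>u. \<bar>K.risk u - K.Erisk\<bar> powr q \<partial>Pi\<^sub>M {1..N} \<mu>)" for q
    unfolding ER by (rule transfer[of "\<lambda>x. \<bar>x - K.Erisk\<bar> powr q" for q]) measurable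
  have m2: "(\<integral>\<omega>. (R \<omega> - (\<integral>\<omega>'. R \<omega>' \<partial>M))\<^sup>2 \<partial>M) = (\<integral>u. \<bar>K.risk u - K.Erisk\<bar> powr 2 \<partial>Pi\<^sub>M {1..N} \<mu>)"
    unfolding mq[symmetric] by simp
  have m: "m = real K.m" unfolding assms(18) K.m_def using assms(4) by simp
  have l: "l = real (n div K.m)" unfolding assms(19) m by (simp add: floor_divide_of_nat_eq)
  note bounds = K.risk_moment_bounds[OF assms(12,14,15,16)]
  show ?thesis
    unfolding m2 mq m l using bounds by (intro conjI allI impI) simp_all
qed

end
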